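(* Let $\mathcal B$ be a modular fusion category over $\mathbb C$ whose fusion ring is one of the eight rings (F1)–(F8) listed in the context, i.e. $\mathcal B\simeq \mathrm{Vec}_{\mathbb Z/6\mathbb Z}^\alpha$, $\mathrm{Vec}_{\mathbb Z/2\mathbb Z}^{-1}\boxtimes\mathrm{Ising}$, $su(3)_2\simeq\mathrm{Fib}\boxtimes\mathrm{Vec}_{\mathbb Z/3\mathbb Z}^1$, $\mathrm{TriCritIsing}$, $\mathrm{Vec}_{\mathbb Z/2\mathbb Z}^{-1}\boxtimes psu(2)_5$, $so(5)_2$, $\mathrm{Fib}\boxtimes psu(2)_5$, or $psu(2)_{11}$, and let $A\in\mathcal B$ be a connected étale algebra. Then in the two-dimensional gapped phase described by the left $\mathcal B$-module category $\mathcal B_A$ of right $A$-modules, the symmetry $\mathcal B$ is spontaneously broken; that is, there exist a simple object $b\in\mathcal B$ and an object $m\in\mathcal B_A$ with $b\triangleright m\not\cong m$.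
   Context: A modular fusion category (MFC) is a spherical braided fusion category over $\mathbb C$ whose $S$-matrix is non-degenerate (no unitarity assumed). An algebra $(A,\mu,u)$ in a fusion category $\mathcal C$ is an associative unital algebra object. The category $\mathcal C_A$ of right $A$-modules in $\mathcal C$ is a left $\mathcal C$-module category, with action bifunctor $\triangleright:\mathcal C\times\mathcal C_A\to\mathcal C_A$ given by the tensor product $c\triangleright m=c\otimes m$. $A$ is separable if $\mathcal C_A$ is semisimple, and connected if $\dim_{\mathbb C}\mathrm{Hom}_{\mathcal C}(1,A)=1$. In a braided fusion category with braiding $c$, $A$ is commutative if $\mu\circ c_{A,A}=\mu$. It is étale if it is commutative and separable. Spontaneous breaking: let $\mathcal C$ be a fusion category and $\mathcal M$ a left $\mathcal C$-module category describing a $\mathcal C$-symmetric gapped phase. A symmetry $c\in\mathcal C$ (a simple object) is spontaneously broken if there exists $m\in\mathcal M$ with $c\triangleright m\not\cong m$. $\mathcal C$ is spontaneously broken if some $c\in\mathcal C$ is spontaneously broken; otherwise it is preserved. The eight fusion rings (each name collectively denotes all MFCs with the given fusion ring): Auxiliary rings: $\mathbb Z[G]$ is the group ring with basis $G$; $R_{\mathrm{Fib}}$ has basis $1,\tau$ with $\tau^2=1+\tau$; $R_{\mathrm{Ising}}$ has basis $1,\psi,\sigma$ with $\psi^2=1$, $\psi\sigma=\sigma\psi=\sigma$, $\sigma^2=1+\psi$; $R_{psu(2)_5}$ is commutative with basis $1,a,b$ and $a^2=1+b$, $ab=a+b$, $b^2=1+a+b$. Tensor products of based rings carry the product basis. (F1)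 $\mathrm{Vec}_{\mathbb Z/6\mathbb Z}^\alpha$: $\mathbb Z[\mathbb Z/6\mathbb Z]$. (F2) $\mathrm{Vec}_{\mathbb Z/2\mathbb Z}^{-1}\boxtimes\mathrm{Ising}$: $\mathbb Z[\mathbb Z/2\mathbb Z]\otimes R_{\mathrm{Ising}}$. (F3) $su(3)_2\simeq\mathrm{Fib}\boxtimes\mathrm{Vec}_{\mathbb Z/3\mathbb Z}^1$: $R_{\mathrm{Fib}}\otimes\mathbb Z[\mathbb Z/3\mathbb Z]$. (F4) $\mathrm{TriCritIsing}$: $R_{\mathrm{Fib}}\otimes R_{\mathrm{Ising}}$. (F5) $\mathrm{Vec}_{\mathbb Z/2\mathbb Z}^{-1}\boxtimes psu(2)_5\simeq su(2)_5$: $\mathbb Z[\mathbb Z/2\mathbb Z]\otimes R_{psu(2)_5}$. (F6) $so(5)_2$: commutative, basis $1,X,Y,Z,V,W$, with $X^2=1$, $XY=Y$, $XZ=Z$, $XV=W$, $XW=V$, $Y^2=1+X+Z$, $YZ=Y+Z$, $YV=YW=V+W$, $Z^2=1+X+Y$, $ZV=ZW=V+W$, $V^2=1+Y+Z$, $VW=X+Y+Z$, $W^2=1+Y+Z$. (F7) $\mathrm{Fib}\boxtimes psu(2)_5$: $R_{\mathrm{Fib}}\otimes R_{psu(2)_5}$. (F8) $psu(2)_{11}$: commutative, basis $1,X,Y,Z,V,W$, with $X^2=1+Y$, $XY=X+Z$, $XZ=Y+V$, $XV=Z+W$, $XW=V+W$, $Y^2=1+Y+V$, $YZ=X+Z+W$,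 $YV=Y+V+W$, $YW=Z+V+W$, $Z^2=1+Y+V+W$, $ZV=X+Z+V+W$, $ZW=Y+Z+V+W$, $V^2=1+Y+Z+V+W$, $VW=X+Y+Z+V+W$, $W^2=1+X+Y+Z+V+W$. *)

theory Defs
  imports "Jordan_Normal_Form.Determinant"
begin

section \<open>Linear, abelian and semisimple categories\<close>

text \<open>
  The Hom-spaces of a \<open>\<complex>\<close>-linear category are subspaces of one ambient complex vector
  space \<open>'m\<close> (one may take the direct sum of all of them). They need not be disjoint, so a morphism
  carries no domain or codomain of its own; every notion below names them where they matter.
  \<open>f \<cdot> g\<close> is \<open>f\<close> after \<open>g\<close>. Nothing is assumed about operations applied to elements outside the Hom-spaces.
\<close>

record ('o, 'm) linear_category =
  Obj :: "'o set"
  Hom :: "'o \<Rightarrow> 'o \<Rightarrow> 'm set"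
  Ident :: "'o \<Rightarrow> 'm"
  Comp :: "'m \<Rightarrow> 'm \<Rightarrow> 'm"  (infixr "\<cdot>\<index>" 70)
  Scale :: "complex \<Rightarrow> 'm \<Rightarrow> 'm"

locale linear_category =
  fixes C :: "('o, 'm::ab_group_add, 'z) linear_category_scheme" (structure)
  assumes vector_space_Scale: "vector_space (Scale C)"
    and subspace_Hom: "\<lbrakk>a \<in> Obj C; b \<in> Obj C\<rbrakk> \<Longrightarrow> module.subspace (Scale C) (Hom C a b)"
    and Id_in_Hom: "a \<in> Obj C \<Longrightarrow> Ident C a \<in> Hom C a a"
    and Comp_in_Hom:
      "\<lbrakk>a \<in> Obj C; b \<in> Obj C; c \<in> Obj C; f \<in> Hom C b c; g \<in> Hom C a b\<rbrakk> \<Longrightarrow> f \<cdot> g \<in> Hom C a c"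
    and Comp_Id: "\<lbrakk>a \<in> Obj C; b \<in> Obj C; f \<in> Hom C a b\<rbrakk> \<Longrightarrow> f \<cdot> Ident C a = f"
    and Id_Comp: "\<lbrakk>a \<in> Obj C; b \<in> Obj C; f \<in> Hom C a b\<rbrakk> \<Longrightarrow> Ident C b \<cdot> f = f"
    and Comp_assoc:
      "\<lbrakk>a \<in> Obj C; b \<in> Obj C; c \<in> Obj C; d \<in> Obj C;
        f \<in> Hom C c d; g \<in> Hom C b c; h \<in> Hom C a b\<rbrakk> \<Longrightarrow> (f \<cdot> g) \<cdot> h = f \<cdot> (g \<cdot> h)"
    and Comp_add_left:
      "\<lbrakk>a \<in> Obj C; b \<in> Obj C; c \<in> Obj C; f \<in> Hom C b c; f' \<in> Hom C b c; g \<in> Hom C a b\<rbrakk>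
        \<Longrightarrow> (f + f') \<cdot> g = (f \<cdot> g) + (f' \<cdot> g)"
    and Comp_add_right:
      "\<lbrakk>a \<in> Obj C; b \<in> Obj C; c \<in> Obj C; f \<in> Hom C b c; g \<in> Hom C a b; g' \<in> Hom C a b\<rbrakk>
        \<Longrightarrow> f \<cdot> (g + g') = (f \<cdot> g) + (f \<cdot> g')"
    and Comp_Scale_left:
      "\<lbrakk>a \<in> Obj C; b \<in> Obj C; c \<in> Obj C; f \<in> Hom C b c; g \<in> Hom C a b\<rbrakk>
        \<Longrightarrow> Scale C k f \<cdot> g = Scale C k (f \<cdot> g)"
    and Comp_Scale_right:
      "\<lbrakk>a \<in> Obj C; b \<in> Obj C; c \<in> Obj C; f \<in> Hom C b c; g \<in> Hom C a b\<rbrakk>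
        \<Longrightarrow> f \<cdot> Scale C k g = Scale C k (f \<cdot> g)"

definition inverse_mor ::
    "('o, 'm, 'z) linear_category_scheme \<Rightarrow> 'o \<Rightarrow> 'o \<Rightarrow> 'm \<Rightarrow> 'm \<Rightarrow> bool" where
  "inverse_mor C a b f g \<longleftrightarrow>
     f \<in> Hom C a b \<and> g \<in> Hom C b a \<and> g \<cdot> f = Ident C a \<and> f \<cdot> g = Ident C b" for C (structure)

definition iso_mor :: "('o, 'm, 'z) linear_category_scheme \<Rightarrow> 'o \<Rightarrow> 'o \<Rightarrow> 'm \<Rightarrow> bool" where
  "iso_mor C a b f \<longleftrightarrow> (\<exists>g. inverse_mor C a b f g)"

definition inv_mor :: "('o, 'm, 'z) linear_category_scheme \<Rightarrow> 'o \<Rightarrow> 'o \<Rightarrow> 'm \<Rightarrow> 'm" where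
  "inv_mor C a b f = (THE g. inverse_mor C a b f g)"

definition isomorphic :: "('o, 'm, 'z) linear_category_scheme \<Rightarrow> 'o \<Rightarrow> 'o \<Rightarrow> bool" where
  "isomorphic C a b \<longleftrightarrow> (\<exists>f. iso_mor C a b f)"

definition zero_object :: "('o, 'm::ab_group_add, 'z) linear_category_scheme \<Rightarrow> 'o \<Rightarrow> bool" where
  "zero_object C z \<longleftrightarrow>
     z \<in> Obj C \<and> (\<forall>a\<in>Obj C. Hom C z a = {0} \<and> Hom C a z = {0})"

definition is_direct_sum ::
    "('o, 'm::ab_group_add, 'z) linear_category_scheme \<Rightarrow> 'o list \<Rightarrow> 'o \<Rightarrow> bool" where
  "is_direct_sum C xs z \<longleftrightarrow>
     z \<in> Obj C \<and> set xs \<subseteq> Obj C \<and>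
     (\<exists>\<iota> \<pi>. (\<forall>i<length xs. \<iota> i \<in> Hom C (xs ! i) z \<and> \<pi> i \<in> Hom C z (xs ! i)) \<and>
       (\<forall>i<length xs. \<forall>j<length xs. \<pi> i \<cdot> \<iota> j = (if i = j then Ident C (xs ! i) else 0)) \<and>
       (\<Sum>i<length xs. \<iota> i \<cdot> \<pi> i) = Ident C z)" for C (structure)

definition mono_mor ::
    "('o, 'm, 'z) linear_category_scheme \<Rightarrow> 'o \<Rightarrow> 'o \<Rightarrow> 'm \<Rightarrow> bool" where
  "mono_mor C a b f \<longleftrightarrow>
     f \<in> Hom C a b \<and>
     (\<forall>c\<in>Obj C. \<forall>g\<in>Hom C c a. \<forall>h\<in>Hom C c a. f \<cdot> g = f \<cdot> h \<longrightarrow> g = h)" for C (structure)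

definition epi_mor ::
    "('o, 'm, 'z) linear_category_scheme \<Rightarrow> 'o \<Rightarrow> 'o \<Rightarrow> 'm \<Rightarrow> bool" where
  "epi_mor C a b f \<longleftrightarrow>
     f \<in> Hom C a b \<and>
     (\<forall>c\<in>Obj C. \<forall>g\<in>Hom C b c. \<forall>h\<in>Hom C b c. g \<cdot> f = h \<cdot> f \<longrightarrow> g = h)" for C (structure)

definition is_kernel ::
    "('o, 'm::ab_group_add, 'z) linear_category_scheme \<Rightarrow> 'o \<Rightarrow> 'o \<Rightarrow> 'm \<Rightarrow> 'o \<Rightarrow> 'm \<Rightarrow> bool" where
  "is_kernel C a b f k \<iota> \<longleftrightarrow>
     k \<in> Obj C \<and> \<iota> \<in> Hom C k a \<and> f \<cdot> \<iota> = 0 \<and>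
     (\<forall>c\<in>Obj C. \<forall>g\<in>Hom C c a. f \<cdot> g = 0 \<longrightarrow> (\<exists>!h. h \<in> Hom C c k \<and> \<iota> \<cdot> h = g))" for C (structure)

definition is_cokernel ::
    "('o, 'm::ab_group_add, 'z) linear_category_scheme \<Rightarrow> 'o \<Rightarrow> 'o \<Rightarrow> 'm \<Rightarrow> 'o \<Rightarrow> 'm \<Rightarrow> bool" where
  "is_cokernel C a b f k \<pi> \<longleftrightarrow>
     k \<in> Obj C \<and> \<pi> \<in> Hom C b k \<and> \<pi> \<cdot> f = 0 \<and>
     (\<forall>c\<in>Obj C. \<forall>g\<in>Hom C b c. g \<cdot> f = 0 \<longrightarrow> (\<exists>!h. h \<in> Hom C k c \<and> h \<cdot> \<pi> = g))" for C (structure)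

locale abelian_category = linear_category +
  assumes zero_object_exists: "\<exists>z. zero_object C z"
    and direct_sum_exists: "\<lbrakk>a \<in> Obj C; b \<in> Obj C\<rbrakk> \<Longrightarrow> \<exists>z. is_direct_sum C [a, b] z"
    and kernel_exists:
      "\<lbrakk>a \<in> Obj C; b \<in> Obj C; f \<in> Hom C a b\<rbrakk> \<Longrightarrow> \<exists>k \<iota>. is_kernel C a b f k \<iota>"
    and cokernel_exists:
      "\<lbrakk>a \<in> Obj C; b \<in> Obj C; f \<in> Hom C a b\<rbrakk> \<Longrightarrow> \<exists>k \<pi>. is_cokernel C a b f k \<pi>"
    and mono_is_kernel:
      "\<lbrakk>a \<in> Obj C; b \<in> Obj C; mono_mor C a b f\<rbrakk> \<Longrightarrow> \<exists>c\<in>Obj C. \<exists>g\<in>Hom C b c. is_kernel C b c g a f"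
    and epi_is_cokernel:
      "\<lbrakk>a \<in> Obj C; b \<in> Obj C; epi_mor C a b f\<rbrakk> \<Longrightarrow> \<exists>c\<in>Obj C. \<exists>g\<in>Hom C c a. is_cokernel C c a g b f"

definition simple_object :: "('o, 'm::ab_group_add, 'z) linear_category_scheme \<Rightarrow> 'o \<Rightarrow> bool" where
  "simple_object C x \<longleftrightarrow>
     x \<in> Obj C \<and> \<not> zero_object C x \<and>
     (\<forall>y\<in>Obj C. \<forall>f. mono_mor C y x f \<longrightarrow> zero_object C y \<or> iso_mor C y x f)"

definition semisimple :: "('o, 'm::ab_group_add, 'z) linear_category_scheme \<Rightarrow> bool" where
  "semisimple C \<longleftrightarrow>
     abelian_category C \<and>
     (\<forall>a\<in>Obj C. \<exists>xs. (\<forall>x\<in>set xs. simple_object C x) \<and> is_direct_sum C xs a)"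

definition simple_transversal ::
    "('o, 'm::ab_group_add, 'z) linear_category_scheme \<Rightarrow> 'o list \<Rightarrow> bool" where
  "simple_transversal C xs \<longleftrightarrow>
     (\<forall>x\<in>set xs. simple_object C x) \<and>
     sorted_wrt (\<lambda>x y. \<not> isomorphic C x y) xs \<and>
     (\<forall>y. simple_object C y \<longrightarrow> (\<exists>x\<in>set xs. isomorphic C x y))"


section \<open>Monoidal and fusion categories\<close>

record ('o, 'm) monoidal_category = "('o, 'm) linear_category" +
  TObj :: "'o \<Rightarrow> 'o \<Rightarrow> 'o"  (infix "\<otimes>\<^sub>o\<index>" 75)
  TMor :: "'m \<Rightarrow> 'm \<Rightarrow> 'm"  (infix "\<otimes>\<^sub>m\<index>" 75)
  UnitObj :: 'o  ("\<one>\<^sub>o\<index>")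
  Assoc :: "'o \<Rightarrow> 'o \<Rightarrow> 'o \<Rightarrow> 'm"
  Lunit :: "'o \<Rightarrow> 'm"
  Runit :: "'o \<Rightarrow> 'm"

locale monoidal_category = linear_category C
  for C :: "('o, 'm::ab_group_add, 'z) monoidal_category_scheme" (structure) +
  assumes TObj_in_Obj: "\<lbrakk>a \<in> Obj C; b \<in> Obj C\<rbrakk> \<Longrightarrow> a \<otimes>\<^sub>o b \<in> Obj C"
    and One_in_Obj: "\<one>\<^sub>o \<in> Obj C"
    and TMor_in_Hom:
      "\<lbrakk>a \<in> Obj C; a' \<in> Obj C; b \<in> Obj C; b' \<in> Obj C; f \<in> Hom C a a'; g \<in> Hom C b b'\<rbrakk>
        \<Longrightarrow> f \<otimes>\<^sub>m g \<in> Hom C (a \<otimes>\<^sub>o b) (a' \<otimes>\<^sub>o b')"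
    and TMor_Id: "\<lbrakk>a \<in> Obj C; b \<in> Obj C\<rbrakk> \<Longrightarrow> Ident C a \<otimes>\<^sub>m Ident C b = Ident C (a \<otimes>\<^sub>o b)"
    and TMor_Comp:
      "\<lbrakk>a \<in> Obj C; a' \<in> Obj C; a'' \<in> Obj C; b \<in> Obj C; b' \<in> Obj C; b'' \<in> Obj C;
        f \<in> Hom C a' a''; f' \<in> Hom C a a'; g \<in> Hom C b' b''; g' \<in> Hom C b b'\<rbrakk>
        \<Longrightarrow> (f \<cdot> f') \<otimes>\<^sub>m (g \<cdot> g') = (f \<otimes>\<^sub>m g) \<cdot> (f' \<otimes>\<^sub>m g')"
    and TMor_add_left:
      "\<lbrakk>a \<in> Obj C; a' \<in> Obj C; b \<in> Obj C; b' \<in> Obj C;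
        f \<in> Hom C a a'; f' \<in> Hom C a a'; g \<in> Hom C b b'\<rbrakk>
        \<Longrightarrow> (f + f') \<otimes>\<^sub>m g = (f \<otimes>\<^sub>m g) + (f' \<otimes>\<^sub>m g)"
    and TMor_add_right:
      "\<lbrakk>a \<in> Obj C; a' \<in> Obj C; b \<in> Obj C; b' \<in> Obj C;
        f \<in> Hom C a a'; g \<in> Hom C b b'; g' \<in> Hom C b b'\<rbrakk>
        \<Longrightarrow> f \<otimes>\<^sub>m (g + g') = (f \<otimes>\<^sub>m g) + (f \<otimes>\<^sub>m g')"
    and TMor_Scale_left:
      "\<lbrakk>a \<in> Obj C; a' \<in> Obj C; b \<in> Obj C; b' \<in> Obj C; f \<in> Hom C a a'; g \<in> Hom C b b'\<rbrakk>
        \<Longrightarrow> Scale C k f \<otimes>\<^sub>m g = Scale C k (f \<otimes>\<^sub>m g)"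
    and TMor_Scale_right:
      "\<lbrakk>a \<in> Obj C; a' \<in> Obj C; b \<in> Obj C; b' \<in> Obj C; f \<in> Hom C a a'; g \<in> Hom C b b'\<rbrakk>
        \<Longrightarrow> f \<otimes>\<^sub>m Scale C k g = Scale C k (f \<otimes>\<^sub>m g)"
    and Assoc_iso:
      "\<lbrakk>a \<in> Obj C; b \<in> Obj C; c \<in> Obj C\<rbrakk>
        \<Longrightarrow> iso_mor C ((a \<otimes>\<^sub>o b) \<otimes>\<^sub>o c) (a \<otimes>\<^sub>o (b \<otimes>\<^sub>o c)) (Assoc C a b c)"
    and Lunit_iso: "a \<in> Obj C \<Longrightarrow> iso_mor C (\<one>\<^sub>o \<otimes>\<^sub>o a) a (Lunit C a)"
    and Runit_iso: "a \<in> Obj C \<Longrightarrow> iso_mor C (a \<otimes>\<^sub>o \<one>\<^sub>o) a (Runit C a)"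
    and Assoc_natural:
      "\<lbrakk>a \<in> Obj C; a' \<in> Obj C; b \<in> Obj C; b' \<in> Obj C; c \<in> Obj C; c' \<in> Obj C;
        f \<in> Hom C a a'; g \<in> Hom C b b'; h \<in> Hom C c c'\<rbrakk>
        \<Longrightarrow> Assoc C a' b' c' \<cdot> ((f \<otimes>\<^sub>m g) \<otimes>\<^sub>m h) = (f \<otimes>\<^sub>m (g \<otimes>\<^sub>m h)) \<cdot> Assoc C a b c"
    and Lunit_natural:
      "\<lbrakk>a \<in> Obj C; a' \<in> Obj C; f \<in> Hom C a a'\<rbrakk>
        \<Longrightarrow> Lunit C a' \<cdot> (Ident C \<one>\<^sub>o \<otimes>\<^sub>m f) = f \<cdot> Lunit C a"
    and Runit_natural:
      "\<lbrakk>a \<in> Obj C; a' \<in> Obj C; f \<in> Hom C a a'\<rbrakk>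
        \<Longrightarrow> Runit C a' \<cdot> (f \<otimes>\<^sub>m Ident C \<one>\<^sub>o) = f \<cdot> Runit C a"
    and pentagon:
      "\<lbrakk>a \<in> Obj C; b \<in> Obj C; c \<in> Obj C; d \<in> Obj C\<rbrakk>
        \<Longrightarrow> (Ident C a \<otimes>\<^sub>m Assoc C b c d) \<cdot> Assoc C a (b \<otimes>\<^sub>o c) d \<cdot> (Assoc C a b c \<otimes>\<^sub>m Ident C d)
          = Assoc C a b (c \<otimes>\<^sub>o d) \<cdot> Assoc C (a \<otimes>\<^sub>o b) c d"
    and triangle:
      "\<lbrakk>a \<in> Obj C; b \<in> Obj C\<rbrakk>
        \<Longrightarrow> (Ident C a \<otimes>\<^sub>m Lunit C b) \<cdot> Assoc C a \<one>\<^sub>o b = Runit C a \<otimes>\<^sub>m Ident C b"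

abbreviation Assoc_inv ::
    "('o, 'm, 'z) monoidal_category_scheme \<Rightarrow> 'o \<Rightarrow> 'o \<Rightarrow> 'o \<Rightarrow> 'm" where
  "Assoc_inv C a b c \<equiv>
     inv_mor C (TObj C (TObj C a b) c) (TObj C a (TObj C b c)) (Assoc C a b c)"

abbreviation Runit_inv :: "('o, 'm, 'z) monoidal_category_scheme \<Rightarrow> 'o \<Rightarrow> 'm" where
  "Runit_inv C a \<equiv> inv_mor C (TObj C a (UnitObj C)) a (Runit C a)"

text \<open>\<open>x'\<close> is a left dual of \<open>x\<close>, equivalently \<open>x\<close> is a right dual of \<open>x'\<close>.\<close>

definition left_dual ::
    "('o, 'm, 'z) monoidal_category_scheme \<Rightarrow> 'o \<Rightarrow> 'o \<Rightarrow> 'm \<Rightarrow> 'm \<Rightarrow> bool" where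
  "left_dual C x x' e k \<longleftrightarrow>
     x \<in> Obj C \<and> x' \<in> Obj C \<and> e \<in> Hom C (x' \<otimes>\<^sub>o x) \<one>\<^sub>o \<and> k \<in> Hom C \<one>\<^sub>o (x \<otimes>\<^sub>o x') \<and>
     Runit C x \<cdot> (Ident C x \<otimes>\<^sub>m e) \<cdot> Assoc C x x' x \<cdot> (k \<otimes>\<^sub>m Ident C x) = Lunit C x \<and>
     Lunit C x' \<cdot> (e \<otimes>\<^sub>m Ident C x') \<cdot> Assoc_inv C x' x x' \<cdot> (Ident C x' \<otimes>\<^sub>m k) = Runit C x'"
  for C (structure)

locale fusion_category = monoidal_category +
  assumes semisimple: "semisimple C"
    and Hom_finite_dim:
      "\<lbrakk>a \<in> Obj C; b \<in> Obj C\<rbrakk> \<Longrightarrow> \<exists>S. finite S \<and> Hom C a b \<subseteq> module.span (Scale C) S"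
    and finitely_many_simples: "\<exists>xs. simple_transversal C xs"
    and simple_One: "simple_object C \<one>\<^sub>o"
    and left_dual_exists: "x \<in> Obj C \<Longrightarrow> \<exists>y e k. left_dual C x y e k"
    and right_dual_exists: "x \<in> Obj C \<Longrightarrow> \<exists>y e k. left_dual C y x e k"


section \<open>Modular fusion categories\<close>

record ('o, 'm) braided_category = "('o, 'm) monoidal_category" +
  Braid :: "'o \<Rightarrow> 'o \<Rightarrow> 'm"

locale braided_fusion_category = fusion_category C
  for C :: "('o, 'm::ab_group_add, 'z) braided_category_scheme" (structure) +
  assumes Braid_iso:
      "\<lbrakk>a \<in> Obj C; b \<in> Obj C\<rbrakk> \<Longrightarrow> iso_mor C (a \<otimes>\<^sub>o b) (b \<otimes>\<^sub>o a) (Braid C a b)"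
    and Braid_natural:
      "\<lbrakk>a \<in> Obj C; a' \<in> Obj C; b \<in> Obj C; b' \<in> Obj C; f \<in> Hom C a a'; g \<in> Hom C b b'\<rbrakk>
        \<Longrightarrow> Braid C a' b' \<cdot> (f \<otimes>\<^sub>m g) = (g \<otimes>\<^sub>m f) \<cdot> Braid C a b"
    and hexagon:
      "\<lbrakk>a \<in> Obj C; b \<in> Obj C; c \<in> Obj C\<rbrakk>
        \<Longrightarrow> Assoc C b c a \<cdot> Braid C a (b \<otimes>\<^sub>o c) \<cdot> Assoc C a b c
          = (Ident C b \<otimes>\<^sub>m Braid C a c) \<cdot> Assoc C b a c \<cdot> (Braid C a b \<otimes>\<^sub>m Ident C c)"
    and hexagon':
      "\<lbrakk>a \<in> Obj C; b \<in> Obj C; c \<in> Obj C\<rbrakk>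
        \<Longrightarrow> Assoc_inv C c a b \<cdot> Braid C (a \<otimes>\<^sub>o b) c \<cdot> Assoc_inv C a b c
          = (Braid C a c \<otimes>\<^sub>m Ident C b) \<cdot> Assoc_inv C a c b \<cdot> (Ident C a \<otimes>\<^sub>m Braid C b c)"

text \<open>
  \<open>Dual\<close>, \<open>Ev\<close>, \<open>Coev\<close> is a choice of left duals, which makes \<open>x \<mapsto> Dual (Dual x)\<close> a monoidal functor,
  and \<open>Piv x : x \<rightarrow> Dual (Dual x)\<close> is the pivotal structure.
\<close>

record ('o, 'm) pivotal_braided_category = "('o, 'm) braided_category" +
  Dual :: "'o \<Rightarrow> 'o"
  Ev :: "'o \<Rightarrow> 'm"
  Coev :: "'o \<Rightarrow> 'm"
  Piv :: "'o \<Rightarrow> 'm"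

text \<open>
  The morphism \<open>u \<rightarrow> Dual v\<close> corresponding to \<open>g : u \<otimes> v \<rightarrow> \<one>\<close>, i.e. the unique \<open>h\<close> with
  \<open>Ev v \<cdot> (h \<otimes> Ident v) = g\<close>.
\<close>

definition mate ::
    "('o, 'm, 'z) pivotal_braided_category_scheme \<Rightarrow> 'o \<Rightarrow> 'o \<Rightarrow> 'm \<Rightarrow> 'm" where
  "mate C u v g =
     Lunit C (Dual C v) \<cdot> (g \<otimes>\<^sub>m Ident C (Dual C v)) \<cdot> Assoc_inv C u v (Dual C v)
       \<cdot> (Ident C u \<otimes>\<^sub>m Coev C v) \<cdot> Runit_inv C u" for C (structure)

text \<open>The dual \<open>Dual y \<rightarrow> Dual x\<close> of \<open>f : x \<rightarrow> y\<close>.\<close>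

definition dual_mor ::
    "('o, 'm, 'z) pivotal_braided_category_scheme \<Rightarrow> 'o \<Rightarrow> 'o \<Rightarrow> 'm \<Rightarrow> 'm" where
  "dual_mor C x y f = mate C (Dual C y) x (Ev C y \<cdot> (Ident C (Dual C y) \<otimes>\<^sub>m f))" for C (structure)

text \<open>The canonical isomorphism \<open>Dual y \<otimes> Dual x \<rightarrow> Dual (x \<otimes> y)\<close>.\<close>

definition dual_tensor ::
    "('o, 'm, 'z) pivotal_braided_category_scheme \<Rightarrow> 'o \<Rightarrow> 'o \<Rightarrow> 'm" where
  "dual_tensor C x y =
     mate C (Dual C y \<otimes>\<^sub>o Dual C x) (x \<otimes>\<^sub>o y)
       (Ev C y
         \<cdot> (Ident C (Dual C y) \<otimes>\<^sub>m
              (Lunit C y \<cdot> (Ev C x \<otimes>\<^sub>m Ident C y) \<cdot> Assoc_inv C (Dual C x) x y))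
         \<cdot> Assoc C (Dual C y) (Dual C x) (x \<otimes>\<^sub>o y))" for C (structure)

text \<open>The trace of \<open>f : x \<rightarrow> x\<close>, as an endomorphism of the unit object and as a number.\<close>

definition trace_mor :: "('o, 'm, 'z) pivotal_braided_category_scheme \<Rightarrow> 'o \<Rightarrow> 'm \<Rightarrow> 'm" where
  "trace_mor C x f =
     Ev C (Dual C x) \<cdot> ((Piv C x \<cdot> f) \<otimes>\<^sub>m Ident C (Dual C x)) \<cdot> Coev C x" for C (structure)

definition ctrace :: "('o, 'm, 'z) pivotal_braided_category_scheme \<Rightarrow> 'o \<Rightarrow> 'm \<Rightarrow> complex" where
  "ctrace C x f = (THE k. trace_mor C x f = Scale C k (Ident C \<one>\<^sub>o))" for C (structure)

text \<open>
  \<open>Piv_tensor\<close> is monoidality of \<open>Piv\<close>: the structure isomorphism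
  \<open>Dual (Dual x) \<otimes> Dual (Dual y) \<rightarrow> Dual (Dual (x \<otimes> y))\<close> of the double dual functor is
  \<open>dual_tensor (Dual y) (Dual x)\<close> followed by the inverse of the dual of \<open>dual_tensor x y\<close>.
\<close>

locale spherical_braided_fusion_category = braided_fusion_category C
  for C :: "('o, 'm::ab_group_add, 'z) pivotal_braided_category_scheme" (structure) +
  assumes left_dual_Dual: "x \<in> Obj C \<Longrightarrow> left_dual C x (Dual C x) (Ev C x) (Coev C x)"
    and Piv_iso: "x \<in> Obj C \<Longrightarrow> iso_mor C x (Dual C (Dual C x)) (Piv C x)"
    and Piv_natural:
      "\<lbrakk>x \<in> Obj C; y \<in> Obj C; f \<in> Hom C x y\<rbrakk>
        \<Longrightarrow> Piv C y \<cdot> f = dual_mor C (Dual C y) (Dual C x) (dual_mor C x y f) \<cdot> Piv C x"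
    and Piv_tensor:
      "\<lbrakk>x \<in> Obj C; y \<in> Obj C\<rbrakk>
        \<Longrightarrow> dual_mor C (Dual C y \<otimes>\<^sub>o Dual C x) (Dual C (x \<otimes>\<^sub>o y)) (dual_tensor C x y) \<cdot> Piv C (x \<otimes>\<^sub>o y)
          = dual_tensor C (Dual C y) (Dual C x) \<cdot> (Piv C x \<otimes>\<^sub>m Piv C y)"
    and spherical:
      "x \<in> Obj C \<Longrightarrow> ctrace C x (Ident C x) = ctrace C (Dual C x) (Ident C (Dual C x))"

definition S_matrix ::
    "('o, 'm, 'z) pivotal_braided_category_scheme \<Rightarrow> 'o list \<Rightarrow> complex mat" where
  "S_matrix C xs =
     mat (length xs) (length xs)
       (\<lambda>(i, j). ctrace C (xs ! i \<otimes>\<^sub>o xs ! j) (Braid C (xs ! j) (xs ! i) \<cdot> Braid C (xs ! i) (xs ! j)))"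
  for C (structure)

locale modular_fusion_category = spherical_braided_fusion_category +
  assumes S_matrix_nondegenerate: "\<exists>xs. simple_transversal C xs \<and> det (S_matrix C xs) \<noteq> 0"


section \<open>Module categories and spontaneous symmetry breaking\<close>

text \<open>\<open>'c\<close> and \<open>'k\<close> are the types of the objects and morphisms of the acting category.\<close>

record ('c, 'k, 'o, 'm) module_category = "('o, 'm) linear_category" +
  Act :: "'c \<Rightarrow> 'o \<Rightarrow> 'o"
  ActMor :: "'k \<Rightarrow> 'm \<Rightarrow> 'm"
  ActAssoc :: "'c \<Rightarrow> 'c \<Rightarrow> 'o \<Rightarrow> 'm"
  ActUnit :: "'o \<Rightarrow> 'm"

locale left_module_category = C: monoidal_category C + M: linear_category M
  for C :: "('c, 'k::ab_group_add, 'y) monoidal_category_scheme"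
    and M :: "('c, 'k, 'o, 'm::ab_group_add, 'z) module_category_scheme" +
  assumes Act_in_Obj: "\<lbrakk>c \<in> Obj C; m \<in> Obj M\<rbrakk> \<Longrightarrow> Act M c m \<in> Obj M"
    and ActMor_in_Hom:
      "\<lbrakk>c \<in> Obj C; c' \<in> Obj C; m \<in> Obj M; m' \<in> Obj M; f \<in> Hom C c c'; g \<in> Hom M m m'\<rbrakk>
        \<Longrightarrow> ActMor M f g \<in> Hom M (Act M c m) (Act M c' m')"
    and ActMor_Id: "\<lbrakk>c \<in> Obj C; m \<in> Obj M\<rbrakk> \<Longrightarrow> ActMor M (Ident C c) (Ident M m) = Ident M (Act M c m)"
    and ActMor_Comp:
      "\<lbrakk>c \<in> Obj C; c' \<in> Obj C; c'' \<in> Obj C; m \<in> Obj M; m' \<in> Obj M; m'' \<in> Obj M;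
        f \<in> Hom C c' c''; f' \<in> Hom C c c'; g \<in> Hom M m' m''; g' \<in> Hom M m m'\<rbrakk>
        \<Longrightarrow> ActMor M (Comp C f f') (Comp M g g') = Comp M (ActMor M f g) (ActMor M f' g')"
    and ActMor_add_left:
      "\<lbrakk>c \<in> Obj C; c' \<in> Obj C; m \<in> Obj M; m' \<in> Obj M;
        f \<in> Hom C c c'; f' \<in> Hom C c c'; g \<in> Hom M m m'\<rbrakk>
        \<Longrightarrow> ActMor M (f + f') g = ActMor M f g + ActMor M f' g"
    and ActMor_add_right:
      "\<lbrakk>c \<in> Obj C; c' \<in> Obj C; m \<in> Obj M; m' \<in> Obj M;
        f \<in> Hom C c c'; g \<in> Hom M m m'; g' \<in> Hom M m m'\<rbrakk>
        \<Longrightarrow> ActMor M f (g + g') = ActMor M f g + ActMor M f g'"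
    and ActMor_Scale_left:
      "\<lbrakk>c \<in> Obj C; c' \<in> Obj C; m \<in> Obj M; m' \<in> Obj M; f \<in> Hom C c c'; g \<in> Hom M m m'\<rbrakk>
        \<Longrightarrow> ActMor M (Scale C k f) g = Scale M k (ActMor M f g)"
    and ActMor_Scale_right:
      "\<lbrakk>c \<in> Obj C; c' \<in> Obj C; m \<in> Obj M; m' \<in> Obj M; f \<in> Hom C c c'; g \<in> Hom M m m'\<rbrakk>
        \<Longrightarrow> ActMor M f (Scale M k g) = Scale M k (ActMor M f g)"
    and ActAssoc_iso:
      "\<lbrakk>c \<in> Obj C; d \<in> Obj C; m \<in> Obj M\<rbrakk>
        \<Longrightarrow> iso_mor M (Act M (TObj C c d) m) (Act M c (Act M d m)) (ActAssoc M c d m)"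
    and ActUnit_iso: "m \<in> Obj M \<Longrightarrow> iso_mor M (Act M (UnitObj C) m) m (ActUnit M m)"
    and ActAssoc_natural:
      "\<lbrakk>c \<in> Obj C; c' \<in> Obj C; d \<in> Obj C; d' \<in> Obj C; m \<in> Obj M; m' \<in> Obj M;
        f \<in> Hom C c c'; u \<in> Hom C d d'; h \<in> Hom M m m'\<rbrakk>
        \<Longrightarrow> Comp M (ActAssoc M c' d' m') (ActMor M (TMor C f u) h)
          = Comp M (ActMor M f (ActMor M u h)) (ActAssoc M c d m)"
    and ActUnit_natural:
      "\<lbrakk>m \<in> Obj M; m' \<in> Obj M; h \<in> Hom M m m'\<rbrakk>
        \<Longrightarrow> Comp M (ActUnit M m') (ActMor M (Ident C (UnitObj C)) h) = Comp M h (ActUnit M m)"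
    and ActAssoc_pentagon:
      "\<lbrakk>b \<in> Obj C; c \<in> Obj C; d \<in> Obj C; m \<in> Obj M\<rbrakk>
        \<Longrightarrow> Comp M (ActMor M (Ident C b) (ActAssoc M c d m))
              (Comp M (ActAssoc M b (TObj C c d) m) (ActMor M (Assoc C b c d) (Ident M m)))
          = Comp M (ActAssoc M b c (Act M d m)) (ActAssoc M (TObj C b c) d m)"
    and ActUnit_triangle:
      "\<lbrakk>c \<in> Obj C; m \<in> Obj M\<rbrakk>
        \<Longrightarrow> Comp M (ActMor M (Ident C c) (ActUnit M m)) (ActAssoc M c (UnitObj C) m)
          = ActMor M (Runit C c) (Ident M m)"

definition symmetry_spontaneously_broken ::
    "('c, 'k, 'o, 'm, 'z) module_category_scheme \<Rightarrow> 'c \<Rightarrow> bool" where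
  "symmetry_spontaneously_broken M c \<longleftrightarrow> (\<exists>m\<in>Obj M. \<not> isomorphic M (Act M c m) m)"

definition spontaneously_broken ::
    "('c, 'k::ab_group_add, 'y) linear_category_scheme
      \<Rightarrow> ('c, 'k, 'o, 'm, 'z) module_category_scheme \<Rightarrow> bool" where
  "spontaneously_broken C M \<longleftrightarrow>
     (\<exists>c. simple_object C c \<and> symmetry_spontaneously_broken M c)"


section \<open>Algebras and their module categories\<close>

record ('o, 'm) algebra_object =
  AObj :: 'o
  AMult :: 'm
  AUnit :: 'm

locale algebra_in = monoidal_category C
  for C :: "('o, 'm::ab_group_add, 'z) monoidal_category_scheme" (structure)
    and A :: "('o, 'm, 'y) algebra_object_scheme" +
  assumes AObj_in_Obj: "AObj A \<in> Obj C"
    and AMult_in_Hom: "AMult A \<in> Hom C (AObj A \<otimes>\<^sub>o AObj A) (AObj A)"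
    and AUnit_in_Hom: "AUnit A \<in> Hom C \<one>\<^sub>o (AObj A)"
    and AMult_assoc:
      "AMult A \<cdot> (AMult A \<otimes>\<^sub>m Ident C (AObj A))
        = AMult A \<cdot> (Ident C (AObj A) \<otimes>\<^sub>m AMult A) \<cdot> Assoc C (AObj A) (AObj A) (AObj A)"
    and AMult_AUnit_left: "AMult A \<cdot> (AUnit A \<otimes>\<^sub>m Ident C (AObj A)) = Lunit C (AObj A)"
    and AMult_AUnit_right: "AMult A \<cdot> (Ident C (AObj A) \<otimes>\<^sub>m AUnit A) = Runit C (AObj A)"

definition right_module ::
    "('o, 'm, 'z) monoidal_category_scheme \<Rightarrow> ('o, 'm, 'y) algebra_object_scheme
      \<Rightarrow> 'o \<Rightarrow> 'm \<Rightarrow> bool" where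
  "right_module C A m p \<longleftrightarrow>
     m \<in> Obj C \<and> p \<in> Hom C (m \<otimes>\<^sub>o AObj A) m \<and>
     p \<cdot> (p \<otimes>\<^sub>m Ident C (AObj A))
       = p \<cdot> (Ident C m \<otimes>\<^sub>m AMult A) \<cdot> Assoc C m (AObj A) (AObj A) \<and>
     p \<cdot> (Ident C m \<otimes>\<^sub>m AUnit A) = Runit C m" for C (structure)

definition right_modules ::
    "('o, 'm, 'z) monoidal_category_scheme \<Rightarrow> ('o, 'm, 'y) algebra_object_scheme
      \<Rightarrow> ('o, 'm, 'o \<times> 'm, 'm) module_category" where
  "right_modules C A =
     \<lparr> Obj = {(m, p). right_module C A m p},
       Hom = (\<lambda>(m, p) (n, q). {f \<in> Hom C m n. f \<cdot> p = q \<cdot> (f \<otimes>\<^sub>m Ident C (AObj A))}),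
       Ident = (\<lambda>(m, p). Ident C m),
       Comp = Comp C,
       Scale = Scale C,
       Act = (\<lambda>c (m, p). (c \<otimes>\<^sub>o m, (Ident C c \<otimes>\<^sub>m p) \<cdot> Assoc C c m (AObj A))),
       ActMor = TMor C,
       ActAssoc = (\<lambda>c d (m, p). Assoc C c d m),
       ActUnit = (\<lambda>(m, p). Lunit C m) \<rparr>" for C (structure)

definition connected_algebra ::
    "('o, 'm::ab_group_add, 'z) monoidal_category_scheme
      \<Rightarrow> ('o, 'm, 'y) algebra_object_scheme \<Rightarrow> bool" where
  "connected_algebra C A \<longleftrightarrow> vector_space.dim (Scale C) (Hom C \<one>\<^sub>o (AObj A)) = 1" for C (structure)

definition separable_algebra ::
    "('o, 'm::ab_group_add, 'z) monoidal_category_scheme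
      \<Rightarrow> ('o, 'm, 'y) algebra_object_scheme \<Rightarrow> bool" where
  "separable_algebra C A \<longleftrightarrow> semisimple (right_modules C A)"

definition commutative_algebra ::
    "('o, 'm, 'z) braided_category_scheme \<Rightarrow> ('o, 'm, 'y) algebra_object_scheme \<Rightarrow> bool" where
  "commutative_algebra C A \<longleftrightarrow> AMult A \<cdot> Braid C (AObj A) (AObj A) = AMult A" for C (structure)

definition etale_algebra ::
    "('o, 'm::ab_group_add, 'z) braided_category_scheme
      \<Rightarrow> ('o, 'm, 'y) algebra_object_scheme \<Rightarrow> bool" where
  "etale_algebra C A \<longleftrightarrow>
     algebra_in C A \<and> commutative_algebra C A \<and> separable_algebra C A"

subsection \<open>The right modules over an algebra form a left module category\<close>

lemma (in linear_category) Comp_typed: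
  "\<lbrakk>g \<in> Hom C a b; f \<in> Hom C b c; a \<in> Obj C; b \<in> Obj C; c \<in> Obj C\<rbrakk> \<Longrightarrow> f \<cdot> g \<in> Hom C a c"
  by (rule Comp_in_Hom)

lemma (in linear_category) Comp_assoc_typed:
  "\<lbrakk>h \<in> Hom C a b; g \<in> Hom C b c; f \<in> Hom C c d; a \<in> Obj C; b \<in> Obj C; c \<in> Obj C; d \<in> Obj C\<rbrakk>
    \<Longrightarrow> f \<cdot> (g \<cdot> h) = (f \<cdot> g) \<cdot> h"
  by (rule Comp_assoc[symmetric])

lemma (in linear_category) iso_mor_in_Hom: "iso_mor C a b f \<Longrightarrow> f \<in> Hom C a b"
  by (auto simp: iso_mor_def inverse_mor_def)

lemma (in linear_category) Comp_eq_left: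
  assumes "x \<cdot> y = z" "w \<in> Hom C a b" "y \<in> Hom C b c" "x \<in> Hom C c d"
    and "a \<in> Obj C" "b \<in> Obj C" "c \<in> Obj C" "d \<in> Obj C"
  shows "x \<cdot> (y \<cdot> w) = z \<cdot> w"
  by (simp only: Comp_assoc_typed[OF assms(2-8)] assms(1))

lemma (in linear_category) iso_mor_cancel_right:
  assumes "g \<cdot> f = h \<cdot> f" "iso_mor C a b f" "g \<in> Hom C b c" "h \<in> Hom C b c"
    and o: "a \<in> Obj C" "b \<in> Obj C" "c \<in> Obj C"
  shows "g = h"
proof -
  obtain f' where f: "f \<in> Hom C a b" "f' \<in> Hom C b a" "f \<cdot> f' = Ident C b"
    using assms(2) by (auto simp: iso_mor_def inverse_mor_def)
  have "g = g \<cdot> (f \<cdot> f')"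
    by (simp only: f(3) Comp_Id[OF o(2,3) assms(3)])
  also have "\<dots> = (h \<cdot> f) \<cdot> f'"
    by (rule Comp_eq_left[OF assms(1) f(2,1) assms(3) o(2,1,2,3)])
  also have "\<dots> = h \<cdot> (f \<cdot> f')"
    by (rule Comp_assoc_typed[OF f(2,1) assms(4) o(2,1,2,3), symmetric])
  also have "\<dots> = h"
    by (simp only: f(3) Comp_Id[OF o(2,3) assms(4)])
  finally show ?thesis .
qed

lemma (in linear_category) iso_mor_cancel_left:
  assumes "f \<cdot> g = f \<cdot> h" "iso_mor C b c f" "g \<in> Hom C a b" "h \<in> Hom C a b"
    and o: "a \<in> Obj C" "b \<in> Obj C" "c \<in> Obj C"
  shows "g = h"
proof -
  obtain f' where f: "f \<in> Hom C b c" "f' \<in> Hom C c b" "f' \<cdot> f = Ident C b"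
    using assms(2) by (auto simp: iso_mor_def inverse_mor_def)
  have "g = Ident C b \<cdot> g"
    by (rule Id_Comp[OF o(1,2) assms(3), symmetric])
  also have "\<dots> = f' \<cdot> (f \<cdot> g)"
    by (rule Comp_eq_left[OF f(3) assms(3) f(1,2) o(1,2,3,2), symmetric])
  also have "\<dots> = f' \<cdot> (f \<cdot> h)"
    by (simp only: assms(1))
  also have "\<dots> = Ident C b \<cdot> h"
    by (rule Comp_eq_left[OF f(3) assms(4) f(1,2) o(1,2,3,2)])
  also have "\<dots> = h"
    by (rule Id_Comp[OF o(1,2) assms(4)])
  finally show ?thesis .
qed

context monoidal_category
begin

lemma Id_iso: "a \<in> Obj C \<Longrightarrow> iso_mor C a a (Ident C a)"
  unfolding iso_mor_def inverse_mor_def by (rule exI[of _ "Ident C a"]) (simp add: Id_in_Hom Id_Comp)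

lemmas Assoc_in_Hom = iso_mor_in_Hom[OF Assoc_iso]
lemmas Lunit_in_Hom = iso_mor_in_Hom[OF Lunit_iso]
lemmas Runit_in_Hom = iso_mor_in_Hom[OF Runit_iso]

lemmas obj_typing = TObj_in_Obj One_in_Obj

lemma TMor_Comp_typed:
  "\<lbrakk>f \<in> Hom C a' a''; f' \<in> Hom C a a'; g \<in> Hom C b' b''; g' \<in> Hom C b b';
    a \<in> Obj C; a' \<in> Obj C; a'' \<in> Obj C; b \<in> Obj C; b' \<in> Obj C; b'' \<in> Obj C\<rbrakk>
    \<Longrightarrow> (f \<otimes>\<^sub>m g) \<cdot> (f' \<otimes>\<^sub>m g') = (f \<cdot> f') \<otimes>\<^sub>m (g \<cdot> g')"
  by (rule TMor_Comp[symmetric])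

lemma Assoc_natural_typed:
  "\<lbrakk>f \<in> Hom C a a'; g \<in> Hom C b b'; h \<in> Hom C c c';
    a \<in> Obj C; a' \<in> Obj C; b \<in> Obj C; b' \<in> Obj C; c \<in> Obj C; c' \<in> Obj C\<rbrakk>
    \<Longrightarrow> Assoc C a' b' c' \<cdot> ((f \<otimes>\<^sub>m g) \<otimes>\<^sub>m h) = (f \<otimes>\<^sub>m (g \<otimes>\<^sub>m h)) \<cdot> Assoc C a b c"
  by (rule Assoc_natural)

lemma TMor_typed:
  "\<lbrakk>f \<in> Hom C a a'; g \<in> Hom C b b'; a \<in> Obj C; a' \<in> Obj C; b \<in> Obj C; b' \<in> Obj C\<rbrakk>
    \<Longrightarrow> f \<otimes>\<^sub>m g \<in> Hom C (a \<otimes>\<^sub>o b) (a' \<otimes>\<^sub>o b')"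
  by (rule TMor_in_Hom)

lemmas mor_typing = Comp_typed TMor_typed Assoc_in_Hom Lunit_in_Hom Runit_in_Hom Id_in_Hom obj_typing

lemma TMor_Comp_left_Id:
  "\<lbrakk>g \<in> Hom C a b; f \<in> Hom C b c; a \<in> Obj C; b \<in> Obj C; c \<in> Obj C; d \<in> Obj C\<rbrakk>
    \<Longrightarrow> Ident C d \<otimes>\<^sub>m (f \<cdot> g) = (Ident C d \<otimes>\<^sub>m f) \<cdot> (Ident C d \<otimes>\<^sub>m g)"
  using TMor_Comp[of d d d a b c "Ident C d" "Ident C d" f g] Id_Comp[of d d "Ident C d"]
  by (simp add: Id_in_Hom)

lemma TMor_Comp_right_Id:
  "\<lbrakk>g \<in> Hom C a b; f \<in> Hom C b c; a \<in> Obj C; b \<in> Obj C; c \<in> Obj C; d \<in> Obj C\<rbrakk>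
    \<Longrightarrow> (f \<cdot> g) \<otimes>\<^sub>m Ident C d = (f \<otimes>\<^sub>m Ident C d) \<cdot> (g \<otimes>\<^sub>m Ident C d)"
  using TMor_Comp[of a b c d d d f g "Ident C d" "Ident C d"] Id_Comp[of d d "Ident C d"]
  by (simp add: Id_in_Hom)

lemma TMor_iso:
  assumes "iso_mor C a a' f" "iso_mor C b b' g" "a \<in> Obj C" "a' \<in> Obj C" "b \<in> Obj C" "b' \<in> Obj C"
  shows "iso_mor C (a \<otimes>\<^sub>o b) (a' \<otimes>\<^sub>o b') (f \<otimes>\<^sub>m g)"
proof -
  obtain f' g' where f: "f \<in> Hom C a a'" "f' \<in> Hom C a' a" "f' \<cdot> f = Ident C a" "f \<cdot> f' = Ident C a'"
    and g: "g \<in> Hom C b b'" "g' \<in> Hom C b' b" "g' \<cdot> g = Ident C b" "g \<cdot> g' = Ident C b'"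
    using assms(1,2) by (auto simp: iso_mor_def inverse_mor_def)
  note o = assms(3-)
  have "(f' \<otimes>\<^sub>m g') \<cdot> (f \<otimes>\<^sub>m g) = Ident C (a \<otimes>\<^sub>o b)"
    by (subst TMor_Comp_typed, (rule f g o)+) (simp only: f g TMor_Id o)
  moreover have "(f \<otimes>\<^sub>m g) \<cdot> (f' \<otimes>\<^sub>m g') = Ident C (a' \<otimes>\<^sub>o b')"
    by (subst TMor_Comp_typed, (rule f g o)+) (simp only: f g TMor_Id o)
  moreover have "f \<otimes>\<^sub>m g \<in> Hom C (a \<otimes>\<^sub>o b) (a' \<otimes>\<^sub>o b')" "f' \<otimes>\<^sub>m g' \<in> Hom C (a' \<otimes>\<^sub>o b') (a \<otimes>\<^sub>o b)"
    by (rule TMor_typed f g o)+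
  ultimately have "inverse_mor C (a \<otimes>\<^sub>o b) (a' \<otimes>\<^sub>o b') (f \<otimes>\<^sub>m g) (f' \<otimes>\<^sub>m g')"
    by (simp add: inverse_mor_def)
  then show ?thesis by (auto simp: iso_mor_def)
qed

lemma One_TMor_faithful:
  assumes "f \<in> Hom C a b" "g \<in> Hom C a b" "a \<in> Obj C" "b \<in> Obj C"
    and "Ident C \<one>\<^sub>o \<otimes>\<^sub>m f = Ident C \<one>\<^sub>o \<otimes>\<^sub>m g"
  shows "f = g"
proof (rule iso_mor_cancel_right[OF _ Lunit_iso[OF assms(3)], of _ _ b])
  show "f \<cdot> Lunit C a = g \<cdot> Lunit C a"
    by (simp only: Lunit_natural[OF assms(3,4,1), symmetric] Lunit_natural[OF assms(3,4,2), symmetric] assms(5))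
qed (simp_all add: assms(1-4) obj_typing)

lemma TMor_One_faithful:
  assumes "f \<in> Hom C a b" "g \<in> Hom C a b" "a \<in> Obj C" "b \<in> Obj C"
    and "f \<otimes>\<^sub>m Ident C \<one>\<^sub>o = g \<otimes>\<^sub>m Ident C \<one>\<^sub>o"
  shows "f = g"
proof (rule iso_mor_cancel_right[OF _ Runit_iso[OF assms(3)], of _ _ b])
  show "f \<cdot> Runit C a = g \<cdot> Runit C a"
    by (simp only: Runit_natural[OF assms(3,4,1), symmetric] Runit_natural[OF assms(3,4,2), symmetric] assms(5))
qed (simp_all add: assms(1-4) obj_typing)

lemma Lunit_TObj:
  assumes a: "a \<in> Obj C" and b: "b \<in> Obj C"
  shows "Lunit C (a \<otimes>\<^sub>o b) \<cdot> Assoc C \<one>\<^sub>o a b = Lunit C a \<otimes>\<^sub>m Ident C b"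
proof (rule One_TMor_faithful)
  let ?i = "Ident C \<one>\<^sub>o"
  let ?p = "Assoc C \<one>\<^sub>o (\<one>\<^sub>o \<otimes>\<^sub>o a) b" and ?q = "Assoc C \<one>\<^sub>o \<one>\<^sub>o a \<otimes>\<^sub>m Ident C b"
  note T = mor_typing a b
  have "((?i \<otimes>\<^sub>m (Lunit C (a \<otimes>\<^sub>o b) \<cdot> Assoc C \<one>\<^sub>o a b)) \<cdot> ?p) \<cdot> ?q
      = (?i \<otimes>\<^sub>m (Lunit C (a \<otimes>\<^sub>o b) \<cdot> Assoc C \<one>\<^sub>o a b)) \<cdot> (?p \<cdot> ?q)"
    by (rule Comp_assoc_typed[symmetric], (rule T)+)
  also have "\<dots> = (?i \<otimes>\<^sub>m Lunit C (a \<otimes>\<^sub>o b)) \<cdot> ((?i \<otimes>\<^sub>m Assoc C \<one>\<^sub>o a b) \<cdot> (?p \<cdot> ?q))"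
    by (subst TMor_Comp_left_Id, (rule T)+, rule Comp_assoc_typed[symmetric], (rule T)+)
  also have "\<dots> = (?i \<otimes>\<^sub>m Lunit C (a \<otimes>\<^sub>o b)) \<cdot> (Assoc C \<one>\<^sub>o \<one>\<^sub>o (a \<otimes>\<^sub>o b) \<cdot> Assoc C (\<one>\<^sub>o \<otimes>\<^sub>o \<one>\<^sub>o) a b)"
    using pentagon[OF One_in_Obj One_in_Obj a b] by simp
  also have "\<dots> = ((?i \<otimes>\<^sub>m Lunit C (a \<otimes>\<^sub>o b)) \<cdot> Assoc C \<one>\<^sub>o \<one>\<^sub>o (a \<otimes>\<^sub>o b)) \<cdot> Assoc C (\<one>\<^sub>o \<otimes>\<^sub>o \<one>\<^sub>o) a b"
    by (rule Comp_assoc_typed, (rule T)+)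
  also have "\<dots> = (Runit C \<one>\<^sub>o \<otimes>\<^sub>m (Ident C a \<otimes>\<^sub>m Ident C b)) \<cdot> Assoc C (\<one>\<^sub>o \<otimes>\<^sub>o \<one>\<^sub>o) a b"
    by (simp only: triangle[OF One_in_Obj TObj_in_Obj[OF a b]] TMor_Id[OF a b])
  also have "\<dots> = Assoc C \<one>\<^sub>o a b \<cdot> ((Runit C \<one>\<^sub>o \<otimes>\<^sub>m Ident C a) \<otimes>\<^sub>m Ident C b)"
    by (rule Assoc_natural_typed[symmetric], (rule T)+)
  also have "\<dots> = Assoc C \<one>\<^sub>o a b \<cdot> (((?i \<otimes>\<^sub>m Lunit C a) \<otimes>\<^sub>m Ident C b) \<cdot> ?q)"
    by (subst triangle[symmetric], (rule T)+, subst TMor_Comp_right_Id, (rule T)+, rule refl)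
  also have "\<dots> = (Assoc C \<one>\<^sub>o a b \<cdot> ((?i \<otimes>\<^sub>m Lunit C a) \<otimes>\<^sub>m Ident C b)) \<cdot> ?q"
    by (rule Comp_assoc_typed, (rule T)+)
  also have "Assoc C \<one>\<^sub>o a b \<cdot> ((?i \<otimes>\<^sub>m Lunit C a) \<otimes>\<^sub>m Ident C b) = (?i \<otimes>\<^sub>m (Lunit C a \<otimes>\<^sub>m Ident C b)) \<cdot> ?p"
    by (rule Assoc_natural_typed, (rule T)+)
  finally have "(?i \<otimes>\<^sub>m (Lunit C (a \<otimes>\<^sub>o b) \<cdot> Assoc C \<one>\<^sub>o a b)) \<cdot> ?p = (?i \<otimes>\<^sub>m (Lunit C a \<otimes>\<^sub>m Ident C b)) \<cdot> ?p"
    by (rule iso_mor_cancel_right) (rule TMor_iso Assoc_iso Id_iso T)+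
  then show "?i \<otimes>\<^sub>m (Lunit C (a \<otimes>\<^sub>o b) \<cdot> Assoc C \<one>\<^sub>o a b) = ?i \<otimes>\<^sub>m (Lunit C a \<otimes>\<^sub>m Ident C b)"
    by (rule iso_mor_cancel_right) (rule Assoc_iso T)+
qed (rule mor_typing a b)+

lemma Runit_TObj:
  assumes a: "a \<in> Obj C" and b: "b \<in> Obj C"
  shows "(Ident C a \<otimes>\<^sub>m Runit C b) \<cdot> Assoc C a b \<one>\<^sub>o = Runit C (a \<otimes>\<^sub>o b)"
proof (rule TMor_One_faithful)
  let ?i = "Ident C \<one>\<^sub>o" and ?l = "Lunit C \<one>\<^sub>o" and ?r = "Runit C b" and ?\<alpha> = "Assoc C a b \<one>\<^sub>o"
  note T = mor_typing a b
  have "?\<alpha> \<cdot> (((Ident C a \<otimes>\<^sub>m ?r) \<cdot> ?\<alpha>) \<otimes>\<^sub>m ?i)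
      = ?\<alpha> \<cdot> (((Ident C a \<otimes>\<^sub>m ?r) \<otimes>\<^sub>m ?i) \<cdot> (?\<alpha> \<otimes>\<^sub>m ?i))"
    by (subst TMor_Comp_right_Id, (rule T)+, rule refl)
  also have "\<dots> = ((Ident C a \<otimes>\<^sub>m (?r \<otimes>\<^sub>m ?i)) \<cdot> Assoc C a (b \<otimes>\<^sub>o \<one>\<^sub>o) \<one>\<^sub>o) \<cdot> (?\<alpha> \<otimes>\<^sub>m ?i)"
    by (rule Comp_eq_left, rule Assoc_natural_typed, (rule T)+)
  also have "\<dots> = (Ident C a \<otimes>\<^sub>m (?r \<otimes>\<^sub>m ?i)) \<cdot> (Assoc C a (b \<otimes>\<^sub>o \<one>\<^sub>o) \<one>\<^sub>o \<cdot> (?\<alpha> \<otimes>\<^sub>m ?i))"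
    by (rule Comp_assoc_typed[symmetric], (rule T)+)
  also have "Ident C a \<otimes>\<^sub>m (?r \<otimes>\<^sub>m ?i)
      = (Ident C a \<otimes>\<^sub>m (Ident C b \<otimes>\<^sub>m ?l)) \<cdot> (Ident C a \<otimes>\<^sub>m Assoc C b \<one>\<^sub>o \<one>\<^sub>o)"
    by (subst triangle[symmetric], (rule T)+, rule TMor_Comp_left_Id, (rule T)+)
  also have "((Ident C a \<otimes>\<^sub>m (Ident C b \<otimes>\<^sub>m ?l)) \<cdot> (Ident C a \<otimes>\<^sub>m Assoc C b \<one>\<^sub>o \<one>\<^sub>o))
        \<cdot> (Assoc C a (b \<otimes>\<^sub>o \<one>\<^sub>o) \<one>\<^sub>o \<cdot> (?\<alpha> \<otimes>\<^sub>m ?i))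
      = (Ident C a \<otimes>\<^sub>m (Ident C b \<otimes>\<^sub>m ?l))
        \<cdot> ((Ident C a \<otimes>\<^sub>m Assoc C b \<one>\<^sub>o \<one>\<^sub>o) \<cdot> (Assoc C a (b \<otimes>\<^sub>o \<one>\<^sub>o) \<one>\<^sub>o \<cdot> (?\<alpha> \<otimes>\<^sub>m ?i)))"
    by (rule Comp_assoc_typed[symmetric], (rule T)+)
  also have "\<dots> = (Ident C a \<otimes>\<^sub>m (Ident C b \<otimes>\<^sub>m ?l))
        \<cdot> (Assoc C a b (\<one>\<^sub>o \<otimes>\<^sub>o \<one>\<^sub>o) \<cdot> Assoc C (a \<otimes>\<^sub>o b) \<one>\<^sub>o \<one>\<^sub>o)"
    by (simp only: pentagon[OF a b One_in_Obj One_in_Obj])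
  also have "\<dots> = (?\<alpha> \<cdot> ((Ident C a \<otimes>\<^sub>m Ident C b) \<otimes>\<^sub>m ?l)) \<cdot> Assoc C (a \<otimes>\<^sub>o b) \<one>\<^sub>o \<one>\<^sub>o"
    by (rule Comp_eq_left, rule Assoc_natural_typed[symmetric], (rule T)+)
  also have "\<dots> = ?\<alpha> \<cdot> (((Ident C a \<otimes>\<^sub>m Ident C b) \<otimes>\<^sub>m ?l) \<cdot> Assoc C (a \<otimes>\<^sub>o b) \<one>\<^sub>o \<one>\<^sub>o)"
    by (rule Comp_assoc_typed[symmetric], (rule T)+)
  also have "\<dots> = ?\<alpha> \<cdot> (Runit C (a \<otimes>\<^sub>o b) \<otimes>\<^sub>m ?i)"
    by (simp only: TMor_Id[OF a b] triangle[OF TObj_in_Obj[OF a b] One_in_Obj])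
  finally show "((Ident C a \<otimes>\<^sub>m ?r) \<cdot> ?\<alpha>) \<otimes>\<^sub>m ?i = Runit C (a \<otimes>\<^sub>o b) \<otimes>\<^sub>m ?i"
    by (rule iso_mor_cancel_left) (rule Assoc_iso T)+
qed (rule mor_typing a b)+

end

context algebra_in
begin

abbreviation (input) "AA \<equiv> AObj A"
abbreviation (input) "iA \<equiv> Ident C (AObj A)"

lemma right_moduleD:
  assumes "right_module C A m p"
  shows "m \<in> Obj C" "p \<in> Hom C (m \<otimes>\<^sub>o AA) m"
    and "p \<cdot> (p \<otimes>\<^sub>m iA) = p \<cdot> (Ident C m \<otimes>\<^sub>m AMult A) \<cdot> Assoc C m AA AA"
    and "p \<cdot> (Ident C m \<otimes>\<^sub>m AUnit A) = Runit C m"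
  using assms by (simp_all add: right_module_def)

lemmas A_typing = AObj_in_Obj AMult_in_Hom AUnit_in_Hom

lemma right_module_Act:
  assumes c: "c \<in> Obj C" and p: "right_module C A m p"
  shows "right_module C A (c \<otimes>\<^sub>o m) ((Ident C c \<otimes>\<^sub>m p) \<cdot> Assoc C c m AA)"
proof -
  let ?c = "Ident C c" and ?m = "Ident C m" and ?a = "Assoc C c m AA"
  let ?p = "?c \<otimes>\<^sub>m p" and ?\<mu> = "AMult A"
  note T = mor_typing c right_moduleD(1,2)[OF p] A_typing
  have m: "m \<in> Obj C" by (rule T)
  have "(?p \<cdot> ?a) \<cdot> ((?p \<cdot> ?a) \<otimes>\<^sub>m iA) = (?p \<cdot> ?a) \<cdot> ((?p \<otimes>\<^sub>m iA) \<cdot> (?a \<otimes>\<^sub>m iA))"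
    by (subst TMor_Comp_right_Id, (rule T)+, rule refl)
  also have "\<dots> = ?p \<cdot> (?a \<cdot> ((?p \<otimes>\<^sub>m iA) \<cdot> (?a \<otimes>\<^sub>m iA)))"
    by (rule Comp_assoc_typed[symmetric], (rule T)+)
  also have "?a \<cdot> ((?p \<otimes>\<^sub>m iA) \<cdot> (?a \<otimes>\<^sub>m iA))
      = ((?c \<otimes>\<^sub>m (p \<otimes>\<^sub>m iA)) \<cdot> Assoc C c (m \<otimes>\<^sub>o AA) AA) \<cdot> (?a \<otimes>\<^sub>m iA)"
    by (rule Comp_eq_left, rule Assoc_natural_typed, (rule T)+)
  also have "\<dots> = (?c \<otimes>\<^sub>m (p \<otimes>\<^sub>m iA)) \<cdot> (Assoc C c (m \<otimes>\<^sub>o AA) AA \<cdot> (?a \<otimes>\<^sub>m iA))"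
    by (rule Comp_assoc_typed[symmetric], (rule T)+)
  also have "?p \<cdot> ((?c \<otimes>\<^sub>m (p \<otimes>\<^sub>m iA)) \<cdot> (Assoc C c (m \<otimes>\<^sub>o AA) AA \<cdot> (?a \<otimes>\<^sub>m iA)))
      = (?c \<otimes>\<^sub>m (p \<cdot> (p \<otimes>\<^sub>m iA))) \<cdot> (Assoc C c (m \<otimes>\<^sub>o AA) AA \<cdot> (?a \<otimes>\<^sub>m iA))"
    by (rule Comp_eq_left, rule TMor_Comp_left_Id[symmetric], (rule T)+)
  also have "?c \<otimes>\<^sub>m (p \<cdot> (p \<otimes>\<^sub>m iA))
      = ?p \<cdot> (?c \<otimes>\<^sub>m (?m \<otimes>\<^sub>m ?\<mu>)) \<cdot> (?c \<otimes>\<^sub>m Assoc C m AA AA)"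
    unfolding right_moduleD(3)[OF p]
    by (subst TMor_Comp_left_Id, (rule T)+, subst TMor_Comp_left_Id, (rule T)+, rule refl)
  also have "(?p \<cdot> (?c \<otimes>\<^sub>m (?m \<otimes>\<^sub>m ?\<mu>)) \<cdot> (?c \<otimes>\<^sub>m Assoc C m AA AA))
        \<cdot> (Assoc C c (m \<otimes>\<^sub>o AA) AA \<cdot> (?a \<otimes>\<^sub>m iA))
      = ?p \<cdot> (((?c \<otimes>\<^sub>m (?m \<otimes>\<^sub>m ?\<mu>)) \<cdot> (?c \<otimes>\<^sub>m Assoc C m AA AA))
        \<cdot> (Assoc C c (m \<otimes>\<^sub>o AA) AA \<cdot> (?a \<otimes>\<^sub>m iA)))"
    by (rule Comp_assoc_typed[symmetric], (rule T)+)
  also have "((?c \<otimes>\<^sub>m (?m \<otimes>\<^sub>m ?\<mu>)) \<cdot> (?c \<otimes>\<^sub>m Assoc C m AA AA))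
        \<cdot> (Assoc C c (m \<otimes>\<^sub>o AA) AA \<cdot> (?a \<otimes>\<^sub>m iA))
      = (?c \<otimes>\<^sub>m (?m \<otimes>\<^sub>m ?\<mu>)) \<cdot> ((?c \<otimes>\<^sub>m Assoc C m AA AA)
        \<cdot> (Assoc C c (m \<otimes>\<^sub>o AA) AA \<cdot> (?a \<otimes>\<^sub>m iA)))"
    by (rule Comp_assoc_typed[symmetric], (rule T)+)
  also have "\<dots> = (?c \<otimes>\<^sub>m (?m \<otimes>\<^sub>m ?\<mu>)) \<cdot> (Assoc C c m (AA \<otimes>\<^sub>o AA) \<cdot> Assoc C (c \<otimes>\<^sub>o m) AA AA)"
    by (simp only: pentagon[OF c m AObj_in_Obj AObj_in_Obj])
  also have "\<dots> = (?a \<cdot> ((?c \<otimes>\<^sub>m ?m) \<otimes>\<^sub>m ?\<mu>)) \<cdot> Assoc C (c \<otimes>\<^sub>o m) AA AA"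
    by (rule Comp_eq_left, rule Assoc_natural_typed[symmetric], (rule T)+)
  also have "\<dots> = ?a \<cdot> (((?c \<otimes>\<^sub>m ?m) \<otimes>\<^sub>m ?\<mu>) \<cdot> Assoc C (c \<otimes>\<^sub>o m) AA AA)"
    by (rule Comp_assoc_typed[symmetric], (rule T)+)
  also have "?p \<cdot> (?a \<cdot> (((?c \<otimes>\<^sub>m ?m) \<otimes>\<^sub>m ?\<mu>) \<cdot> Assoc C (c \<otimes>\<^sub>o m) AA AA))
      = (?p \<cdot> ?a) \<cdot> (((?c \<otimes>\<^sub>m ?m) \<otimes>\<^sub>m ?\<mu>) \<cdot> Assoc C (c \<otimes>\<^sub>o m) AA AA)"
    by (rule Comp_assoc_typed, (rule T)+)
  finally have assoc: "(?p \<cdot> ?a) \<cdot> ((?p \<cdot> ?a) \<otimes>\<^sub>m iA)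
      = (?p \<cdot> ?a) \<cdot> (Ident C (c \<otimes>\<^sub>o m) \<otimes>\<^sub>m ?\<mu>) \<cdot> Assoc C (c \<otimes>\<^sub>o m) AA AA"
    by (simp only: TMor_Id[OF c m])
  have "(?p \<cdot> ?a) \<cdot> ((?c \<otimes>\<^sub>m ?m) \<otimes>\<^sub>m AUnit A) = ?p \<cdot> (?a \<cdot> ((?c \<otimes>\<^sub>m ?m) \<otimes>\<^sub>m AUnit A))"
    by (rule Comp_assoc_typed[symmetric], (rule T)+)
  also have "?a \<cdot> ((?c \<otimes>\<^sub>m ?m) \<otimes>\<^sub>m AUnit A) = (?c \<otimes>\<^sub>m (?m \<otimes>\<^sub>m AUnit A)) \<cdot> Assoc C c m \<one>\<^sub>o"
    by (rule Assoc_natural_typed, (rule T)+)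
  also have "?p \<cdot> ((?c \<otimes>\<^sub>m (?m \<otimes>\<^sub>m AUnit A)) \<cdot> Assoc C c m \<one>\<^sub>o)
      = (?c \<otimes>\<^sub>m (p \<cdot> (?m \<otimes>\<^sub>m AUnit A))) \<cdot> Assoc C c m \<one>\<^sub>o"
    by (rule Comp_eq_left, rule TMor_Comp_left_Id[symmetric], (rule T)+)
  also have "\<dots> = Runit C (c \<otimes>\<^sub>o m)"
    by (simp only: right_moduleD(4)[OF p] Runit_TObj[OF c m])
  finally have unit: "(?p \<cdot> ?a) \<cdot> (Ident C (c \<otimes>\<^sub>o m) \<otimes>\<^sub>m AUnit A) = Runit C (c \<otimes>\<^sub>o m)"
    by (simp only: TMor_Id[OF c m])
  have hom: "?p \<cdot> ?a \<in> Hom C ((c \<otimes>\<^sub>o m) \<otimes>\<^sub>o AA) (c \<otimes>\<^sub>o m)" by ((rule T)+)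
  have obj: "c \<otimes>\<^sub>o m \<in> Obj C" by ((rule T)+)
  show ?thesis
    unfolding right_module_def by (intro conjI obj hom assoc unit)
qed

abbreviation module_map where
  "module_map m p n q f \<equiv> f \<in> Hom C m n \<and> f \<cdot> p = q \<cdot> (f \<otimes>\<^sub>m iA)"

lemma module_map_ActMor:
  assumes c: "c \<in> Obj C" "c' \<in> Obj C" "f \<in> Hom C c c'"
    and p: "right_module C A m p" and q: "right_module C A n q" and g: "module_map m p n q g"
  shows "module_map (c \<otimes>\<^sub>o m) ((Ident C c \<otimes>\<^sub>m p) \<cdot> Assoc C c m AA)
     (c' \<otimes>\<^sub>o n) ((Ident C c' \<otimes>\<^sub>m q) \<cdot> Assoc C c' n AA) (f \<otimes>\<^sub>m g)"
proof
  have g': "g \<in> Hom C m n" "g \<cdot> p = q \<cdot> (g \<otimes>\<^sub>m iA)" using g by auto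
  note T = mor_typing c right_moduleD(1,2)[OF p] right_moduleD(1,2)[OF q] A_typing g'(1)
  show "f \<otimes>\<^sub>m g \<in> Hom C (c \<otimes>\<^sub>o m) (c' \<otimes>\<^sub>o n)" by ((rule T)+)
  have "(f \<otimes>\<^sub>m g) \<cdot> ((Ident C c \<otimes>\<^sub>m p) \<cdot> Assoc C c m AA)
      = ((f \<cdot> Ident C c) \<otimes>\<^sub>m (g \<cdot> p)) \<cdot> Assoc C c m AA"
    by (rule Comp_eq_left, rule TMor_Comp_typed, (rule T)+)
  also have "\<dots> = ((Ident C c' \<cdot> f) \<otimes>\<^sub>m (q \<cdot> (g \<otimes>\<^sub>m iA))) \<cdot> Assoc C c m AA"
    by (simp only: g'(2) Comp_Id[OF c] Id_Comp[OF c])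
  also have "(Ident C c' \<cdot> f) \<otimes>\<^sub>m (q \<cdot> (g \<otimes>\<^sub>m iA)) = (Ident C c' \<otimes>\<^sub>m q) \<cdot> (f \<otimes>\<^sub>m (g \<otimes>\<^sub>m iA))"
    by (rule TMor_Comp_typed[symmetric], (rule T)+)
  also have "((Ident C c' \<otimes>\<^sub>m q) \<cdot> (f \<otimes>\<^sub>m (g \<otimes>\<^sub>m iA))) \<cdot> Assoc C c m AA
      = (Ident C c' \<otimes>\<^sub>m q) \<cdot> ((f \<otimes>\<^sub>m (g \<otimes>\<^sub>m iA)) \<cdot> Assoc C c m AA)"
    by (rule Comp_assoc_typed[symmetric], (rule T)+)
  also have "(f \<otimes>\<^sub>m (g \<otimes>\<^sub>m iA)) \<cdot> Assoc C c m AA = Assoc C c' n AA \<cdot> ((f \<otimes>\<^sub>m g) \<otimes>\<^sub>m iA)"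
    by (rule Assoc_natural_typed[symmetric], (rule T)+)
  also have "(Ident C c' \<otimes>\<^sub>m q) \<cdot> (Assoc C c' n AA \<cdot> ((f \<otimes>\<^sub>m g) \<otimes>\<^sub>m iA))
      = ((Ident C c' \<otimes>\<^sub>m q) \<cdot> Assoc C c' n AA) \<cdot> ((f \<otimes>\<^sub>m g) \<otimes>\<^sub>m iA)"
    by (rule Comp_assoc_typed, (rule T)+)
  finally show "(f \<otimes>\<^sub>m g) \<cdot> ((Ident C c \<otimes>\<^sub>m p) \<cdot> Assoc C c m AA)
      = ((Ident C c' \<otimes>\<^sub>m q) \<cdot> Assoc C c' n AA) \<cdot> ((f \<otimes>\<^sub>m g) \<otimes>\<^sub>m iA)" .
qed

lemma module_map_Assoc:
  assumes c: "c \<in> Obj C" and d: "d \<in> Obj C" and p: "right_module C A m p"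
  shows "module_map ((c \<otimes>\<^sub>o d) \<otimes>\<^sub>o m) ((Ident C (c \<otimes>\<^sub>o d) \<otimes>\<^sub>m p) \<cdot> Assoc C (c \<otimes>\<^sub>o d) m AA)
     (c \<otimes>\<^sub>o (d \<otimes>\<^sub>o m))
     ((Ident C c \<otimes>\<^sub>m ((Ident C d \<otimes>\<^sub>m p) \<cdot> Assoc C d m AA)) \<cdot> Assoc C c (d \<otimes>\<^sub>o m) AA)
     (Assoc C c d m)"
proof
  note T = mor_typing c d right_moduleD(1,2)[OF p] A_typing
  have m: "m \<in> Obj C" by (rule T)
  let ?cdp = "Ident C c \<otimes>\<^sub>m (Ident C d \<otimes>\<^sub>m p)" and ?x = "Assoc C (c \<otimes>\<^sub>o d) m AA"
  let ?y = "Assoc C c (d \<otimes>\<^sub>o m) AA" and ?z = "Ident C c \<otimes>\<^sub>m Assoc C d m AA" and ?w = "Assoc C c d m \<otimes>\<^sub>m iA"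
  show "Assoc C c d m \<in> Hom C ((c \<otimes>\<^sub>o d) \<otimes>\<^sub>o m) (c \<otimes>\<^sub>o (d \<otimes>\<^sub>o m))" by ((rule T)+)
  have "Assoc C c d m \<cdot> (((Ident C c \<otimes>\<^sub>m Ident C d) \<otimes>\<^sub>m p) \<cdot> ?x)
      = (?cdp \<cdot> Assoc C c d (m \<otimes>\<^sub>o AA)) \<cdot> ?x"
    by (rule Comp_eq_left, rule Assoc_natural_typed, (rule T)+)
  also have "\<dots> = ?cdp \<cdot> (Assoc C c d (m \<otimes>\<^sub>o AA) \<cdot> ?x)"
    by (rule Comp_assoc_typed[symmetric], (rule T)+)
  also have "\<dots> = ?cdp \<cdot> (?z \<cdot> (?y \<cdot> ?w))"
    by (simp only: pentagon[OF c d m AObj_in_Obj])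
  also have "\<dots> = (Ident C c \<otimes>\<^sub>m ((Ident C d \<otimes>\<^sub>m p) \<cdot> Assoc C d m AA)) \<cdot> (?y \<cdot> ?w)"
    by (rule Comp_eq_left, rule TMor_Comp_left_Id[symmetric], (rule T)+)
  also have "\<dots> = ((Ident C c \<otimes>\<^sub>m ((Ident C d \<otimes>\<^sub>m p) \<cdot> Assoc C d m AA)) \<cdot> ?y) \<cdot> ?w"
    by (rule Comp_assoc_typed, (rule T)+)
  finally show "Assoc C c d m \<cdot> ((Ident C (c \<otimes>\<^sub>o d) \<otimes>\<^sub>m p) \<cdot> ?x)
      = ((Ident C c \<otimes>\<^sub>m ((Ident C d \<otimes>\<^sub>m p) \<cdot> Assoc C d m AA)) \<cdot> ?y) \<cdot> ?w"
    by (simp only: TMor_Id[OF c d])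
qed

lemma module_map_Lunit:
  assumes p: "right_module C A m p"
  shows "module_map (\<one>\<^sub>o \<otimes>\<^sub>o m) ((Ident C \<one>\<^sub>o \<otimes>\<^sub>m p) \<cdot> Assoc C \<one>\<^sub>o m AA) m p (Lunit C m)"
proof
  note T = mor_typing right_moduleD(1,2)[OF p] A_typing
  have m: "m \<in> Obj C" by (rule T)
  show "Lunit C m \<in> Hom C (\<one>\<^sub>o \<otimes>\<^sub>o m) m" by ((rule T)+)
  have "Lunit C m \<cdot> ((Ident C \<one>\<^sub>o \<otimes>\<^sub>m p) \<cdot> Assoc C \<one>\<^sub>o m AA)
      = (p \<cdot> Lunit C (m \<otimes>\<^sub>o AA)) \<cdot> Assoc C \<one>\<^sub>o m AA"
    by (rule Comp_eq_left,
        rule Lunit_natural[OF TObj_in_Obj[OF m AObj_in_Obj] m right_moduleD(2)[OF p]], (rule T)+)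
  also have "\<dots> = p \<cdot> (Lunit C (m \<otimes>\<^sub>o AA) \<cdot> Assoc C \<one>\<^sub>o m AA)"
    by (rule Comp_assoc_typed[symmetric], (rule T)+)
  also have "\<dots> = p \<cdot> (Lunit C m \<otimes>\<^sub>m iA)"
    by (simp only: Lunit_TObj[OF m AObj_in_Obj])
  finally show "Lunit C m \<cdot> ((Ident C \<one>\<^sub>o \<otimes>\<^sub>m p) \<cdot> Assoc C \<one>\<^sub>o m AA) = p \<cdot> (Lunit C m \<otimes>\<^sub>m iA)" .
qed

lemma module_map_inverse:
  assumes p: "right_module C A m p" and q: "right_module C A n q" and f: "module_map m p n q f"
    and inv: "inverse_mor C m n f g"
  shows "module_map n q m p g"
proof
  have fg: "f \<in> Hom C m n" "g \<in> Hom C n m" "g \<cdot> f = Ident C m" "f \<cdot> g = Ident C n"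
      "f \<cdot> p = q \<cdot> (f \<otimes>\<^sub>m iA)"
    using inv f by (auto simp: inverse_mor_def)
  note T = mor_typing right_moduleD(1,2)[OF p] right_moduleD(1,2)[OF q] A_typing fg(1,2)
  note mn = right_moduleD(1)[OF p] right_moduleD(1)[OF q]
  show "g \<in> Hom C n m" by (rule fg)
  have fgA: "(f \<otimes>\<^sub>m iA) \<cdot> (g \<otimes>\<^sub>m iA) = Ident C (n \<otimes>\<^sub>o AA)"
    by (subst TMor_Comp_right_Id[symmetric], (rule T)+) (simp only: fg TMor_Id[OF mn(2) AObj_in_Obj])
  have "f \<cdot> (p \<cdot> (g \<otimes>\<^sub>m iA)) = (q \<cdot> (f \<otimes>\<^sub>m iA)) \<cdot> (g \<otimes>\<^sub>m iA)"
    by (rule Comp_eq_left[OF fg(5)], (rule T)+)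
  also have "\<dots> = q \<cdot> ((f \<otimes>\<^sub>m iA) \<cdot> (g \<otimes>\<^sub>m iA))"
    by (rule Comp_assoc_typed[symmetric], (rule T)+)
  also have "\<dots> = q"
    by (simp only: fgA Comp_Id[OF TObj_in_Obj[OF mn(2) AObj_in_Obj] mn(2) right_moduleD(2)[OF q]])
  also have "\<dots> = Ident C n \<cdot> q"
    by (rule Id_Comp[OF TObj_in_Obj[OF mn(2) AObj_in_Obj] mn(2) right_moduleD(2)[OF q], symmetric])
  also have "\<dots> = f \<cdot> (g \<cdot> q)"
    by (rule Comp_eq_left[OF fg(4), symmetric], (rule T)+)
  finally show "g \<cdot> q = p \<cdot> (g \<otimes>\<^sub>m iA)"
  proof (rule iso_mor_cancel_left[OF sym])
    show "iso_mor C m n f" using inv by (auto simp: iso_mor_def)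
  qed (rule T)+
qed

lemma module_map_Ident:
  assumes p: "right_module C A m p"
  shows "module_map m p m p (Ident C m)"
proof
  note o = right_moduleD(1)[OF p] AObj_in_Obj
  note T = right_moduleD(2)[OF p]
  show "Ident C m \<in> Hom C m m" by (rule Id_in_Hom[OF o(1)])
  show "Ident C m \<cdot> p = p \<cdot> (Ident C m \<otimes>\<^sub>m iA)"
    by (simp only: TMor_Id[OF o] Comp_Id[OF TObj_in_Obj[OF o] o(1) T] Id_Comp[OF TObj_in_Obj[OF o] o(1) T])
qed

lemma module_map_Comp:
  assumes p: "right_module C A m p" and q: "right_module C A n q" and r: "right_module C A k r"
    and f: "module_map n q k r f" and g: "module_map m p n q g"
  shows "module_map m p k r (f \<cdot> g)"
proof
  have fg: "f \<in> Hom C n k" "g \<in> Hom C m n" "f \<cdot> q = r \<cdot> (f \<otimes>\<^sub>m iA)" "g \<cdot> p = q \<cdot> (g \<otimes>\<^sub>m iA)"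
    using f g by auto
  note T = mor_typing right_moduleD(1,2)[OF p] right_moduleD(1,2)[OF q] right_moduleD(1,2)[OF r]
    A_typing fg(1,2)
  show "f \<cdot> g \<in> Hom C m k" by ((rule T)+)
  have "(f \<cdot> g) \<cdot> p = f \<cdot> (g \<cdot> p)"
    by (rule Comp_assoc_typed[symmetric], (rule T)+)
  also have "\<dots> = f \<cdot> (q \<cdot> (g \<otimes>\<^sub>m iA))"
    by (simp only: fg(4))
  also have "\<dots> = (r \<cdot> (f \<otimes>\<^sub>m iA)) \<cdot> (g \<otimes>\<^sub>m iA)"
    by (rule Comp_eq_left[OF fg(3)], (rule T)+)
  also have "\<dots> = r \<cdot> ((f \<otimes>\<^sub>m iA) \<cdot> (g \<otimes>\<^sub>m iA))"
    by (rule Comp_assoc_typed[symmetric], (rule T)+)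
  also have "(f \<otimes>\<^sub>m iA) \<cdot> (g \<otimes>\<^sub>m iA) = (f \<cdot> g) \<otimes>\<^sub>m iA"
    by (rule TMor_Comp_right_Id[symmetric], (rule T)+)
  finally show "(f \<cdot> g) \<cdot> p = r \<cdot> ((f \<cdot> g) \<otimes>\<^sub>m iA)" .
qed

lemma module_map_subspace:
  assumes p: "right_module C A m p" and q: "right_module C A n q"
  shows "module.subspace (Scale C) {f. module_map m p n q f}"
proof -
  interpret V: vector_space "Scale C" by (rule vector_space_Scale)
  note o = right_moduleD(1)[OF p] right_moduleD(1)[OF q] AObj_in_Obj
  note oA = TObj_in_Obj[OF o(1,3)] TObj_in_Obj[OF o(2,3)]
  have sub: "V.subspace (Hom C m n)" by (rule subspace_Hom[OF o(1,2)])
  have scale: "module_map m p n q (Scale C k f)" if "module_map m p n q f" for k f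
  proof -
    have f: "f \<in> Hom C m n" "f \<cdot> p = q \<cdot> (f \<otimes>\<^sub>m iA)" using that by auto
    have fA: "f \<otimes>\<^sub>m iA \<in> Hom C (m \<otimes>\<^sub>o AA) (n \<otimes>\<^sub>o AA)"
      by (rule TMor_in_Hom[OF o(1,2,3,3) f(1) Id_in_Hom[OF o(3)]])
    have "Scale C k f \<cdot> p = q \<cdot> (Scale C k f \<otimes>\<^sub>m iA)"
      by (simp only: Comp_Scale_left[OF oA(1) o(1,2) f(1) right_moduleD(2)[OF p]] f(2)
          TMor_Scale_left[OF o(1,2,3,3) f(1) Id_in_Hom[OF o(3)]]
          Comp_Scale_right[OF oA o(2) right_moduleD(2)[OF q] fA])
    then show ?thesis using V.subspace_scale[OF sub f(1)] by simp
  qed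
  have add: "module_map m p n q (f + g)" if "module_map m p n q f" "module_map m p n q g" for f g
  proof -
    have f: "f \<in> Hom C m n" "f \<cdot> p = q \<cdot> (f \<otimes>\<^sub>m iA)" using that by auto
    have g: "g \<in> Hom C m n" "g \<cdot> p = q \<cdot> (g \<otimes>\<^sub>m iA)" using that by auto
    have fA: "f \<otimes>\<^sub>m iA \<in> Hom C (m \<otimes>\<^sub>o AA) (n \<otimes>\<^sub>o AA)"
      by (rule TMor_in_Hom[OF o(1,2,3,3) f(1) Id_in_Hom[OF o(3)]])
    have gA: "g \<otimes>\<^sub>m iA \<in> Hom C (m \<otimes>\<^sub>o AA) (n \<otimes>\<^sub>o AA)"
      by (rule TMor_in_Hom[OF o(1,2,3,3) g(1) Id_in_Hom[OF o(3)]])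
    have "(f + g) \<cdot> p = q \<cdot> ((f + g) \<otimes>\<^sub>m iA)"
      by (simp only: Comp_add_left[OF oA(1) o(1,2) f(1) g(1) right_moduleD(2)[OF p]] f(2) g(2)
          TMor_add_left[OF o(1,2,3,3) f(1) g(1) Id_in_Hom[OF o(3)]]
          Comp_add_right[OF oA o(2) right_moduleD(2)[OF q] fA gA])
    then show ?thesis using V.subspace_add[OF sub f(1) g(1)] by simp
  qed
  have zHom: "0 \<in> Hom C m n" by (rule V.subspace_0[OF sub])
  have z1: "0 \<cdot> p = 0"
    using Comp_Scale_left[OF oA(1) o(1,2) zHom right_moduleD(2)[OF p], of 0] by simp
  have z2: "0 \<otimes>\<^sub>m iA = 0"
    using TMor_Scale_left[OF o(1,2,3,3) zHom Id_in_Hom[OF o(3)], of 0] by simp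
  have z3: "q \<cdot> 0 = 0"
    using Comp_Scale_right[OF oA o(2) right_moduleD(2)[OF q] V.subspace_0[OF subspace_Hom[OF oA]], of 0]
    by simp
  show ?thesis
    by (rule V.subspaceI) (use zHom z1 z2 z3 add scale in auto)
qed

lemma right_modules_sel:
  "(m, p) \<in> Obj (right_modules C A) \<longleftrightarrow> right_module C A m p"
  "Hom (right_modules C A) (m, p) (n, q) = {f. module_map m p n q f}"
  "Ident (right_modules C A) (m, p) = Ident C m"
  "Comp (right_modules C A) = Comp C"
  "Scale (right_modules C A) = Scale C"
  "Act (right_modules C A) c (m, p) = (c \<otimes>\<^sub>o m, (Ident C c \<otimes>\<^sub>m p) \<cdot> Assoc C c m AA)"
  "ActMor (right_modules C A) = TMor C"
  "ActAssoc (right_modules C A) c d (m, p) = Assoc C c d m"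
  "ActUnit (right_modules C A) (m, p) = Lunit C m"
  by (simp_all add: right_modules_def)

lemma right_modules_fst:
  "m \<in> Obj (right_modules C A) \<Longrightarrow> fst m \<in> Obj C"
  "f \<in> Hom (right_modules C A) m n \<Longrightarrow> f \<in> Hom C (fst m) (fst n)"
  "Ident (right_modules C A) m = Ident C (fst m)"
  "fst (Act (right_modules C A) c m) = c \<otimes>\<^sub>o fst m"
  "ActAssoc (right_modules C A) c d m = Assoc C c d (fst m)"
  "ActUnit (right_modules C A) m = Lunit C (fst m)"
  by (cases m; cases n; simp add: right_modules_def right_module_def)+

lemma right_modules_iso_mor:
  assumes p: "right_module C A m p" and q: "right_module C A n q" and f: "module_map m p n q f"
    and iso: "iso_mor C m n f"
  shows "iso_mor (right_modules C A) (m, p) (n, q) f"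
proof -
  obtain g where inv: "inverse_mor C m n f g" using iso by (auto simp: iso_mor_def)
  have "inverse_mor (right_modules C A) (m, p) (n, q) f g"
    using inv f module_map_inverse[OF p q f inv] by (simp add: inverse_mor_def right_modules_sel)
  then show ?thesis by (auto simp: iso_mor_def)
qed

theorem left_module_category_right_modules: "left_module_category C (right_modules C A)"
proof -
  let ?M = "right_modules C A"
  have lin: "linear_category ?M"
  proof (rule linear_category.intro, goal_cases)
    case 1 then show ?case using vector_space_Scale by (simp add: right_modules_sel)
  next
    case (2 a b) then show ?case
      by (cases a; cases b) (simp add: right_modules_sel module_map_subspace)
  next
    case (3 a) then show ?case
      by (cases a) (simp only: right_modules_sel mem_Collect_eq module_map_Ident)
  next
    case (4 a b c f g) then show ?case
      by (cases a; cases b; cases c) (simp only: right_modules_sel mem_Collect_eq, rule module_map_Comp)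
  next
    case (5 a b f) show ?case
      unfolding right_modules_sel right_modules_fst
      by (rule Comp_Id[OF 5(1-2)[THEN right_modules_fst(1)] 5(3)[THEN right_modules_fst(2)]])
  next
    case (6 a b f) show ?case
      unfolding right_modules_sel right_modules_fst
      by (rule Id_Comp[OF 6(1-2)[THEN right_modules_fst(1)] 6(3)[THEN right_modules_fst(2)]])
  next
    case (7 a b c d f g h) show ?case
      unfolding right_modules_sel right_modules_fst
      by (rule Comp_assoc[OF 7(1-4)[THEN right_modules_fst(1)] 7(5-7)[THEN right_modules_fst(2)]])
  next
    case (8 a b c f f' g) show ?case
      unfolding right_modules_sel right_modules_fst
      by (rule Comp_add_left[OF 8(1-3)[THEN right_modules_fst(1)] 8(4-6)[THEN right_modules_fst(2)]])
  next
    case (9 a b c f g g') show ?case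
      unfolding right_modules_sel right_modules_fst
      by (rule Comp_add_right[OF 9(1-3)[THEN right_modules_fst(1)] 9(4-6)[THEN right_modules_fst(2)]])
  next
    case (10 a b c f g k) show ?case
      unfolding right_modules_sel right_modules_fst
      by (rule Comp_Scale_left[OF 10(1-3)[THEN right_modules_fst(1)] 10(4-5)[THEN right_modules_fst(2)]])
  next
    case (11 a b c f g k) show ?case
      unfolding right_modules_sel right_modules_fst
      by (rule Comp_Scale_right[OF 11(1-3)[THEN right_modules_fst(1)] 11(4-5)[THEN right_modules_fst(2)]])
  qed
  have "left_module_category_axioms C ?M"
  proof (rule left_module_category_axioms.intro, goal_cases)
    case (1 c m) then show ?case
      by (cases m) (simp add: right_modules_sel right_module_Act)
  next
    case (2 c c' m m' f g) then show ?case
      by (cases m; cases m')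
        (simp only: right_modules_sel mem_Collect_eq, rule module_map_ActMor)
  next
    case (3 c m) show ?case
      unfolding right_modules_sel right_modules_fst
      by (rule TMor_Id[OF 3(1) 3(2)[THEN right_modules_fst(1)]])
  next
    case (4 c c' c'' m m' m'' f f' g g') show ?case
      unfolding right_modules_sel right_modules_fst
      by (rule TMor_Comp[OF 4(1-3) 4(4-6)[THEN right_modules_fst(1)] 4(7-8) 4(9-10)[THEN right_modules_fst(2)]])
  next
    case (5 c c' m m' f f' g) show ?case
      unfolding right_modules_sel right_modules_fst
      by (rule TMor_add_left[OF 5(1-2) 5(3-4)[THEN right_modules_fst(1)] 5(5-6) 5(7)[THEN right_modules_fst(2)]])
  next
    case (6 c c' m m' f g g') show ?case
      unfolding right_modules_sel right_modules_fst
      by (rule TMor_add_right[OF 6(1-2) 6(3-4)[THEN right_modules_fst(1)] 6(5) 6(6-7)[THEN right_modules_fst(2)]])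
  next
    case (7 c c' m m' f g k) show ?case
      unfolding right_modules_sel right_modules_fst
      by (rule TMor_Scale_left[OF 7(1-2) 7(3-4)[THEN right_modules_fst(1)] 7(5) 7(6)[THEN right_modules_fst(2)]])
  next
    case (8 c c' m m' f g k) show ?case
      unfolding right_modules_sel right_modules_fst
      by (rule TMor_Scale_right[OF 8(1-2) 8(3-4)[THEN right_modules_fst(1)] 8(5) 8(6)[THEN right_modules_fst(2)]])
  next
    case (9 c d m)
    obtain n p where m: "m = (n, p)" by (cases m)
    have p: "right_module C A n p" using 9 by (simp add: m right_modules_sel)
    show ?case
      unfolding m right_modules_sel
      by (rule right_modules_iso_mor[OF right_module_Act[OF TObj_in_Obj[OF 9(1,2)] p]
            right_module_Act[OF 9(1) right_module_Act[OF 9(2) p]] module_map_Assoc[OF 9(1,2) p]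
            Assoc_iso[OF 9(1,2) right_moduleD(1)[OF p]]])
  next
    case (10 m)
    obtain n p where m: "m = (n, p)" by (cases m)
    have p: "right_module C A n p" using 10 by (simp add: m right_modules_sel)
    show ?case
      unfolding m right_modules_sel
      by (rule right_modules_iso_mor[OF right_module_Act[OF One_in_Obj p] p module_map_Lunit[OF p]
            Lunit_iso[OF right_moduleD(1)[OF p]]])
  next
    case (11 c c' d d' m m' f g h) show ?case
      unfolding right_modules_sel right_modules_fst
      by (rule Assoc_natural[OF 11(1-4) 11(5-6)[THEN right_modules_fst(1)] 11(7-8) 11(9)[THEN right_modules_fst(2)]])
  next
    case (12 m m' h) show ?case
      unfolding right_modules_sel right_modules_fst
      by (rule Lunit_natural[OF 12(1-2)[THEN right_modules_fst(1)] 12(3)[THEN right_modules_fst(2)]])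
  next
    case (13 b c d m) show ?case
      unfolding right_modules_sel right_modules_fst
      by (rule pentagon[OF 13(1-3) 13(4)[THEN right_modules_fst(1)]])
  next
    case (14 c m) show ?case
      unfolding right_modules_sel right_modules_fst
      by (rule triangle[OF 14(1) 14(2)[THEN right_modules_fst(1)]])
  qed
  then show ?thesis
    by (rule left_module_category.intro[OF monoidal_category_axioms lin])
qed

end

section \<open>Fusion rings\<close>

text \<open>
  A based ring with nonnegative structure constants: \<open>rtimes a b\<close> lists the basis elements whose sum
  is the product of \<open>a\<close> and \<open>b\<close>, each as often as its coefficient says.
\<close>

record 'b based_ring =
  rbasis :: "'b set"
  rone :: 'b
  rtimes :: "'b \<Rightarrow> 'b \<Rightarrow> 'b list"

definition has_fusion_ring ::
    "('o, 'm::ab_group_add, 'z) monoidal_category_scheme \<Rightarrow> 'b based_ring \<Rightarrow> bool" where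
  "has_fusion_ring C R \<longleftrightarrow>
     (\<exists>X. (\<forall>a\<in>rbasis R. simple_object C (X a)) \<and>
       (\<forall>a\<in>rbasis R. \<forall>b\<in>rbasis R. isomorphic C (X a) (X b) \<longrightarrow> a = b) \<and>
       (\<forall>y. simple_object C y \<longrightarrow> (\<exists>a\<in>rbasis R. isomorphic C (X a) y)) \<and>
       isomorphic C (X (rone R)) \<one>\<^sub>o \<and>
       (\<forall>a\<in>rbasis R. \<forall>b\<in>rbasis R. is_direct_sum C (map X (rtimes R a b)) (X a \<otimes>\<^sub>o X b)))"
  for C (structure)

definition tensor_ring :: "'a based_ring \<Rightarrow> 'b based_ring \<Rightarrow> ('a \<times> 'b) based_ring" where
  "tensor_ring R S =
     \<lparr> rbasis = rbasis R \<times> rbasis S,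
       rone = (rone R, rone S),
       rtimes = (\<lambda>(a, b) (a', b'). List.product (rtimes R a a') (rtimes S b b')) \<rparr>"

definition cyclic_group_ring :: "nat \<Rightarrow> nat based_ring" where
  "cyclic_group_ring n =
     \<lparr> rbasis = {..<n}, rone = 0, rtimes = (\<lambda>i j. [(i + j) mod n]) \<rparr>"

datatype fib_basis = Fib1 | Fib_tau

definition fib_ring :: "fib_basis based_ring" where
  "fib_ring =
     \<lparr> rbasis = UNIV, rone = Fib1,
       rtimes = (\<lambda>x y. case x of
           Fib1 \<Rightarrow> [y]
         | Fib_tau \<Rightarrow> (case y of Fib1 \<Rightarrow> [Fib_tau] | Fib_tau \<Rightarrow> [Fib1, Fib_tau])) \<rparr>"

datatype ising_basis = Ising1 | Ising_psi | Ising_sigma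

definition ising_ring :: "ising_basis based_ring" where
  "ising_ring =
     \<lparr> rbasis = UNIV, rone = Ising1,
       rtimes = (\<lambda>x y. case x of
           Ising1 \<Rightarrow> [y]
         | Ising_psi \<Rightarrow> (case y of
               Ising1 \<Rightarrow> [Ising_psi] | Ising_psi \<Rightarrow> [Ising1] | Ising_sigma \<Rightarrow> [Ising_sigma])
         | Ising_sigma \<Rightarrow> (case y of
               Ising1 \<Rightarrow> [Ising_sigma] | Ising_psi \<Rightarrow> [Ising_sigma]
             | Ising_sigma \<Rightarrow> [Ising1, Ising_psi])) \<rparr>"

datatype psu2_5_basis = P1 | Pa | Pb

definition psu2_5_ring :: "psu2_5_basis based_ring" where
  "psu2_5_ring =
     \<lparr> rbasis = UNIV, rone = P1,
       rtimes = (\<lambda>x y. case x of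
           P1 \<Rightarrow> [y]
         | Pa \<Rightarrow> (case y of P1 \<Rightarrow> [Pa] | Pa \<Rightarrow> [P1, Pb] | Pb \<Rightarrow> [Pa, Pb])
         | Pb \<Rightarrow> (case y of P1 \<Rightarrow> [Pb] | Pa \<Rightarrow> [Pa, Pb] | Pb \<Rightarrow> [P1, Pa, Pb])) \<rparr>"

datatype basis6 = I6 | X6 | Y6 | Z6 | V6 | W6

definition so5_2_ring :: "basis6 based_ring" where
  "so5_2_ring =
     \<lparr> rbasis = UNIV, rone = I6,
       rtimes = (\<lambda>x y. case x of
           I6 \<Rightarrow> [y]
         | X6 \<Rightarrow> (case y of
               I6 \<Rightarrow> [X6] | X6 \<Rightarrow> [I6] | Y6 \<Rightarrow> [Y6] | Z6 \<Rightarrow> [Z6] | V6 \<Rightarrow> [W6] | W6 \<Rightarrow> [V6])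
         | Y6 \<Rightarrow> (case y of
               I6 \<Rightarrow> [Y6] | X6 \<Rightarrow> [Y6] | Y6 \<Rightarrow> [I6, X6, Z6] | Z6 \<Rightarrow> [Y6, Z6]
             | V6 \<Rightarrow> [V6, W6] | W6 \<Rightarrow> [V6, W6])
         | Z6 \<Rightarrow> (case y of
               I6 \<Rightarrow> [Z6] | X6 \<Rightarrow> [Z6] | Y6 \<Rightarrow> [Y6, Z6] | Z6 \<Rightarrow> [I6, X6, Y6]
             | V6 \<Rightarrow> [V6, W6] | W6 \<Rightarrow> [V6, W6])
         | V6 \<Rightarrow> (case y of
               I6 \<Rightarrow> [V6] | X6 \<Rightarrow> [W6] | Y6 \<Rightarrow> [V6, W6] | Z6 \<Rightarrow> [V6, W6]
             | V6 \<Rightarrow> [I6, Y6, Z6] | W6 \<Rightarrow> [X6, Y6, Z6])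
         | W6 \<Rightarrow> (case y of
               I6 \<Rightarrow> [W6] | X6 \<Rightarrow> [V6] | Y6 \<Rightarrow> [V6, W6] | Z6 \<Rightarrow> [V6, W6]
             | V6 \<Rightarrow> [X6, Y6, Z6] | W6 \<Rightarrow> [I6, Y6, Z6])) \<rparr>"

definition psu2_11_ring :: "basis6 based_ring" where
  "psu2_11_ring =
     \<lparr> rbasis = UNIV, rone = I6,
       rtimes = (\<lambda>x y. case x of
           I6 \<Rightarrow> [y]
         | X6 \<Rightarrow> (case y of
               I6 \<Rightarrow> [X6] | X6 \<Rightarrow> [I6, Y6] | Y6 \<Rightarrow> [X6, Z6] | Z6 \<Rightarrow> [Y6, V6]
             | V6 \<Rightarrow> [Z6, W6] | W6 \<Rightarrow> [V6, W6])
         | Y6 \<Rightarrow> (case y of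
               I6 \<Rightarrow> [Y6] | X6 \<Rightarrow> [X6, Z6] | Y6 \<Rightarrow> [I6, Y6, V6] | Z6 \<Rightarrow> [X6, Z6, W6]
             | V6 \<Rightarrow> [Y6, V6, W6] | W6 \<Rightarrow> [Z6, V6, W6])
         | Z6 \<Rightarrow> (case y of
               I6 \<Rightarrow> [Z6] | X6 \<Rightarrow> [Y6, V6] | Y6 \<Rightarrow> [X6, Z6, W6] | Z6 \<Rightarrow> [I6, Y6, V6, W6]
             | V6 \<Rightarrow> [X6, Z6, V6, W6] | W6 \<Rightarrow> [Y6, Z6, V6, W6])
         | V6 \<Rightarrow> (case y of
               I6 \<Rightarrow> [V6] | X6 \<Rightarrow> [Z6, W6] | Y6 \<Rightarrow> [Y6, V6, W6] | Z6 \<Rightarrow> [X6, Z6, V6, W6]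
             | V6 \<Rightarrow> [I6, Y6, Z6, V6, W6] | W6 \<Rightarrow> [X6, Y6, Z6, V6, W6])
         | W6 \<Rightarrow> (case y of
               I6 \<Rightarrow> [W6] | X6 \<Rightarrow> [V6, W6] | Y6 \<Rightarrow> [Z6, V6, W6] | Z6 \<Rightarrow> [Y6, Z6, V6, W6]
             | V6 \<Rightarrow> [X6, Y6, Z6, V6, W6] | W6 \<Rightarrow> [I6, X6, Y6, Z6, V6, W6])) \<rparr>"

end

theory Submission
  imports Defs
begin

text \<open>
  Each of the eight fusion rings has rank at least two, and over any modular fusion category with two
  non-isomorphic simple objects a connected commutative algebra \<open>A\<close> breaks the symmetry.

  Suppose that every simple \<open>b\<close> satisfies \<open>b \<otimes> A \<cong> A\<close> as right \<open>A\<close>-modules. A module map out of the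
  free module \<open>b \<otimes> A\<close> is multiplication by an element of \<open>A\<close> of shape \<open>b\<close>, so the isomorphism is
  \<open>\<mu> (i\<^sub>b \<otimes> 1)\<close> for some nonzero \<open>i\<^sub>b : b \<rightarrow> A\<close>; the elements \<open>i\<^sub>b\<close> behave like invertible elements of
  \<open>A\<close> (\<open>absorbed_simple\<close>). For simple \<open>b\<close> and \<open>c\<close> the product \<open>\<mu> (i\<^sub>b \<otimes> i\<^sub>c) : b \<otimes> c \<rightarrow> A\<close> is
  \<open>\<mu> (i\<^sub>b \<otimes> 1)\<close>, which is invertible, after \<open>1 \<otimes> i\<^sub>c\<close>, which is a split monomorphism because \<open>c\<close> is
  simple. By commutativity of \<open>A\<close> the product is unchanged by precomposition with the double braiding
  of \<open>b\<close> and \<open>c\<close>. A monomorphism can be cancelled, so that double braiding is the identity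
  (\<open>double_braiding_trivial\<close>).

  Hence the entry of the \<open>S\<close>-matrix at \<open>(b, c)\<close> is the dimension of \<open>b \<otimes> c\<close>. Dimensions are
  multiplicative (\<open>trace_mor_TObj\<close>), so the \<open>S\<close>-matrix is \<open>d\<^sub>b d\<^sub>c\<close>, of rank one, and it is degenerate
  as soon as its size is at least two, contradicting modularity.

  Most of the text below derives multiplicativity of dimensions from monoidality of the pivotal
  structure, in a category that is not strict. Associators are kept under control by working with
  the maps \<open>u \<otimes> (v \<otimes> z) \<rightarrow> z\<close> induced by a pairing \<open>u \<otimes> v \<rightarrow> \<one>\<close> (\<open>contract\<close>): they are natural in \<open>z\<close>,
  compatible with tensoring on the right, and two nested contractions are, after rebracketing, again a
  contraction.
\<close>

section \<open>Morphisms in linear categories\<close>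

context linear_category
begin

lemma inverse_mor_inv_mor:
  assumes "iso_mor C a b f" and o: "a \<in> Obj C" "b \<in> Obj C"
  shows "inverse_mor C a b f (inv_mor C a b f)"
proof -
  obtain g where g: "inverse_mor C a b f g" using assms(1) by (auto simp: iso_mor_def)
  have "h = g" if h: "inverse_mor C a b f h" for h
    by (rule iso_mor_cancel_left[OF _ assms(1), of _ _ b]) (use g h o in \<open>auto simp: inverse_mor_def\<close>)
  with g show ?thesis unfolding inv_mor_def by (metis theI)
qed

lemma inv_mor_in_Hom:
  "\<lbrakk>iso_mor C a b f; a \<in> Obj C; b \<in> Obj C\<rbrakk> \<Longrightarrow> inv_mor C a b f \<in> Hom C b a"
  using inverse_mor_inv_mor by (auto simp: inverse_mor_def)

lemma inv_mor_left:
  "\<lbrakk>iso_mor C a b f; a \<in> Obj C; b \<in> Obj C\<rbrakk> \<Longrightarrow> inv_mor C a b f \<cdot> f = Ident C a"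
  using inverse_mor_inv_mor by (auto simp: inverse_mor_def)

lemma inv_mor_right:
  "\<lbrakk>iso_mor C a b f; a \<in> Obj C; b \<in> Obj C\<rbrakk> \<Longrightarrow> f \<cdot> inv_mor C a b f = Ident C b"
  using inverse_mor_inv_mor by (auto simp: inverse_mor_def)

lemma isomorphic_sym: "isomorphic C a b \<Longrightarrow> isomorphic C b a"
  by (auto simp: isomorphic_def iso_mor_def inverse_mor_def)

lemma iso_mor_Comp:
  assumes "iso_mor C a b g" "iso_mor C b c f" and o: "a \<in> Obj C" "b \<in> Obj C" "c \<in> Obj C"
  shows "iso_mor C a c (f \<cdot> g)"
proof -
  obtain g' f' where g: "g \<in> Hom C a b" "g' \<in> Hom C b a" "g' \<cdot> g = Ident C a" "g \<cdot> g' = Ident C b"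
    and f: "f \<in> Hom C b c" "f' \<in> Hom C c b" "f' \<cdot> f = Ident C b" "f \<cdot> f' = Ident C c"
    using assms(1,2) by (auto simp: iso_mor_def inverse_mor_def)
  have "(g' \<cdot> f') \<cdot> (f \<cdot> g) = g' \<cdot> (f' \<cdot> (f \<cdot> g))"
    by (rule Comp_assoc_typed[symmetric], (rule Comp_typed f g o)+)
  also have "f' \<cdot> (f \<cdot> g) = Ident C b \<cdot> g"
    by (rule Comp_eq_left[OF f(3)], (rule f g o)+)
  finally have 1: "(g' \<cdot> f') \<cdot> (f \<cdot> g) = Ident C a"
    by (simp only: Id_Comp[OF o(1,2) g(1)] g)
  have "(f \<cdot> g) \<cdot> (g' \<cdot> f') = f \<cdot> (g \<cdot> (g' \<cdot> f'))"
    by (rule Comp_assoc_typed[symmetric], (rule Comp_typed f g o)+)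
  also have "g \<cdot> (g' \<cdot> f') = Ident C b \<cdot> f'"
    by (rule Comp_eq_left[OF g(4)], (rule f g o)+)
  finally have 2: "(f \<cdot> g) \<cdot> (g' \<cdot> f') = Ident C c"
    by (simp only: Id_Comp[OF o(3,2) f(2)] f)
  have "inverse_mor C a c (f \<cdot> g) (g' \<cdot> f')"
    unfolding inverse_mor_def using 1 2 Comp_typed[OF g(1) f(1) o] Comp_typed[OF f(2) g(2) o(3,2,1)] by blast
  then show ?thesis by (auto simp: iso_mor_def)
qed

lemma isomorphic_trans:
  "\<lbrakk>isomorphic C a b; isomorphic C b c; a \<in> Obj C; b \<in> Obj C; c \<in> Obj C\<rbrakk> \<Longrightarrow> isomorphic C a c"
  unfolding isomorphic_def using iso_mor_Comp by blast

text \<open>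
  Serves to rewrite at the head of a composite nested to the right. The objects between morphisms cannot
  be read off from the morphisms, so associativity is not available as a rewrite rule.
\<close>

lemma Comp_eq_left2:
  assumes "x \<cdot> y = x' \<cdot> y'" "w \<in> Hom C a b" "y \<in> Hom C b c" "x \<in> Hom C c d"
    and "y' \<in> Hom C b c'" "x' \<in> Hom C c' d"
    and "a \<in> Obj C" "b \<in> Obj C" "c \<in> Obj C" "d \<in> Obj C" "c' \<in> Obj C"
  shows "x \<cdot> (y \<cdot> w) = x' \<cdot> (y' \<cdot> w)"
  by (simp only: Comp_assoc_typed[OF assms(2-4,7-10)] assms(1)
      Comp_assoc_typed[OF assms(2,5,6,7,8,11,10)])

lemma zero_in_Hom: "\<lbrakk>a \<in> Obj C; b \<in> Obj C\<rbrakk> \<Longrightarrow> 0 \<in> Hom C a b"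
proof -
  assume o: "a \<in> Obj C" "b \<in> Obj C"
  interpret V: vector_space "Scale C" by (rule vector_space_Scale)
  show ?thesis by (rule V.subspace_0[OF subspace_Hom[OF o]])
qed

lemma Comp_zero_left:
  assumes "f \<in> Hom C a b" and o: "a \<in> Obj C" "b \<in> Obj C" "c \<in> Obj C"
  shows "0 \<cdot> f = 0"
  using Comp_add_left[OF o zero_in_Hom[OF o(2,3)] zero_in_Hom[OF o(2,3)] assms(1)] by simp

lemma Comp_zero_right:
  assumes "f \<in> Hom C b c" and o: "a \<in> Obj C" "b \<in> Obj C" "c \<in> Obj C"
  shows "f \<cdot> 0 = 0"
  using Comp_add_right[OF o assms(1) zero_in_Hom[OF o(1,2)] zero_in_Hom[OF o(1,2)]] by simp

lemma sum_in_Hom: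
  fixes n :: nat
  assumes "\<And>j. j < n \<Longrightarrow> f j \<in> Hom C a b" and o: "a \<in> Obj C" "b \<in> Obj C"
  shows "(\<Sum>j<n. f j) \<in> Hom C a b"
proof -
  interpret V: vector_space "Scale C" by (rule vector_space_Scale)
  show ?thesis by (rule V.subspace_sum[OF subspace_Hom[OF o]]) (simp add: assms(1))
qed

lemma diff_in_Hom:
  assumes "f \<in> Hom C a b" "g \<in> Hom C a b" and o: "a \<in> Obj C" "b \<in> Obj C"
  shows "f - g \<in> Hom C a b"
proof -
  interpret V: vector_space "Scale C" by (rule vector_space_Scale)
  show ?thesis by (rule V.subspace_diff[OF subspace_Hom[OF o] assms(1,2)])
qed

lemma scale_in_Hom:
  assumes "f \<in> Hom C a b" and o: "a \<in> Obj C" "b \<in> Obj C"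
  shows "Scale C r f \<in> Hom C a b"
proof -
  interpret V: vector_space "Scale C" by (rule vector_space_Scale)
  show ?thesis by (rule V.subspace_scale[OF subspace_Hom[OF o] assms(1)])
qed

lemma Comp_diff_right:
  assumes "f \<in> Hom C b c" "g \<in> Hom C a b" "h \<in> Hom C a b" and o: "a \<in> Obj C" "b \<in> Obj C" "c \<in> Obj C"
  shows "f \<cdot> (g - h) = (f \<cdot> g) - (f \<cdot> h)"
  using Comp_add_right[OF o assms(1) diff_in_Hom[OF assms(2,3) o(1,2)] assms(3)] by simp

lemma Comp_sum_left:
  fixes n :: nat
  assumes "\<And>j. j < n \<Longrightarrow> f j \<in> Hom C b c" and g: "g \<in> Hom C a b"
    and o: "a \<in> Obj C" "b \<in> Obj C" "c \<in> Obj C"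
  shows "(\<Sum>j<n. f j) \<cdot> g = (\<Sum>j<n. f j \<cdot> g)"
  using assms(1)
proof (induction n)
  case 0
  then show ?case using Comp_zero_left[OF g o] by simp
next
  case (Suc n)
  then have "(\<Sum>j<n. f j) \<in> Hom C b c" by (intro sum_in_Hom o) auto
  with Suc show ?case using Comp_add_left[OF o _ _ g] by simp
qed

lemma zero_object_if_Ident_zero:
  assumes "x \<in> Obj C" "Ident C x = 0"
  shows "zero_object C x"
proof -
  have "f = 0" if "a \<in> Obj C" "f \<in> Hom C x a" for a f
    using Comp_Id[OF assms(1) that] Comp_zero_right[OF that(2) assms(1) assms(1) that(1)] assms(2) by simp
  moreover have "f = 0" if "a \<in> Obj C" "f \<in> Hom C a x" for a f
    using Id_Comp[OF that(1) assms(1) that(2)] Comp_zero_left[OF that(2) that(1) assms(1) assms(1)] assms(2) by simp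
  ultimately show ?thesis unfolding zero_object_def using assms(1) zero_in_Hom by blast
qed

end

lemma (in abelian_category) schur:
  assumes x: "simple_object C x" and y: "simple_object C y" and f: "f \<in> Hom C x y" and nz: "f \<noteq> 0"
  shows "iso_mor C x y f"
proof -
  have o: "x \<in> Obj C" "y \<in> Obj C" using x y by (auto simp: simple_object_def)
  obtain k \<iota> where k: "is_kernel C x y f k \<iota>" using kernel_exists[OF o f] by blast
  then have k': "k \<in> Obj C" "\<iota> \<in> Hom C k x" "f \<cdot> \<iota> = 0"
    and univ: "\<And>c g. \<lbrakk>c \<in> Obj C; g \<in> Hom C c x; f \<cdot> g = 0\<rbrakk> \<Longrightarrow> \<exists>!h. h \<in> Hom C c k \<and> \<iota> \<cdot> h = g"
    by (auto simp: is_kernel_def)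
  have "mono_mor C k x \<iota>"
    unfolding mono_mor_def
  proof (intro conjI ballI impI k')
    fix c g h assume c: "c \<in> Obj C" and g: "g \<in> Hom C c k" and h: "h \<in> Hom C c k" and eq: "\<iota> \<cdot> g = \<iota> \<cdot> h"
    have "f \<cdot> (\<iota> \<cdot> g) = 0 \<cdot> g" by (rule Comp_eq_left[OF k'(3) g k'(2) f c k'(1) o])
    then have "f \<cdot> (\<iota> \<cdot> g) = 0" using Comp_zero_left[OF g c k'(1) o(2)] by simp
    from univ[OF c Comp_typed[OF g k'(2) c k'(1) o(1)] this] show "g = h" using g h eq by metis
  qed
  then consider "zero_object C k" | "iso_mor C k x \<iota>" using x k'(1) by (auto simp: simple_object_def)
  then show ?thesis
  proof cases
    case 1
    have "mono_mor C x y f"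
      unfolding mono_mor_def
    proof (intro conjI ballI impI f)
      fix c g h assume c: "c \<in> Obj C" and g: "g \<in> Hom C c x" and h: "h \<in> Hom C c x" and eq: "f \<cdot> g = f \<cdot> h"
      have "f \<cdot> (g - h) = 0" using Comp_diff_right[OF f g h c o] eq by simp
      then obtain r where "r \<in> Hom C c k" "\<iota> \<cdot> r = g - h" using univ[OF c diff_in_Hom[OF g h c o(1)]] by blast
      moreover from this have "r = 0" using 1 c by (auto simp: zero_object_def)
      ultimately show "g = h" using Comp_zero_right[OF k'(2) c k'(1) o(1)] by simp
    qed
    then show ?thesis using y x o(1) by (auto simp: simple_object_def)
  next
    case 2
    have "f \<cdot> \<iota> = 0 \<cdot> \<iota>" using k'(3) Comp_zero_left[OF k'(2,1) o] by simp
    then have "f = 0" by (rule iso_mor_cancel_right[OF _ 2 f zero_in_Hom[OF o] k'(1) o])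
    with nz show ?thesis by simp
  qed
qed

text \<open>
  Some component of \<open>i\<close> in a decomposition of \<open>a\<close> into simple objects is nonzero, hence an isomorphism
  by Schur's lemma; its inverse after the projection is a retraction.
\<close>

lemma (in linear_category) simple_source_retraction:
  assumes ss: "semisimple C" and b: "simple_object C b" and a: "a \<in> Obj C"
    and i: "i \<in> Hom C b a" and nz: "i \<noteq> 0"
  shows "\<exists>s\<in>Hom C a b. s \<cdot> i = Ident C b"
proof -
  interpret abelian_category C using ss by (simp add: semisimple_def)
  have bo: "b \<in> Obj C" using b by (simp add: simple_object_def)
  obtain xs where xs: "\<forall>x\<in>set xs. simple_object C x" and "is_direct_sum C xs a"
    using ss a by (auto simp: semisimple_def)
  then obtain \<iota> \<pi> where \<iota>: "\<And>j. j < length xs \<Longrightarrow> \<iota> j \<in> Hom C (xs ! j) a"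
    and \<pi>: "\<And>j. j < length xs \<Longrightarrow> \<pi> j \<in> Hom C a (xs ! j)"
    and sum: "(\<Sum>j<length xs. \<iota> j \<cdot> \<pi> j) = Ident C a"
    unfolding is_direct_sum_def by blast
  have o: "xs ! j \<in> Obj C" "simple_object C (xs ! j)" if "j < length xs" for j
    using xs that by (auto simp: simple_object_def)
  have "\<exists>j<length xs. \<pi> j \<cdot> i \<noteq> 0"
  proof (rule ccontr)
    assume "\<not> ?thesis"
    then have z: "\<pi> j \<cdot> i = 0" if "j < length xs" for j using that by blast
    have "(\<iota> j \<cdot> \<pi> j) \<cdot> i = 0" if j: "j < length xs" for j
      using Comp_assoc_typed[OF i \<pi>[OF j] \<iota>[OF j] bo a o(1)[OF j] a] z[OF j]
        Comp_zero_right[OF \<iota>[OF j] bo o(1)[OF j] a] by simp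
    then have "(\<Sum>j<length xs. (\<iota> j \<cdot> \<pi> j) \<cdot> i) = 0" by (intro sum.neutral) auto
    moreover have "(\<Sum>j<length xs. \<iota> j \<cdot> \<pi> j) \<cdot> i = (\<Sum>j<length xs. (\<iota> j \<cdot> \<pi> j) \<cdot> i)"
      by (rule Comp_sum_left[OF Comp_typed[OF \<pi> \<iota> a o(1) a] i bo a a])
    ultimately show False using Id_Comp[OF bo a i] sum nz by simp
  qed
  then obtain j where j: "j < length xs" "\<pi> j \<cdot> i \<noteq> 0" by blast
  note xj = o[OF j(1)] and p = \<pi>[OF j(1)]
  have iso: "iso_mor C b (xs ! j) (\<pi> j \<cdot> i)"
    by (rule schur[OF b xj(2) Comp_typed[OF i p bo a xj(1)] j(2)])
  let ?r = "inv_mor C b (xs ! j) (\<pi> j \<cdot> i)"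
  have r: "?r \<in> Hom C (xs ! j) b" by (rule inv_mor_in_Hom[OF iso bo xj(1)])
  have "(?r \<cdot> \<pi> j) \<cdot> i = Ident C b"
    using inv_mor_left[OF iso bo xj(1)] Comp_assoc_typed[OF i p r bo a xj(1) bo] by simp
  then show ?thesis using Comp_typed[OF p r a xj(1) bo] by blast
qed

section \<open>Pairings, duals and nested duals\<close>

context monoidal_category
begin

lemma Lunit_eq_Runit_One: "Lunit C \<one>\<^sub>o = Runit C \<one>\<^sub>o"
proof (rule TMor_One_faithful)
  let ?i = "Ident C \<one>\<^sub>o" and ?l = "Lunit C \<one>\<^sub>o"
  note T = mor_typing
  have "?i \<otimes>\<^sub>m ?l = Lunit C (\<one>\<^sub>o \<otimes>\<^sub>o \<one>\<^sub>o)"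
    by (rule iso_mor_cancel_left[OF Lunit_natural Lunit_iso], (rule T)+)
  then show "?l \<otimes>\<^sub>m ?i = Runit C \<one>\<^sub>o \<otimes>\<^sub>m ?i"
    using Lunit_TObj[OF One_in_Obj One_in_Obj] triangle[OF One_in_Obj One_in_Obj] by simp
qed (rule mor_typing)+

text \<open>
  The pairing \<open>g : u \<otimes> v \<rightarrow> \<one>\<close> applied in the presence of a bystander \<open>z\<close>. The source
  \<open>u \<otimes> (v \<otimes> z)\<close> is bracketed to the right, so that the associator stays inside the definition and
  arguments about duals need only naturality in \<open>z\<close> and the rules for \<open>z\<close> a tensor product or the unit.
\<close>

definition contract :: "'o \<Rightarrow> 'o \<Rightarrow> 'm \<Rightarrow> 'o \<Rightarrow> 'm" where
  "contract u v g z = Lunit C z \<cdot> (g \<otimes>\<^sub>m Ident C z) \<cdot> Assoc_inv C u v z"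

lemma Assoc_inv_in_Hom:
  "\<lbrakk>a \<in> Obj C; b \<in> Obj C; c \<in> Obj C\<rbrakk> \<Longrightarrow> Assoc_inv C a b c \<in> Hom C (a \<otimes>\<^sub>o (b \<otimes>\<^sub>o c)) ((a \<otimes>\<^sub>o b) \<otimes>\<^sub>o c)"
  by (intro inv_mor_in_Hom Assoc_iso obj_typing)

lemma Runit_inv_in_Hom: "a \<in> Obj C \<Longrightarrow> Runit_inv C a \<in> Hom C a (a \<otimes>\<^sub>o \<one>\<^sub>o)"
  by (intro inv_mor_in_Hom Runit_iso obj_typing)

abbreviation "Lunit_inv a \<equiv> inv_mor C (\<one>\<^sub>o \<otimes>\<^sub>o a) a (Lunit C a)"

lemma Lunit_inv_in_Hom: "a \<in> Obj C \<Longrightarrow> Lunit_inv a \<in> Hom C a (\<one>\<^sub>o \<otimes>\<^sub>o a)"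
  by (intro inv_mor_in_Hom Lunit_iso obj_typing)

lemmas iso_typing = mor_typing Assoc_inv_in_Hom Lunit_inv_in_Hom Runit_inv_in_Hom

lemma contract_in_Hom:
  "\<lbrakk>g \<in> Hom C (u \<otimes>\<^sub>o v) \<one>\<^sub>o; u \<in> Obj C; v \<in> Obj C; z \<in> Obj C\<rbrakk>
    \<Longrightarrow> contract u v g z \<in> Hom C (u \<otimes>\<^sub>o (v \<otimes>\<^sub>o z)) z"
  unfolding contract_def by (rule iso_typing | assumption)+

lemma contract_Assoc:
  assumes g: "g \<in> Hom C (u \<otimes>\<^sub>o v) \<one>\<^sub>o" and o: "u \<in> Obj C" "v \<in> Obj C" "z \<in> Obj C"
  shows "contract u v g z \<cdot> Assoc C u v z = Lunit C z \<cdot> (g \<otimes>\<^sub>m Ident C z)"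
proof -
  note T = iso_typing g o
  have "contract u v g z \<cdot> Assoc C u v z
      = (Lunit C z \<cdot> (g \<otimes>\<^sub>m Ident C z)) \<cdot> (Assoc_inv C u v z \<cdot> Assoc C u v z)"
    unfolding contract_def
    by (subst Comp_assoc_typed, (rule T)+, rule Comp_assoc_typed[symmetric], (rule T)+)
  also have "Assoc_inv C u v z \<cdot> Assoc C u v z = Ident C ((u \<otimes>\<^sub>o v) \<otimes>\<^sub>o z)"
    by (rule inv_mor_left[OF Assoc_iso], (rule T)+)
  also have "(Lunit C z \<cdot> (g \<otimes>\<^sub>m Ident C z)) \<cdot> \<dots> = Lunit C z \<cdot> (g \<otimes>\<^sub>m Ident C z)"
    by (rule Comp_Id[rotated 2], (rule T)+)
  finally show ?thesis .
qed

lemma contract_natural: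
  assumes g: "g \<in> Hom C (u \<otimes>\<^sub>o v) \<one>\<^sub>o" and f: "f \<in> Hom C z z'"
    and o: "u \<in> Obj C" "v \<in> Obj C" "z \<in> Obj C" "z' \<in> Obj C"
  shows "contract u v g z' \<cdot> (Ident C u \<otimes>\<^sub>m (Ident C v \<otimes>\<^sub>m f)) = f \<cdot> contract u v g z"
proof (rule iso_mor_cancel_right[OF _ Assoc_iso[OF o(1-3)]])
  note T = contract_in_Hom iso_typing g f o
  have "(contract u v g z' \<cdot> (Ident C u \<otimes>\<^sub>m (Ident C v \<otimes>\<^sub>m f))) \<cdot> Assoc C u v z
     = contract u v g z' \<cdot> ((Ident C u \<otimes>\<^sub>m (Ident C v \<otimes>\<^sub>m f)) \<cdot> Assoc C u v z)"
    by (rule Comp_assoc_typed[symmetric], (rule T)+)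
  also have "(Ident C u \<otimes>\<^sub>m (Ident C v \<otimes>\<^sub>m f)) \<cdot> Assoc C u v z
     = Assoc C u v z' \<cdot> (Ident C (u \<otimes>\<^sub>o v) \<otimes>\<^sub>m f)"
    unfolding TMor_Id[OF o(1,2), symmetric] by (rule Assoc_natural_typed[symmetric], (rule T)+)
  also have "contract u v g z' \<cdot> (Assoc C u v z' \<cdot> (Ident C (u \<otimes>\<^sub>o v) \<otimes>\<^sub>m f))
     = Lunit C z' \<cdot> ((g \<otimes>\<^sub>m Ident C z') \<cdot> (Ident C (u \<otimes>\<^sub>o v) \<otimes>\<^sub>m f))"
    by (rule Comp_eq_left2, rule contract_Assoc, (rule T)+)
  also have "(g \<otimes>\<^sub>m Ident C z') \<cdot> (Ident C (u \<otimes>\<^sub>o v) \<otimes>\<^sub>m f) = g \<otimes>\<^sub>m f"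
    by (subst TMor_Comp_typed, (rule T)+)
      (simp only: Comp_Id[OF TObj_in_Obj[OF o(1,2)] One_in_Obj g] Id_Comp[OF o(3,4) f])
  also have "\<dots> = (Ident C \<one>\<^sub>o \<otimes>\<^sub>m f) \<cdot> (g \<otimes>\<^sub>m Ident C z)"
    by (subst TMor_Comp_typed, (rule T)+)
      (simp only: Id_Comp[OF TObj_in_Obj[OF o(1,2)] One_in_Obj g] Comp_Id[OF o(3,4) f])
  also have "Lunit C z' \<cdot> ((Ident C \<one>\<^sub>o \<otimes>\<^sub>m f) \<cdot> (g \<otimes>\<^sub>m Ident C z))
     = f \<cdot> (Lunit C z \<cdot> (g \<otimes>\<^sub>m Ident C z))"
    by (rule Comp_eq_left2, rule Lunit_natural[OF o(3,4) f], (rule T)+)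
  also have "\<dots> = f \<cdot> (contract u v g z \<cdot> Assoc C u v z)"
    by (simp only: contract_Assoc[OF g o(1-3)])
  also have "\<dots> = (f \<cdot> contract u v g z) \<cdot> Assoc C u v z"
    by (rule Comp_assoc_typed, (rule T)+)
  finally show "(contract u v g z' \<cdot> (Ident C u \<otimes>\<^sub>m (Ident C v \<otimes>\<^sub>m f))) \<cdot> Assoc C u v z
     = (f \<cdot> contract u v g z) \<cdot> Assoc C u v z" .
qed (rule contract_in_Hom iso_typing g f o)+

lemma contract_TObj:
  assumes g: "g \<in> Hom C (u \<otimes>\<^sub>o v) \<one>\<^sub>o"
    and o: "u \<in> Obj C" "v \<in> Obj C" "w \<in> Obj C" "z \<in> Obj C"
  shows "contract u v g (w \<otimes>\<^sub>o z) \<cdot> ((Ident C u \<otimes>\<^sub>m Assoc C v w z) \<cdot> Assoc C u (v \<otimes>\<^sub>o w) z)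
     = contract u v g w \<otimes>\<^sub>m Ident C z"
proof (rule iso_mor_cancel_right[OF _ TMor_iso[OF Assoc_iso[OF o(1-3)] Id_iso[OF o(4)]]])
  note T = contract_in_Hom iso_typing g o
  let ?c = "contract u v g (w \<otimes>\<^sub>o z)" and ?a = "Assoc C u v w \<otimes>\<^sub>m Ident C z"
  have "(?c \<cdot> ((Ident C u \<otimes>\<^sub>m Assoc C v w z) \<cdot> Assoc C u (v \<otimes>\<^sub>o w) z)) \<cdot> ?a
      = ?c \<cdot> ((Ident C u \<otimes>\<^sub>m Assoc C v w z) \<cdot> (Assoc C u (v \<otimes>\<^sub>o w) z \<cdot> ?a))"
    by (subst Comp_assoc_typed[symmetric], (rule T)+, subst Comp_assoc_typed[symmetric], (rule T)+, rule refl)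
  also have "\<dots> = ?c \<cdot> (Assoc C u v (w \<otimes>\<^sub>o z) \<cdot> Assoc C (u \<otimes>\<^sub>o v) w z)"
    by (simp only: pentagon[OF o])
  also have "\<dots> = Lunit C (w \<otimes>\<^sub>o z) \<cdot> ((g \<otimes>\<^sub>m Ident C (w \<otimes>\<^sub>o z)) \<cdot> Assoc C (u \<otimes>\<^sub>o v) w z)"
    by (rule Comp_eq_left2, rule contract_Assoc, (rule T)+)
  also have "(g \<otimes>\<^sub>m Ident C (w \<otimes>\<^sub>o z)) \<cdot> Assoc C (u \<otimes>\<^sub>o v) w z
     = Assoc C \<one>\<^sub>o w z \<cdot> ((g \<otimes>\<^sub>m Ident C w) \<otimes>\<^sub>m Ident C z)"
    unfolding TMor_Id[OF o(3,4), symmetric] by (rule Assoc_natural_typed[symmetric], (rule T)+)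
  also have "Lunit C (w \<otimes>\<^sub>o z) \<cdot> (Assoc C \<one>\<^sub>o w z \<cdot> ((g \<otimes>\<^sub>m Ident C w) \<otimes>\<^sub>m Ident C z))
     = (Lunit C w \<otimes>\<^sub>m Ident C z) \<cdot> ((g \<otimes>\<^sub>m Ident C w) \<otimes>\<^sub>m Ident C z)"
    by (rule Comp_eq_left, rule Lunit_TObj, (rule T)+)
  also have "\<dots> = (Lunit C w \<cdot> (g \<otimes>\<^sub>m Ident C w)) \<otimes>\<^sub>m Ident C z"
    by (rule TMor_Comp_right_Id[symmetric], (rule T)+)
  also have "\<dots> = (contract u v g w \<cdot> Assoc C u v w) \<otimes>\<^sub>m Ident C z"
    by (simp only: contract_Assoc[OF g o(1-3)])
  also have "\<dots> = (contract u v g w \<otimes>\<^sub>m Ident C z) \<cdot> ?a"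
    by (rule TMor_Comp_right_Id, (rule T)+)
  finally show "(?c \<cdot> ((Ident C u \<otimes>\<^sub>m Assoc C v w z) \<cdot> Assoc C u (v \<otimes>\<^sub>o w) z)) \<cdot> ?a
     = (contract u v g w \<otimes>\<^sub>m Ident C z) \<cdot> ?a" .
qed (rule contract_in_Hom iso_typing g o)+


lemma contract_One:
  assumes g: "g \<in> Hom C (u \<otimes>\<^sub>o v) \<one>\<^sub>o" and o: "u \<in> Obj C" "v \<in> Obj C"
  shows "contract u v g \<one>\<^sub>o = g \<cdot> (Ident C u \<otimes>\<^sub>m Runit C v)"
proof (rule iso_mor_cancel_right[OF _ Assoc_iso[OF o One_in_Obj]])
  note T = contract_in_Hom iso_typing g o
  have "contract u v g \<one>\<^sub>o \<cdot> Assoc C u v \<one>\<^sub>o = Runit C \<one>\<^sub>o \<cdot> (g \<otimes>\<^sub>m Ident C \<one>\<^sub>o)"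
    using contract_Assoc[OF g o One_in_Obj] Lunit_eq_Runit_One by simp
  also have "\<dots> = g \<cdot> Runit C (u \<otimes>\<^sub>o v)"
    by (rule Runit_natural[OF TObj_in_Obj[OF o] One_in_Obj g])
  also have "\<dots> = g \<cdot> ((Ident C u \<otimes>\<^sub>m Runit C v) \<cdot> Assoc C u v \<one>\<^sub>o)"
    by (simp only: Runit_TObj[OF o])
  also have "\<dots> = (g \<cdot> (Ident C u \<otimes>\<^sub>m Runit C v)) \<cdot> Assoc C u v \<one>\<^sub>o"
    by (rule Comp_assoc_typed, (rule T)+)
  finally show "contract u v g \<one>\<^sub>o \<cdot> Assoc C u v \<one>\<^sub>o
      = (g \<cdot> (Ident C u \<otimes>\<^sub>m Runit C v)) \<cdot> Assoc C u v \<one>\<^sub>o" .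
qed (rule contract_in_Hom iso_typing g o)+

lemma left_dualD:
  assumes "left_dual C x x' e k"
  shows "x \<in> Obj C" "x' \<in> Obj C" "e \<in> Hom C (x' \<otimes>\<^sub>o x) \<one>\<^sub>o" "k \<in> Hom C \<one>\<^sub>o (x \<otimes>\<^sub>o x')"
    and "Runit C x \<cdot> ((Ident C x \<otimes>\<^sub>m e) \<cdot> (Assoc C x x' x \<cdot> (k \<otimes>\<^sub>m Ident C x))) = Lunit C x"
    and "contract x' x e x' \<cdot> (Ident C x' \<otimes>\<^sub>m k) = Runit C x'"
proof -
  show a: "x \<in> Obj C" "x' \<in> Obj C" "e \<in> Hom C (x' \<otimes>\<^sub>o x) \<one>\<^sub>o" "k \<in> Hom C \<one>\<^sub>o (x \<otimes>\<^sub>o x')"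
    "Runit C x \<cdot> ((Ident C x \<otimes>\<^sub>m e) \<cdot> (Assoc C x x' x \<cdot> (k \<otimes>\<^sub>m Ident C x))) = Lunit C x"
    using assms by (simp_all add: left_dual_def)
  note T = iso_typing a(1-4)
  have "contract x' x e x' \<cdot> (Ident C x' \<otimes>\<^sub>m k)
      = Lunit C x' \<cdot> (((e \<otimes>\<^sub>m Ident C x') \<cdot> Assoc_inv C x' x x') \<cdot> (Ident C x' \<otimes>\<^sub>m k))"
    unfolding contract_def by (rule Comp_assoc_typed[symmetric], (rule T)+)
  also have "((e \<otimes>\<^sub>m Ident C x') \<cdot> Assoc_inv C x' x x') \<cdot> (Ident C x' \<otimes>\<^sub>m k)
      = (e \<otimes>\<^sub>m Ident C x') \<cdot> (Assoc_inv C x' x x' \<cdot> (Ident C x' \<otimes>\<^sub>m k))"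
    by (rule Comp_assoc_typed[symmetric], (rule T)+)
  finally show "contract x' x e x' \<cdot> (Ident C x' \<otimes>\<^sub>m k) = Runit C x'"
    using assms by (simp add: left_dual_def)
qed

text \<open>
  This lemma and the next are the triangle identities with a bystander \<open>z\<close>; together they say that \<open>x' \<otimes> _\<close> is left adjoint to
  \<open>x \<otimes> _\<close>. Each follows from the corresponding identity in \<open>left_dual\<close>, tensored with \<open>z\<close> on the right.
\<close>

lemma zigzag_insert_contract:
  assumes d: "left_dual C x x' e k" and z: "z \<in> Obj C"
  shows "(Ident C x \<otimes>\<^sub>m contract x' x e z) \<cdot> (Assoc C x x' (x \<otimes>\<^sub>o z) \<cdot> (k \<otimes>\<^sub>m Ident C (x \<otimes>\<^sub>o z)))
    = Lunit C (x \<otimes>\<^sub>o z)"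
proof (rule iso_mor_cancel_right[OF _ Assoc_iso[OF One_in_Obj left_dualD(1)[OF d] z]])
  note o = left_dualD(1,2)[OF d] z
  note T = contract_in_Hom iso_typing left_dualD(3,4)[OF d] o
  let ?c = "Ident C x \<otimes>\<^sub>m contract x' x e z"
  have "(?c \<cdot> (Assoc C x x' (x \<otimes>\<^sub>o z) \<cdot> (k \<otimes>\<^sub>m Ident C (x \<otimes>\<^sub>o z)))) \<cdot> Assoc C \<one>\<^sub>o x z
      = ?c \<cdot> (Assoc C x x' (x \<otimes>\<^sub>o z) \<cdot> ((k \<otimes>\<^sub>m Ident C (x \<otimes>\<^sub>o z)) \<cdot> Assoc C \<one>\<^sub>o x z))"
    by (subst Comp_assoc_typed[symmetric], (rule T)+, subst Comp_assoc_typed[symmetric], (rule T)+, rule refl)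
  also have "(k \<otimes>\<^sub>m Ident C (x \<otimes>\<^sub>o z)) \<cdot> Assoc C \<one>\<^sub>o x z
      = Assoc C (x \<otimes>\<^sub>o x') x z \<cdot> ((k \<otimes>\<^sub>m Ident C x) \<otimes>\<^sub>m Ident C z)"
    unfolding TMor_Id[OF o(1,3), symmetric] by (rule Assoc_natural_typed[symmetric], (rule T)+)
  also have "Assoc C x x' (x \<otimes>\<^sub>o z) \<cdot> (Assoc C (x \<otimes>\<^sub>o x') x z \<cdot> ((k \<otimes>\<^sub>m Ident C x) \<otimes>\<^sub>m Ident C z))
      = ((Ident C x \<otimes>\<^sub>m Assoc C x' x z) \<cdot> (Assoc C x (x' \<otimes>\<^sub>o x) z \<cdot> (Assoc C x x' x \<otimes>\<^sub>m Ident C z)))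
        \<cdot> ((k \<otimes>\<^sub>m Ident C x) \<otimes>\<^sub>m Ident C z)"
    by (rule Comp_eq_left[OF pentagon[symmetric]], (rule T)+)
  also have "\<dots> = (Ident C x \<otimes>\<^sub>m Assoc C x' x z) \<cdot> (Assoc C x (x' \<otimes>\<^sub>o x) z
        \<cdot> ((Assoc C x x' x \<otimes>\<^sub>m Ident C z) \<cdot> ((k \<otimes>\<^sub>m Ident C x) \<otimes>\<^sub>m Ident C z)))"
    by (subst Comp_assoc_typed[symmetric], (rule T)+, subst Comp_assoc_typed[symmetric], (rule T)+, rule refl)
  also have "(Assoc C x x' x \<otimes>\<^sub>m Ident C z) \<cdot> ((k \<otimes>\<^sub>m Ident C x) \<otimes>\<^sub>m Ident C z)
      = (Assoc C x x' x \<cdot> (k \<otimes>\<^sub>m Ident C x)) \<otimes>\<^sub>m Ident C z"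
    by (rule TMor_Comp_right_Id[symmetric], (rule T)+)
  also have "?c \<cdot> ((Ident C x \<otimes>\<^sub>m Assoc C x' x z) \<cdot> (Assoc C x (x' \<otimes>\<^sub>o x) z
        \<cdot> ((Assoc C x x' x \<cdot> (k \<otimes>\<^sub>m Ident C x)) \<otimes>\<^sub>m Ident C z)))
      = (Ident C x \<otimes>\<^sub>m (contract x' x e z \<cdot> Assoc C x' x z)) \<cdot> (Assoc C x (x' \<otimes>\<^sub>o x) z
        \<cdot> ((Assoc C x x' x \<cdot> (k \<otimes>\<^sub>m Ident C x)) \<otimes>\<^sub>m Ident C z))"
    by (rule Comp_eq_left[OF TMor_Comp_left_Id[symmetric]], (rule T)+)
  also have "Ident C x \<otimes>\<^sub>m (contract x' x e z \<cdot> Assoc C x' x z)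
      = (Ident C x \<otimes>\<^sub>m Lunit C z) \<cdot> (Ident C x \<otimes>\<^sub>m (e \<otimes>\<^sub>m Ident C z))"
    unfolding contract_Assoc[OF left_dualD(3)[OF d] o(2,1,3)] by (rule TMor_Comp_left_Id, (rule T)+)
  also have "((Ident C x \<otimes>\<^sub>m Lunit C z) \<cdot> (Ident C x \<otimes>\<^sub>m (e \<otimes>\<^sub>m Ident C z))) \<cdot> (Assoc C x (x' \<otimes>\<^sub>o x) z
        \<cdot> ((Assoc C x x' x \<cdot> (k \<otimes>\<^sub>m Ident C x)) \<otimes>\<^sub>m Ident C z))
      = (Ident C x \<otimes>\<^sub>m Lunit C z) \<cdot> ((Ident C x \<otimes>\<^sub>m (e \<otimes>\<^sub>m Ident C z)) \<cdot> (Assoc C x (x' \<otimes>\<^sub>o x) z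
        \<cdot> ((Assoc C x x' x \<cdot> (k \<otimes>\<^sub>m Ident C x)) \<otimes>\<^sub>m Ident C z)))"
    by (rule Comp_assoc_typed[symmetric], (rule T)+)
  also have "(Ident C x \<otimes>\<^sub>m (e \<otimes>\<^sub>m Ident C z)) \<cdot> (Assoc C x (x' \<otimes>\<^sub>o x) z
        \<cdot> ((Assoc C x x' x \<cdot> (k \<otimes>\<^sub>m Ident C x)) \<otimes>\<^sub>m Ident C z))
      = Assoc C x \<one>\<^sub>o z \<cdot> (((Ident C x \<otimes>\<^sub>m e) \<otimes>\<^sub>m Ident C z)
        \<cdot> ((Assoc C x x' x \<cdot> (k \<otimes>\<^sub>m Ident C x)) \<otimes>\<^sub>m Ident C z))"
    by (rule Comp_eq_left2[OF Assoc_natural_typed[symmetric]], (rule T)+)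
  also have "((Ident C x \<otimes>\<^sub>m e) \<otimes>\<^sub>m Ident C z) \<cdot> ((Assoc C x x' x \<cdot> (k \<otimes>\<^sub>m Ident C x)) \<otimes>\<^sub>m Ident C z)
      = ((Ident C x \<otimes>\<^sub>m e) \<cdot> (Assoc C x x' x \<cdot> (k \<otimes>\<^sub>m Ident C x))) \<otimes>\<^sub>m Ident C z"
    by (rule TMor_Comp_right_Id[symmetric], (rule T)+)
  also have "(Ident C x \<otimes>\<^sub>m Lunit C z) \<cdot> (Assoc C x \<one>\<^sub>o z
        \<cdot> (((Ident C x \<otimes>\<^sub>m e) \<cdot> (Assoc C x x' x \<cdot> (k \<otimes>\<^sub>m Ident C x))) \<otimes>\<^sub>m Ident C z))
      = (Runit C x \<otimes>\<^sub>m Ident C z)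
        \<cdot> (((Ident C x \<otimes>\<^sub>m e) \<cdot> (Assoc C x x' x \<cdot> (k \<otimes>\<^sub>m Ident C x))) \<otimes>\<^sub>m Ident C z)"
    by (rule Comp_eq_left[OF triangle], (rule T)+)
  also have "\<dots> = (Runit C x \<cdot> ((Ident C x \<otimes>\<^sub>m e) \<cdot> (Assoc C x x' x \<cdot> (k \<otimes>\<^sub>m Ident C x)))) \<otimes>\<^sub>m Ident C z"
    by (rule TMor_Comp_right_Id[symmetric], (rule T)+)
  also have "\<dots> = Lunit C (x \<otimes>\<^sub>o z) \<cdot> Assoc C \<one>\<^sub>o x z"
    by (simp only: left_dualD(5)[OF d] Lunit_TObj[OF o(1,3)])
  finally show "(?c \<cdot> (Assoc C x x' (x \<otimes>\<^sub>o z) \<cdot> (k \<otimes>\<^sub>m Ident C (x \<otimes>\<^sub>o z)))) \<cdot> Assoc C \<one>\<^sub>o x z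
      = Lunit C (x \<otimes>\<^sub>o z) \<cdot> Assoc C \<one>\<^sub>o x z" .
qed (rule contract_in_Hom iso_typing left_dualD(3,4)[OF d] left_dualD(1,2)[OF d] z)+

lemma zigzag_contract_insert:
  assumes d: "left_dual C x x' e k" and z: "z \<in> Obj C"
  shows "contract x' x e (x' \<otimes>\<^sub>o z) \<cdot> (Ident C x' \<otimes>\<^sub>m (Assoc C x x' z \<cdot> (k \<otimes>\<^sub>m Ident C z)))
    = Ident C x' \<otimes>\<^sub>m Lunit C z"
proof (rule iso_mor_cancel_right[OF _ Assoc_iso[OF left_dualD(2)[OF d] One_in_Obj z]])
  note o = left_dualD(1,2)[OF d] z
  note T = contract_in_Hom iso_typing left_dualD(3,4)[OF d] o
  let ?c = "contract x' x e (x' \<otimes>\<^sub>o z)" and ?a = "Ident C x' \<otimes>\<^sub>m Assoc C x x' z"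
  have "(?c \<cdot> (Ident C x' \<otimes>\<^sub>m (Assoc C x x' z \<cdot> (k \<otimes>\<^sub>m Ident C z)))) \<cdot> Assoc C x' \<one>\<^sub>o z
      = ?c \<cdot> (?a \<cdot> ((Ident C x' \<otimes>\<^sub>m (k \<otimes>\<^sub>m Ident C z)) \<cdot> Assoc C x' \<one>\<^sub>o z))"
    by (subst TMor_Comp_left_Id, (rule T)+, subst Comp_assoc_typed[symmetric], (rule T)+,
        subst Comp_assoc_typed[symmetric], (rule T)+, rule refl)
  also have "(Ident C x' \<otimes>\<^sub>m (k \<otimes>\<^sub>m Ident C z)) \<cdot> Assoc C x' \<one>\<^sub>o z
      = Assoc C x' (x \<otimes>\<^sub>o x') z \<cdot> ((Ident C x' \<otimes>\<^sub>m k) \<otimes>\<^sub>m Ident C z)"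
    by (rule Assoc_natural_typed[symmetric], (rule T)+)
  also have "?a \<cdot> (Assoc C x' (x \<otimes>\<^sub>o x') z \<cdot> ((Ident C x' \<otimes>\<^sub>m k) \<otimes>\<^sub>m Ident C z))
      = (?a \<cdot> Assoc C x' (x \<otimes>\<^sub>o x') z) \<cdot> ((Ident C x' \<otimes>\<^sub>m k) \<otimes>\<^sub>m Ident C z)"
    by (rule Comp_assoc_typed, (rule T)+)
  also have "?c \<cdot> \<dots> = (contract x' x e x' \<otimes>\<^sub>m Ident C z) \<cdot> ((Ident C x' \<otimes>\<^sub>m k) \<otimes>\<^sub>m Ident C z)"
    by (rule Comp_eq_left[OF contract_TObj], (rule T)+)
  also have "\<dots> = (contract x' x e x' \<cdot> (Ident C x' \<otimes>\<^sub>m k)) \<otimes>\<^sub>m Ident C z"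
    by (rule TMor_Comp_right_Id[symmetric], (rule T)+)
  also have "\<dots> = (Ident C x' \<otimes>\<^sub>m Lunit C z) \<cdot> Assoc C x' \<one>\<^sub>o z"
    by (simp only: left_dualD(6)[OF d] triangle[OF o(2,3)])
  finally show "(?c \<cdot> (Ident C x' \<otimes>\<^sub>m (Assoc C x x' z \<cdot> (k \<otimes>\<^sub>m Ident C z)))) \<cdot> Assoc C x' \<one>\<^sub>o z
      = (Ident C x' \<otimes>\<^sub>m Lunit C z) \<cdot> Assoc C x' \<one>\<^sub>o z" .
qed (rule contract_in_Hom iso_typing left_dualD(3,4)[OF d] left_dualD(1,2)[OF d] z)+

text \<open>
  The adjunct \<open>x' \<otimes> w \<rightarrow> z\<close> of a morphism \<open>w \<rightarrow> x \<otimes> z\<close> determines it: \<open>rebuild\<close> recovers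
  the morphism by inserting the coevaluation.
\<close>

lemma contract_Comp_inject:
  assumes d: "left_dual C x x' e k" and o: "w \<in> Obj C" "z \<in> Obj C"
    and h: "h \<in> Hom C w (x \<otimes>\<^sub>o z)" "h' \<in> Hom C w (x \<otimes>\<^sub>o z)"
    and eq: "contract x' x e z \<cdot> (Ident C x' \<otimes>\<^sub>m h) = contract x' x e z \<cdot> (Ident C x' \<otimes>\<^sub>m h')"
  shows "h = h'"
proof -
  note x = left_dualD(1,2)[OF d]
  have rebuild: "(Ident C x \<otimes>\<^sub>m (contract x' x e z \<cdot> (Ident C x' \<otimes>\<^sub>m f))) \<cdot> (Assoc C x x' w \<cdot> (k \<otimes>\<^sub>m Ident C w))
      = f \<cdot> Lunit C w" if f: "f \<in> Hom C w (x \<otimes>\<^sub>o z)" for f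
  proof -
    note T = contract_in_Hom iso_typing left_dualD(3,4)[OF d] x o f
    let ?c = "Ident C x \<otimes>\<^sub>m contract x' x e z"
    have "f \<cdot> Lunit C w = Lunit C (x \<otimes>\<^sub>o z) \<cdot> (Ident C \<one>\<^sub>o \<otimes>\<^sub>m f)"
      by (rule Lunit_natural[symmetric], (rule T)+)
    also have "\<dots> = (?c \<cdot> (Assoc C x x' (x \<otimes>\<^sub>o z) \<cdot> (k \<otimes>\<^sub>m Ident C (x \<otimes>\<^sub>o z)))) \<cdot> (Ident C \<one>\<^sub>o \<otimes>\<^sub>m f)"
      by (simp only: zigzag_insert_contract[OF d o(2)])
    also have "\<dots> = ?c \<cdot> (Assoc C x x' (x \<otimes>\<^sub>o z) \<cdot> ((k \<otimes>\<^sub>m Ident C (x \<otimes>\<^sub>o z)) \<cdot> (Ident C \<one>\<^sub>o \<otimes>\<^sub>m f)))"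
      by (subst Comp_assoc_typed[symmetric], (rule T)+, subst Comp_assoc_typed[symmetric], (rule T)+, rule refl)
    also have "(k \<otimes>\<^sub>m Ident C (x \<otimes>\<^sub>o z)) \<cdot> (Ident C \<one>\<^sub>o \<otimes>\<^sub>m f) = k \<otimes>\<^sub>m f"
      by (subst TMor_Comp_typed, (rule T)+)
        (simp only: Comp_Id[OF One_in_Obj TObj_in_Obj[OF x] left_dualD(4)[OF d]] Id_Comp[OF o(1) TObj_in_Obj[OF x(1) o(2)] f])
    also have "\<dots> = (Ident C (x \<otimes>\<^sub>o x') \<otimes>\<^sub>m f) \<cdot> (k \<otimes>\<^sub>m Ident C w)"
      by (subst TMor_Comp_typed, (rule T)+)
        (simp only: Id_Comp[OF One_in_Obj TObj_in_Obj[OF x] left_dualD(4)[OF d]] Comp_Id[OF o(1) TObj_in_Obj[OF x(1) o(2)] f])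
    also have "Assoc C x x' (x \<otimes>\<^sub>o z) \<cdot> ((Ident C (x \<otimes>\<^sub>o x') \<otimes>\<^sub>m f) \<cdot> (k \<otimes>\<^sub>m Ident C w))
        = (Ident C x \<otimes>\<^sub>m (Ident C x' \<otimes>\<^sub>m f)) \<cdot> (Assoc C x x' w \<cdot> (k \<otimes>\<^sub>m Ident C w))"
      unfolding TMor_Id[OF x, symmetric] by (rule Comp_eq_left2[OF Assoc_natural_typed], (rule T)+)
    also have "?c \<cdot> \<dots> = (Ident C x \<otimes>\<^sub>m (contract x' x e z \<cdot> (Ident C x' \<otimes>\<^sub>m f)))
        \<cdot> (Assoc C x x' w \<cdot> (k \<otimes>\<^sub>m Ident C w))"
      by (rule Comp_eq_left[OF TMor_Comp_left_Id[symmetric]], (rule T)+)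
    finally show ?thesis ..
  qed
  have "h \<cdot> Lunit C w = h' \<cdot> Lunit C w"
    using rebuild[OF h(1)] rebuild[OF h(2)] eq by simp
  then show ?thesis
    by (rule iso_mor_cancel_right[OF _ Lunit_iso]) (rule iso_typing h o x)+
qed

text \<open>
  The mate \<open>h\<close> bends the leg \<open>v\<close> of the pairing up with the coevaluation; evaluation bends it back down,
  and the zigzag so formed is straightened by a triangle identity. Composing \<open>h\<close> with the unitor on
  \<open>u\<close> in its defining equation saves an inverse.
\<close>

lemma eval_mate:
  assumes d: "left_dual C v v' e k" and u: "u \<in> Obj C" and g: "g \<in> Hom C (u \<otimes>\<^sub>o v) \<one>\<^sub>o"
    and h: "h \<in> Hom C u v'" "h \<cdot> Runit C u = contract u v g v' \<cdot> (Ident C u \<otimes>\<^sub>m k)"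
  shows "e \<cdot> (h \<otimes>\<^sub>m Ident C v) = g"
proof (rule iso_mor_cancel_right[OF _ TMor_iso[OF Runit_iso[OF u] Id_iso[OF left_dualD(1)[OF d]]]])
  note o = left_dualD(1,2)[OF d] u
  note T = contract_in_Hom iso_typing left_dualD(3,4)[OF d] o g h(1)
  let ?s = "(Ident C v \<otimes>\<^sub>m e) \<cdot> (Assoc C v v' v \<cdot> (k \<otimes>\<^sub>m Ident C v))"
  have "(e \<cdot> (h \<otimes>\<^sub>m Ident C v)) \<cdot> (Runit C u \<otimes>\<^sub>m Ident C v)
      = e \<cdot> ((h \<otimes>\<^sub>m Ident C v) \<cdot> (Runit C u \<otimes>\<^sub>m Ident C v))"
    by (rule Comp_assoc_typed[symmetric], (rule T)+)
  also have "(h \<otimes>\<^sub>m Ident C v) \<cdot> (Runit C u \<otimes>\<^sub>m Ident C v) = (h \<cdot> Runit C u) \<otimes>\<^sub>m Ident C v"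
    by (rule TMor_Comp_right_Id[symmetric], (rule T)+)
  also have "\<dots> = (contract u v g v' \<otimes>\<^sub>m Ident C v) \<cdot> ((Ident C u \<otimes>\<^sub>m k) \<otimes>\<^sub>m Ident C v)"
    unfolding h(2) by (rule TMor_Comp_right_Id, (rule T)+)
  also have "\<dots> = (contract u v g (v' \<otimes>\<^sub>o v) \<cdot> ((Ident C u \<otimes>\<^sub>m Assoc C v v' v) \<cdot> Assoc C u (v \<otimes>\<^sub>o v') v))
      \<cdot> ((Ident C u \<otimes>\<^sub>m k) \<otimes>\<^sub>m Ident C v)"
    by (subst contract_TObj, (rule T)+, rule refl)
  also have "\<dots> = contract u v g (v' \<otimes>\<^sub>o v) \<cdot> ((Ident C u \<otimes>\<^sub>m Assoc C v v' v)
      \<cdot> (Assoc C u (v \<otimes>\<^sub>o v') v \<cdot> ((Ident C u \<otimes>\<^sub>m k) \<otimes>\<^sub>m Ident C v)))"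
    by (subst Comp_assoc_typed[symmetric], (rule T)+, subst Comp_assoc_typed[symmetric], (rule T)+, rule refl)
  also have "Assoc C u (v \<otimes>\<^sub>o v') v \<cdot> ((Ident C u \<otimes>\<^sub>m k) \<otimes>\<^sub>m Ident C v)
      = (Ident C u \<otimes>\<^sub>m (k \<otimes>\<^sub>m Ident C v)) \<cdot> Assoc C u \<one>\<^sub>o v"
    by (rule Assoc_natural_typed, (rule T)+)
  also have "(Ident C u \<otimes>\<^sub>m Assoc C v v' v) \<cdot> ((Ident C u \<otimes>\<^sub>m (k \<otimes>\<^sub>m Ident C v)) \<cdot> Assoc C u \<one>\<^sub>o v)
      = (Ident C u \<otimes>\<^sub>m (Assoc C v v' v \<cdot> (k \<otimes>\<^sub>m Ident C v))) \<cdot> Assoc C u \<one>\<^sub>o v"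
    by (rule Comp_eq_left[OF TMor_Comp_left_Id[symmetric]], (rule T)+)
  also have "e \<cdot> (contract u v g (v' \<otimes>\<^sub>o v) \<cdot> \<dots>)
      = contract u v g \<one>\<^sub>o \<cdot> ((Ident C u \<otimes>\<^sub>m (Ident C v \<otimes>\<^sub>m e)) \<cdot> \<dots>)"
    by (rule Comp_eq_left2[OF contract_natural[symmetric]], (rule T)+)
  also have "(Ident C u \<otimes>\<^sub>m (Ident C v \<otimes>\<^sub>m e))
        \<cdot> ((Ident C u \<otimes>\<^sub>m (Assoc C v v' v \<cdot> (k \<otimes>\<^sub>m Ident C v))) \<cdot> Assoc C u \<one>\<^sub>o v)
      = (Ident C u \<otimes>\<^sub>m ?s) \<cdot> Assoc C u \<one>\<^sub>o v"
    by (rule Comp_eq_left[OF TMor_Comp_left_Id[symmetric]], (rule T)+)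
  also have "contract u v g \<one>\<^sub>o \<cdot> \<dots> = (g \<cdot> (Ident C u \<otimes>\<^sub>m Runit C v)) \<cdot> \<dots>"
    by (simp only: contract_One[OF g o(3,1)])
  also have "\<dots> = g \<cdot> ((Ident C u \<otimes>\<^sub>m Runit C v) \<cdot> ((Ident C u \<otimes>\<^sub>m ?s) \<cdot> Assoc C u \<one>\<^sub>o v))"
    by (rule Comp_assoc_typed[symmetric], (rule T)+)
  also have "(Ident C u \<otimes>\<^sub>m Runit C v) \<cdot> ((Ident C u \<otimes>\<^sub>m ?s) \<cdot> Assoc C u \<one>\<^sub>o v)
      = (Ident C u \<otimes>\<^sub>m (Runit C v \<cdot> ?s)) \<cdot> Assoc C u \<one>\<^sub>o v"
    by (rule Comp_eq_left[OF TMor_Comp_left_Id[symmetric]], (rule T)+)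
  also have "\<dots> = Runit C u \<otimes>\<^sub>m Ident C v"
    by (simp only: left_dualD(5)[OF d] triangle[OF o(3,1)])
  finally show "(e \<cdot> (h \<otimes>\<^sub>m Ident C v)) \<cdot> (Runit C u \<otimes>\<^sub>m Ident C v) = g \<cdot> (Runit C u \<otimes>\<^sub>m Ident C v)" .
qed (rule contract_in_Hom iso_typing left_dualD(3,4)[OF d] left_dualD(1,2)[OF d] u g h(1))+

text \<open>
  The pairing of \<open>y' \<otimes> x'\<close> with \<open>x \<otimes> y\<close> that evaluates the inner pair first contracts by contracting
  \<open>x\<close> and then \<open>y\<close>. This is the pairing that \<open>dual_tensor\<close> is the mate of.
\<close>

lemma contract_nested:
  assumes e: "e \<in> Hom C (x' \<otimes>\<^sub>o x) \<one>\<^sub>o" "e' \<in> Hom C (y' \<otimes>\<^sub>o y) \<one>\<^sub>o"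
    and o: "x \<in> Obj C" "x' \<in> Obj C" "y \<in> Obj C" "y' \<in> Obj C" "z \<in> Obj C"
  shows "contract y' y e' z \<cdot> ((Ident C y' \<otimes>\<^sub>m (contract x' x e (y \<otimes>\<^sub>o z) \<cdot> (Ident C x' \<otimes>\<^sub>m Assoc C x y z)))
        \<cdot> Assoc C y' x' ((x \<otimes>\<^sub>o y) \<otimes>\<^sub>o z))
    = contract (y' \<otimes>\<^sub>o x') (x \<otimes>\<^sub>o y)
        (e' \<cdot> ((Ident C y' \<otimes>\<^sub>m contract x' x e y) \<cdot> Assoc C y' x' (x \<otimes>\<^sub>o y))) z"
    (is "contract y' y e' z \<cdot> ((Ident C y' \<otimes>\<^sub>m ?f) \<cdot> ?a) = contract ?P ?X ?g z")
proof (rule iso_mor_cancel_right[OF _ Assoc_iso[OF TObj_in_Obj[OF o(4,2)] TObj_in_Obj[OF o(1,3)] o(5)]])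
  note T = contract_in_Hom iso_typing e o
  let ?b = "Assoc C y' x' ?X \<otimes>\<^sub>m Ident C z" and ?e = "contract x' x e y"
  have "(contract y' y e' z \<cdot> ((Ident C y' \<otimes>\<^sub>m ?f) \<cdot> ?a)) \<cdot> Assoc C ?P ?X z
      = contract y' y e' z \<cdot> ((Ident C y' \<otimes>\<^sub>m ?f) \<cdot> (?a \<cdot> Assoc C ?P ?X z))"
    by (subst Comp_assoc_typed[symmetric], (rule T)+, subst Comp_assoc_typed[symmetric], (rule T)+, rule refl)
  also have "?a \<cdot> Assoc C ?P ?X z
      = (Ident C y' \<otimes>\<^sub>m Assoc C x' ?X z) \<cdot> (Assoc C y' (x' \<otimes>\<^sub>o ?X) z \<cdot> ?b)"
    by (rule pentagon[symmetric], (rule T)+)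
  also have "(Ident C y' \<otimes>\<^sub>m ?f) \<cdot> \<dots>
      = (Ident C y' \<otimes>\<^sub>m (?f \<cdot> Assoc C x' ?X z)) \<cdot> (Assoc C y' (x' \<otimes>\<^sub>o ?X) z \<cdot> ?b)"
    by (rule Comp_eq_left[OF TMor_Comp_left_Id[symmetric]], (rule T)+)
  also have "?f \<cdot> Assoc C x' ?X z
      = contract x' x e (y \<otimes>\<^sub>o z) \<cdot> ((Ident C x' \<otimes>\<^sub>m Assoc C x y z) \<cdot> Assoc C x' ?X z)"
    by (rule Comp_assoc_typed[symmetric], (rule T)+)
  also have "\<dots> = ?e \<otimes>\<^sub>m Ident C z"
    by (rule contract_TObj, (rule T)+)
  also have "(Ident C y' \<otimes>\<^sub>m (?e \<otimes>\<^sub>m Ident C z)) \<cdot> (Assoc C y' (x' \<otimes>\<^sub>o ?X) z \<cdot> ?b)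
      = Assoc C y' y z \<cdot> (((Ident C y' \<otimes>\<^sub>m ?e) \<otimes>\<^sub>m Ident C z) \<cdot> ?b)"
    by (rule Comp_eq_left2[OF Assoc_natural_typed[symmetric]], (rule T)+)
  also have "((Ident C y' \<otimes>\<^sub>m ?e) \<otimes>\<^sub>m Ident C z) \<cdot> ?b
      = ((Ident C y' \<otimes>\<^sub>m ?e) \<cdot> Assoc C y' x' ?X) \<otimes>\<^sub>m Ident C z"
    by (rule TMor_Comp_right_Id[symmetric], (rule T)+)
  also have "contract y' y e' z \<cdot> (Assoc C y' y z \<cdot> (((Ident C y' \<otimes>\<^sub>m ?e) \<cdot> Assoc C y' x' ?X) \<otimes>\<^sub>m Ident C z))
      = Lunit C z \<cdot> ((e' \<otimes>\<^sub>m Ident C z) \<cdot> (((Ident C y' \<otimes>\<^sub>m ?e) \<cdot> Assoc C y' x' ?X) \<otimes>\<^sub>m Ident C z))"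
    by (rule Comp_eq_left2[OF contract_Assoc], (rule T)+)
  also have "(e' \<otimes>\<^sub>m Ident C z) \<cdot> (((Ident C y' \<otimes>\<^sub>m ?e) \<cdot> Assoc C y' x' ?X) \<otimes>\<^sub>m Ident C z)
      = ?g \<otimes>\<^sub>m Ident C z"
    by (rule TMor_Comp_right_Id[symmetric], (rule T)+)
  also have "Lunit C z \<cdot> (?g \<otimes>\<^sub>m Ident C z) = contract ?P ?X ?g z \<cdot> Assoc C ?P ?X z"
    by (rule contract_Assoc[symmetric], (rule T)+)
  finally show "(contract y' y e' z \<cdot> ((Ident C y' \<otimes>\<^sub>m ?f) \<cdot> ?a)) \<cdot> Assoc C ?P ?X z
      = contract ?P ?X ?g z \<cdot> Assoc C ?P ?X z" .
qed (rule contract_in_Hom iso_typing e o)+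

text \<open>
  If \<open>\<gamma> : y' \<otimes> x' \<rightarrow> X'\<close> is the comparison between the nested dual and a given dual \<open>X'\<close> of \<open>x \<otimes> y\<close>, it
  carries the nested coevaluation \<open>n\<close> to the given one. Both sides are morphisms
  \<open>\<one> \<rightarrow> x \<otimes> (y \<otimes> X')\<close> up to an associator, hence determined by their adjuncts
  \<open>y' \<otimes> (x' \<otimes> \<one>) \<rightarrow> X'\<close>. On both sides the adjunct is \<open>\<gamma>\<close> up to a unitor: on the left by the triangle
  identities for \<open>x\<close> and \<open>y\<close>, on the right because \<open>\<gamma>\<close> is a mate. The morphisms \<open>i\<close> and \<open>n\<close> are
  specified by equations so that no inverse of an associator or unitor appears.
\<close>

lemma coev_nested:
  assumes dx: "left_dual C x x' e k" and dy: "left_dual C y y' e' k'"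
    and dX: "left_dual C (x \<otimes>\<^sub>o y) X' E K"
    and \<gamma>: "\<gamma> \<in> Hom C (y' \<otimes>\<^sub>o x') X'"
    and \<gamma>_mate: "\<gamma> \<cdot> Runit C (y' \<otimes>\<^sub>o x') = contract (y' \<otimes>\<^sub>o x') (x \<otimes>\<^sub>o y)
        (e' \<cdot> ((Ident C y' \<otimes>\<^sub>m contract x' x e y) \<cdot> Assoc C y' x' (x \<otimes>\<^sub>o y))) X' \<cdot> (Ident C (y' \<otimes>\<^sub>o x') \<otimes>\<^sub>m K)"
    and i: "i \<in> Hom C x' (y \<otimes>\<^sub>o (y' \<otimes>\<^sub>o x'))" "i \<cdot> Lunit C x' = Assoc C y y' x' \<cdot> (k' \<otimes>\<^sub>m Ident C x')"
    and n: "n \<in> Hom C \<one>\<^sub>o ((x \<otimes>\<^sub>o y) \<otimes>\<^sub>o (y' \<otimes>\<^sub>o x'))"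
      "Assoc C x y (y' \<otimes>\<^sub>o x') \<cdot> n = (Ident C x \<otimes>\<^sub>m i) \<cdot> k"
  shows "(Ident C (x \<otimes>\<^sub>o y) \<otimes>\<^sub>m \<gamma>) \<cdot> n = K"
proof -
  note o = left_dualD(1,2)[OF dx] left_dualD(1,2)[OF dy] left_dualD(2)[OF dX]
  let ?P = "y' \<otimes>\<^sub>o x'" and ?X = "x \<otimes>\<^sub>o y"
  note T = contract_in_Hom iso_typing left_dualD(3,4)[OF dx] left_dualD(3,4)[OF dy] left_dualD(3,4)[OF dX] o \<gamma> i(1) n(1)
  let ?\<psi> = "(Ident C y \<otimes>\<^sub>m \<gamma>) \<cdot> i" and ?h = "Assoc C x y X' \<cdot> K"
  let ?cx = "contract x' x e (y \<otimes>\<^sub>o X')" and ?cy = "contract y' y e' X'"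
  have h': "Assoc C x y X' \<cdot> ((Ident C ?X \<otimes>\<^sub>m \<gamma>) \<cdot> n) = (Ident C x \<otimes>\<^sub>m ?\<psi>) \<cdot> k"
  proof -
    have "Assoc C x y X' \<cdot> ((Ident C ?X \<otimes>\<^sub>m \<gamma>) \<cdot> n)
        = (Ident C x \<otimes>\<^sub>m (Ident C y \<otimes>\<^sub>m \<gamma>)) \<cdot> (Assoc C x y ?P \<cdot> n)"
      unfolding TMor_Id[OF o(1,3), symmetric] by (rule Comp_eq_left2[OF Assoc_natural_typed], (rule T)+)
    also have "\<dots> = (Ident C x \<otimes>\<^sub>m ?\<psi>) \<cdot> k"
      unfolding n(2) by (rule Comp_eq_left[OF TMor_Comp_left_Id[symmetric]], (rule T)+)
    finally show ?thesis .
  qed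
  have "?cx \<cdot> (Ident C x' \<otimes>\<^sub>m ((Ident C x \<otimes>\<^sub>m ?\<psi>) \<cdot> k))
      = ?cx \<cdot> ((Ident C x' \<otimes>\<^sub>m (Ident C x \<otimes>\<^sub>m ?\<psi>)) \<cdot> (Ident C x' \<otimes>\<^sub>m k))"
    by (subst TMor_Comp_left_Id, (rule T)+, rule refl)
  also have "\<dots> = ?\<psi> \<cdot> (contract x' x e x' \<cdot> (Ident C x' \<otimes>\<^sub>m k))"
    by (rule Comp_eq_left2[OF contract_natural], (rule T)+)
  finally have test1: "?cx \<cdot> (Ident C x' \<otimes>\<^sub>m ((Ident C x \<otimes>\<^sub>m ?\<psi>) \<cdot> k)) = ?\<psi> \<cdot> Runit C x'"
    by (simp only: left_dualD(6)[OF dx])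
  have zig: "contract y' y e' ?P \<cdot> (Ident C y' \<otimes>\<^sub>m i) = Ident C ?P"
  proof (rule iso_mor_cancel_right[OF _ TMor_iso[OF Id_iso[OF o(4)] Lunit_iso[OF o(2)]]])
    have "(contract y' y e' ?P \<cdot> (Ident C y' \<otimes>\<^sub>m i)) \<cdot> (Ident C y' \<otimes>\<^sub>m Lunit C x')
        = contract y' y e' ?P \<cdot> ((Ident C y' \<otimes>\<^sub>m i) \<cdot> (Ident C y' \<otimes>\<^sub>m Lunit C x'))"
      by (rule Comp_assoc_typed[symmetric], (rule T)+)
    also have "(Ident C y' \<otimes>\<^sub>m i) \<cdot> (Ident C y' \<otimes>\<^sub>m Lunit C x') = Ident C y' \<otimes>\<^sub>m (i \<cdot> Lunit C x')"
      by (rule TMor_Comp_left_Id[symmetric], (rule T)+)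
    also have "contract y' y e' ?P \<cdot> \<dots> = Ident C y' \<otimes>\<^sub>m Lunit C x'"
      unfolding i(2) by (rule zigzag_contract_insert[OF dy o(2)])
    also have "\<dots> = Ident C ?P \<cdot> (Ident C y' \<otimes>\<^sub>m Lunit C x')"
      by (rule Id_Comp[symmetric, rotated 2], (rule T)+)
    finally show "(contract y' y e' ?P \<cdot> (Ident C y' \<otimes>\<^sub>m i)) \<cdot> (Ident C y' \<otimes>\<^sub>m Lunit C x')
        = Ident C ?P \<cdot> (Ident C y' \<otimes>\<^sub>m Lunit C x')" .
  qed (rule T)+
  have "?cy \<cdot> (Ident C y' \<otimes>\<^sub>m (?\<psi> \<cdot> Runit C x'))
      = ?cy \<cdot> ((Ident C y' \<otimes>\<^sub>m (Ident C y \<otimes>\<^sub>m \<gamma>)) \<cdot> ((Ident C y' \<otimes>\<^sub>m i) \<cdot> (Ident C y' \<otimes>\<^sub>m Runit C x')))"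
    by (subst Comp_assoc_typed[symmetric], (rule T)+, subst TMor_Comp_left_Id, (rule T)+,
        subst TMor_Comp_left_Id, (rule T)+, rule refl)
  also have "\<dots> = \<gamma> \<cdot> (contract y' y e' ?P \<cdot> ((Ident C y' \<otimes>\<^sub>m i) \<cdot> (Ident C y' \<otimes>\<^sub>m Runit C x')))"
    by (rule Comp_eq_left2[OF contract_natural], (rule T)+)
  also have "contract y' y e' ?P \<cdot> ((Ident C y' \<otimes>\<^sub>m i) \<cdot> (Ident C y' \<otimes>\<^sub>m Runit C x'))
      = Ident C ?P \<cdot> (Ident C y' \<otimes>\<^sub>m Runit C x')"
    by (rule Comp_eq_left[OF zig], (rule T)+)
  also have "\<dots> = Ident C y' \<otimes>\<^sub>m Runit C x'"
    by (rule Id_Comp[rotated 2], (rule T)+)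
  finally have test2: "?cy \<cdot> (Ident C y' \<otimes>\<^sub>m (?\<psi> \<cdot> Runit C x')) = \<gamma> \<cdot> (Ident C y' \<otimes>\<^sub>m Runit C x')" .
  have test2': "?cy \<cdot> (Ident C y' \<otimes>\<^sub>m (?cx \<cdot> (Ident C x' \<otimes>\<^sub>m ?h))) = \<gamma> \<cdot> (Ident C y' \<otimes>\<^sub>m Runit C x')"
  proof (rule iso_mor_cancel_right[OF _ Assoc_iso[OF o(4,2) One_in_Obj]])
    let ?a = "Assoc C y' x' \<one>\<^sub>o" and ?f = "?cx \<cdot> (Ident C x' \<otimes>\<^sub>m Assoc C x y X')"
    let ?g = "e' \<cdot> ((Ident C y' \<otimes>\<^sub>m contract x' x e y) \<cdot> Assoc C y' x' (x \<otimes>\<^sub>o y))"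
    have "(?cy \<cdot> (Ident C y' \<otimes>\<^sub>m (?cx \<cdot> (Ident C x' \<otimes>\<^sub>m ?h)))) \<cdot> ?a
       = (?cy \<cdot> ((Ident C y' \<otimes>\<^sub>m ?f) \<cdot> (Ident C y' \<otimes>\<^sub>m (Ident C x' \<otimes>\<^sub>m K)))) \<cdot> ?a"
      by (subst TMor_Comp_left_Id[of K "\<one>\<^sub>o"], (rule T)+, subst Comp_assoc_typed, (rule T)+,
          subst TMor_Comp_left_Id[of _ "x' \<otimes>\<^sub>o \<one>\<^sub>o"], (rule T)+, rule refl)
    also have "\<dots> = ?cy \<cdot> ((Ident C y' \<otimes>\<^sub>m ?f) \<cdot> ((Ident C y' \<otimes>\<^sub>m (Ident C x' \<otimes>\<^sub>m K)) \<cdot> ?a))"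
      by (subst Comp_assoc_typed[symmetric], (rule T)+, subst Comp_assoc_typed[symmetric], (rule T)+, rule refl)
    also have "(Ident C y' \<otimes>\<^sub>m (Ident C x' \<otimes>\<^sub>m K)) \<cdot> ?a = Assoc C y' x' (?X \<otimes>\<^sub>o X') \<cdot> (Ident C ?P \<otimes>\<^sub>m K)"
      unfolding TMor_Id[OF o(4,2), symmetric] by (rule Assoc_natural_typed[symmetric], (rule T)+)
    also have "(Ident C y' \<otimes>\<^sub>m ?f) \<cdot> (Assoc C y' x' (?X \<otimes>\<^sub>o X') \<cdot> (Ident C ?P \<otimes>\<^sub>m K))
       = ((Ident C y' \<otimes>\<^sub>m ?f) \<cdot> Assoc C y' x' (?X \<otimes>\<^sub>o X')) \<cdot> (Ident C ?P \<otimes>\<^sub>m K)"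
      by (rule Comp_assoc_typed, (rule T)+)
    also have "?cy \<cdot> \<dots> = contract ?P ?X ?g X' \<cdot> (Ident C ?P \<otimes>\<^sub>m K)"
      by (rule Comp_eq_left[OF contract_nested], (rule T)+)
    also have "\<dots> = \<gamma> \<cdot> ((Ident C y' \<otimes>\<^sub>m Runit C x') \<cdot> ?a)"
      by (simp only: \<gamma>_mate Runit_TObj[OF o(4,2)])
    also have "\<dots> = (\<gamma> \<cdot> (Ident C y' \<otimes>\<^sub>m Runit C x')) \<cdot> ?a"
      by (rule Comp_assoc_typed, (rule T)+)
    finally show "(?cy \<cdot> (Ident C y' \<otimes>\<^sub>m (?cx \<cdot> (Ident C x' \<otimes>\<^sub>m ?h)))) \<cdot> ?a
       = (\<gamma> \<cdot> (Ident C y' \<otimes>\<^sub>m Runit C x')) \<cdot> ?a" .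
  qed (rule T)+
  have h: "?cx \<cdot> (Ident C x' \<otimes>\<^sub>m ?h) = ?\<psi> \<cdot> Runit C x'"
    by (rule contract_Comp_inject[OF dy TObj_in_Obj[OF o(2) One_in_Obj] o(5)])
      (simp only: test2 test2' | rule T)+
  have "?h = (Ident C x \<otimes>\<^sub>m ?\<psi>) \<cdot> k"
    by (rule contract_Comp_inject[OF dx One_in_Obj TObj_in_Obj[OF o(3,5)]])
      (simp only: h test1 | rule T)+
  then have eq: "Assoc C x y X' \<cdot> ((Ident C ?X \<otimes>\<^sub>m \<gamma>) \<cdot> n) = Assoc C x y X' \<cdot> K"
    by (simp only: h')
  show ?thesis
    by (rule iso_mor_cancel_left[OF eq Assoc_iso]) (rule T)+
qed

end

section \<open>Multiplicativity of dimensions\<close>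

context spherical_braided_fusion_category
begin

lemmas DualD = left_dualD[OF left_dual_Dual]
lemmas Piv_in_Hom = iso_mor_in_Hom[OF Piv_iso]

lemma mate_in_Hom:
  assumes o: "u \<in> Obj C" "v \<in> Obj C" and g: "g \<in> Hom C (u \<otimes>\<^sub>o v) \<one>\<^sub>o"
  shows "mate C u v g \<in> Hom C u (Dual C v)"
  unfolding mate_def by (rule iso_typing DualD(2,3,4) o g)+

lemma mate_Runit:
  assumes o: "u \<in> Obj C" "v \<in> Obj C" and g: "g \<in> Hom C (u \<otimes>\<^sub>o v) \<one>\<^sub>o"
  shows "mate C u v g \<cdot> Runit C u = contract u v g (Dual C v) \<cdot> (Ident C u \<otimes>\<^sub>m Coev C v)"
proof -
  note T = contract_in_Hom iso_typing DualD(2,3,4) o g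
  have "mate C u v g = contract u v g (Dual C v) \<cdot> ((Ident C u \<otimes>\<^sub>m Coev C v) \<cdot> Runit_inv C u)"
    unfolding mate_def contract_def
    by (subst Comp_assoc_typed[symmetric], (rule T)+, subst Comp_assoc_typed[symmetric], (rule T)+, rule refl)
  also have "\<dots> = (contract u v g (Dual C v) \<cdot> (Ident C u \<otimes>\<^sub>m Coev C v)) \<cdot> Runit_inv C u"
    by (rule Comp_assoc_typed, (rule T)+)
  finally have "mate C u v g \<cdot> Runit C u
      = (contract u v g (Dual C v) \<cdot> (Ident C u \<otimes>\<^sub>m Coev C v)) \<cdot> (Runit_inv C u \<cdot> Runit C u)"
    by (simp only:) (rule Comp_assoc_typed[symmetric], (rule T)+)
  also have "Runit_inv C u \<cdot> Runit C u = Ident C (u \<otimes>\<^sub>o \<one>\<^sub>o)"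
    by (rule inv_mor_left[OF Runit_iso], (rule T)+)
  also have "(contract u v g (Dual C v) \<cdot> (Ident C u \<otimes>\<^sub>m Coev C v)) \<cdot> \<dots>
      = contract u v g (Dual C v) \<cdot> (Ident C u \<otimes>\<^sub>m Coev C v)"
    by (rule Comp_Id[rotated 2], (rule T)+)
  finally show ?thesis .
qed

lemma Ev_mate:
  assumes o: "u \<in> Obj C" "v \<in> Obj C" and g: "g \<in> Hom C (u \<otimes>\<^sub>o v) \<one>\<^sub>o"
  shows "Ev C v \<cdot> (mate C u v g \<otimes>\<^sub>m Ident C v) = g"
  by (rule eval_mate[OF left_dual_Dual[OF o(2)] o(1) g mate_in_Hom[OF o g] mate_Runit[OF o g]])

lemma dual_tensor_contract:
  "dual_tensor C x y = mate C (Dual C y \<otimes>\<^sub>o Dual C x) (x \<otimes>\<^sub>o y)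
     (Ev C y \<cdot> ((Ident C (Dual C y) \<otimes>\<^sub>m contract (Dual C x) x (Ev C x) y)
        \<cdot> Assoc C (Dual C y) (Dual C x) (x \<otimes>\<^sub>o y)))"
  by (simp only: dual_tensor_def contract_def)

lemma trace_mor_Ident:
  assumes x: "x \<in> Obj C"
  shows "trace_mor C x (Ident C x) = Ev C (Dual C x) \<cdot> ((Piv C x \<otimes>\<^sub>m Ident C (Dual C x)) \<cdot> Coev C x)"
  using Comp_Id[OF x DualD(2)[OF DualD(2)[OF x]] Piv_in_Hom[OF x]] by (simp add: trace_mor_def)

lemma trace_mor_in_Hom:
  assumes x: "x \<in> Obj C"
  shows "trace_mor C x (Ident C x) \<in> Hom C \<one>\<^sub>o \<one>\<^sub>o"
  unfolding trace_mor_Ident[OF x] by (rule iso_typing DualD(2,3,4) Piv_in_Hom x)+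

text \<open>
  Multiplicativity of dimensions. The coevaluation of \<open>x \<otimes> y\<close> is the nested one followed by
  \<open>\<gamma> = dual_tensor x y\<close> (\<open>coev_nested\<close>). Moving \<open>\<gamma>\<close> through the evaluation turns it into its dual
  \<open>\<delta>\<close>, and monoidality of the pivotal structure replaces \<open>\<delta> \<cdot> Piv (x \<otimes> y)\<close> by
  \<open>\<epsilon> \<cdot> (Piv x \<otimes> Piv y)\<close> with \<open>\<epsilon> = dual_tensor (Dual y) (Dual x)\<close>. Then both the evaluation and the
  coevaluation are nested, the loop of \<open>y\<close> closes inside the loop of \<open>x\<close>, and it contributes the
  scalar \<open>t\<close>.
\<close>

lemma trace_mor_TObj:
  assumes o: "x \<in> Obj C" "y \<in> Obj C"
    and t: "trace_mor C y (Ident C y) = Scale C t (Ident C \<one>\<^sub>o)"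
  shows "trace_mor C (x \<otimes>\<^sub>o y) (Ident C (x \<otimes>\<^sub>o y)) = Scale C t (trace_mor C x (Ident C x))"
proof -
  let ?x' = "Dual C x" and ?y' = "Dual C y" and ?X = "x \<otimes>\<^sub>o y"
  let ?P = "?y' \<otimes>\<^sub>o ?x'" and ?X' = "Dual C ?X"
  let ?x'' = "Dual C ?x'" and ?y'' = "Dual C ?y'" and ?X'' = "Dual C ?X'" and ?P' = "Dual C ?P"
  note T0 = contract_in_Hom iso_typing DualD(2,3,4) Piv_in_Hom o
  define gg where "gg = Ev C y \<cdot> ((Ident C ?y' \<otimes>\<^sub>m contract ?x' x (Ev C x) y) \<cdot> Assoc C ?y' ?x' ?X)"
  have gg: "gg \<in> Hom C (?P \<otimes>\<^sub>o ?X) \<one>\<^sub>o" unfolding gg_def by (rule T0)+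
  define \<gamma> where "\<gamma> = dual_tensor C x y"
  have \<gamma>_eq: "\<gamma> = mate C ?P ?X gg" by (simp only: \<gamma>_def dual_tensor_contract gg_def)
  have \<gamma>: "\<gamma> \<in> Hom C ?P ?X'" unfolding \<gamma>_eq by (rule mate_in_Hom gg T0)+
  have \<gamma>_mate: "\<gamma> \<cdot> Runit C ?P = contract ?P ?X gg ?X' \<cdot> (Ident C ?P \<otimes>\<^sub>m Coev C ?X)"
    unfolding \<gamma>_eq by (rule mate_Runit) (rule gg T0)+
  define i where "i = Assoc C y ?y' ?x' \<cdot> ((Coev C y \<otimes>\<^sub>m Ident C ?x') \<cdot> Lunit_inv ?x')"
  have i: "i \<in> Hom C ?x' (y \<otimes>\<^sub>o ?P)" unfolding i_def by (rule T0)+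
  have i_eq: "i \<cdot> Lunit C ?x' = Assoc C y ?y' ?x' \<cdot> (Coev C y \<otimes>\<^sub>m Ident C ?x')"
  proof -
    have "i \<cdot> Lunit C ?x' = (Assoc C y ?y' ?x' \<cdot> (Coev C y \<otimes>\<^sub>m Ident C ?x')) \<cdot> (Lunit_inv ?x' \<cdot> Lunit C ?x')"
      unfolding i_def by (subst Comp_assoc_typed, (rule T0)+, rule Comp_assoc_typed[symmetric], (rule T0)+)
    also have "Lunit_inv ?x' \<cdot> Lunit C ?x' = Ident C (\<one>\<^sub>o \<otimes>\<^sub>o ?x')"
      by (rule inv_mor_left[OF Lunit_iso], (rule T0)+)
    also have "(Assoc C y ?y' ?x' \<cdot> (Coev C y \<otimes>\<^sub>m Ident C ?x')) \<cdot> \<dots>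
        = Assoc C y ?y' ?x' \<cdot> (Coev C y \<otimes>\<^sub>m Ident C ?x')"
      by (rule Comp_Id[rotated 2], (rule T0)+)
    finally show ?thesis .
  qed
  define n where "n = Assoc_inv C x y ?P \<cdot> ((Ident C x \<otimes>\<^sub>m i) \<cdot> Coev C x)"
  have n: "n \<in> Hom C \<one>\<^sub>o (?X \<otimes>\<^sub>o ?P)" unfolding n_def by (rule T0 i)+
  have n_eq: "Assoc C x y ?P \<cdot> n = (Ident C x \<otimes>\<^sub>m i) \<cdot> Coev C x"
  proof -
    have "Assoc C x y ?P \<cdot> n = Ident C (x \<otimes>\<^sub>o (y \<otimes>\<^sub>o ?P)) \<cdot> ((Ident C x \<otimes>\<^sub>m i) \<cdot> Coev C x)"
      unfolding n_def by (rule Comp_eq_left[OF inv_mor_right[OF Assoc_iso]], (rule T0 i)+)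
    also have "\<dots> = (Ident C x \<otimes>\<^sub>m i) \<cdot> Coev C x"
      by (rule Id_Comp[rotated 2], (rule T0 i)+)
    finally show ?thesis .
  qed
  have coev: "Coev C ?X = (Ident C ?X \<otimes>\<^sub>m \<gamma>) \<cdot> n"
    by (rule coev_nested[OF left_dual_Dual[OF o(1)] left_dual_Dual[OF o(2)] left_dual_Dual[OF TObj_in_Obj[OF o]]
        \<gamma> \<gamma>_mate[unfolded gg_def] i i_eq n n_eq, symmetric])
  define \<delta> where "\<delta> = dual_mor C ?P ?X' \<gamma>"
  have h: "Ev C ?X' \<cdot> (Ident C ?X'' \<otimes>\<^sub>m \<gamma>) \<in> Hom C (?X'' \<otimes>\<^sub>o ?P) \<one>\<^sub>o"
    by (rule T0 \<gamma>)+
  have \<delta>: "\<delta> \<in> Hom C ?X'' ?P'"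
    unfolding \<delta>_def dual_mor_def by (rule mate_in_Hom h T0)+
  have \<delta>_eq: "Ev C ?P \<cdot> (\<delta> \<otimes>\<^sub>m Ident C ?P) = Ev C ?X' \<cdot> (Ident C ?X'' \<otimes>\<^sub>m \<gamma>)"
    unfolding \<delta>_def dual_mor_def by (rule Ev_mate) (rule h T0)+
  let ?c = "contract ?y'' ?y' (Ev C ?y') ?x'"
  define g' where "g' = Ev C ?x' \<cdot> ((Ident C ?x'' \<otimes>\<^sub>m ?c) \<cdot> Assoc C ?x'' ?y'' ?P)"
  have g': "g' \<in> Hom C ((?x'' \<otimes>\<^sub>o ?y'') \<otimes>\<^sub>o ?P) \<one>\<^sub>o" unfolding g'_def by (rule T0)+
  define \<epsilon> where "\<epsilon> = dual_tensor C ?y' ?x'"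
  have \<epsilon>0: "\<epsilon> = mate C (?x'' \<otimes>\<^sub>o ?y'') ?P g'" by (simp only: \<epsilon>_def dual_tensor_contract g'_def)
  have \<epsilon>: "\<epsilon> \<in> Hom C (?x'' \<otimes>\<^sub>o ?y'') ?P'" unfolding \<epsilon>0 by (rule mate_in_Hom g' T0)+
  have \<epsilon>_eq: "Ev C ?P \<cdot> (\<epsilon> \<otimes>\<^sub>m Ident C ?P) = g'" unfolding \<epsilon>0 by (rule Ev_mate) (rule g' T0)+
  have piv: "\<delta> \<cdot> Piv C ?X = \<epsilon> \<cdot> (Piv C x \<otimes>\<^sub>m Piv C y)"
    unfolding \<delta>_def \<epsilon>_def \<gamma>_def by (rule Piv_tensor[OF o])
  note T = T0 gg \<gamma> i n h \<delta> g' \<epsilon>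
  let ?q = "Piv C x \<otimes>\<^sub>m Piv C y" and ?py = "Piv C y \<otimes>\<^sub>m Ident C ?P"
  have "trace_mor C ?X (Ident C ?X) = Ev C ?X' \<cdot> ((Piv C ?X \<otimes>\<^sub>m Ident C ?X') \<cdot> ((Ident C ?X \<otimes>\<^sub>m \<gamma>) \<cdot> n))"
    unfolding trace_mor_Ident[OF TObj_in_Obj[OF o]] coev[symmetric] ..
  also have "(Piv C ?X \<otimes>\<^sub>m Ident C ?X') \<cdot> ((Ident C ?X \<otimes>\<^sub>m \<gamma>) \<cdot> n)
      = (Ident C ?X'' \<otimes>\<^sub>m \<gamma>) \<cdot> ((Piv C ?X \<otimes>\<^sub>m Ident C ?P) \<cdot> n)"
  proof (rule Comp_eq_left2)
    have PX: "Piv C ?X \<in> Hom C ?X ?X''" by (rule T)+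
    have oX: "?X \<in> Obj C" "?X'' \<in> Obj C" "?P \<in> Obj C" "?X' \<in> Obj C" by (rule T)+
    show "(Piv C ?X \<otimes>\<^sub>m Ident C ?X') \<cdot> (Ident C ?X \<otimes>\<^sub>m \<gamma>) = (Ident C ?X'' \<otimes>\<^sub>m \<gamma>) \<cdot> (Piv C ?X \<otimes>\<^sub>m Ident C ?P)"
      by (subst TMor_Comp_typed, (rule T)+, subst TMor_Comp_typed, (rule T)+)
        (simp only: Comp_Id[OF oX(1,2) PX] Id_Comp[OF oX(1,2) PX] Comp_Id[OF oX(3,4) \<gamma>] Id_Comp[OF oX(3,4) \<gamma>])
  qed (rule T)+
  also have "Ev C ?X' \<cdot> \<dots> = (Ev C ?X' \<cdot> (Ident C ?X'' \<otimes>\<^sub>m \<gamma>)) \<cdot> ((Piv C ?X \<otimes>\<^sub>m Ident C ?P) \<cdot> n)"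
    by (rule Comp_assoc_typed, (rule T)+)
  also have "\<dots> = Ev C ?P \<cdot> ((\<delta> \<otimes>\<^sub>m Ident C ?P) \<cdot> ((Piv C ?X \<otimes>\<^sub>m Ident C ?P) \<cdot> n))"
    unfolding \<delta>_eq[symmetric] by (rule Comp_assoc_typed[symmetric], (rule T)+)
  also have "(\<delta> \<otimes>\<^sub>m Ident C ?P) \<cdot> ((Piv C ?X \<otimes>\<^sub>m Ident C ?P) \<cdot> n) = ((\<delta> \<cdot> Piv C ?X) \<otimes>\<^sub>m Ident C ?P) \<cdot> n"
    by (rule Comp_eq_left[OF TMor_Comp_right_Id[symmetric]], (rule T)+)
  also have "((\<delta> \<cdot> Piv C ?X) \<otimes>\<^sub>m Ident C ?P) \<cdot> n = (\<epsilon> \<otimes>\<^sub>m Ident C ?P) \<cdot> ((?q \<otimes>\<^sub>m Ident C ?P) \<cdot> n)"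
    unfolding piv by (rule Comp_eq_left[OF TMor_Comp_right_Id[symmetric], symmetric], (rule T)+)
  also have "Ev C ?P \<cdot> \<dots> = g' \<cdot> ((?q \<otimes>\<^sub>m Ident C ?P) \<cdot> n)"
    by (rule Comp_eq_left[OF \<epsilon>_eq], (rule T)+)
  also have "\<dots> = Ev C ?x' \<cdot> ((Ident C ?x'' \<otimes>\<^sub>m ?c) \<cdot> (Assoc C ?x'' ?y'' ?P \<cdot> ((?q \<otimes>\<^sub>m Ident C ?P) \<cdot> n)))"
    unfolding g'_def
    by (subst Comp_assoc_typed[symmetric], (rule T)+, subst Comp_assoc_typed[symmetric], (rule T)+, rule refl)
  also have "Assoc C ?x'' ?y'' ?P \<cdot> ((?q \<otimes>\<^sub>m Ident C ?P) \<cdot> n) = (Piv C x \<otimes>\<^sub>m ?py) \<cdot> (Assoc C x y ?P \<cdot> n)"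
    by (rule Comp_eq_left2[OF Assoc_natural_typed], (rule T)+)
  also have "\<dots> = (Piv C x \<otimes>\<^sub>m (?py \<cdot> i)) \<cdot> Coev C x"
  proof -
    have px: "Piv C x \<cdot> Ident C x = Piv C x" by (rule Comp_Id[rotated 2], (rule T)+)
    have "(Piv C x \<otimes>\<^sub>m ?py) \<cdot> (Ident C x \<otimes>\<^sub>m i) = Piv C x \<otimes>\<^sub>m (?py \<cdot> i)"
      by (subst TMor_Comp_typed, (rule T)+) (simp only: px)
    then show ?thesis unfolding n_eq by (rule Comp_eq_left) (rule T)+
  qed
  also have "(Ident C ?x'' \<otimes>\<^sub>m ?c) \<cdot> \<dots> = (Piv C x \<otimes>\<^sub>m (?c \<cdot> (?py \<cdot> i))) \<cdot> Coev C x"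
  proof (rule Comp_eq_left)
    have px: "Ident C ?x'' \<cdot> Piv C x = Piv C x" by (rule Id_Comp[rotated 2], (rule T)+)
    show "(Ident C ?x'' \<otimes>\<^sub>m ?c) \<cdot> (Piv C x \<otimes>\<^sub>m (?py \<cdot> i)) = Piv C x \<otimes>\<^sub>m (?c \<cdot> (?py \<cdot> i))"
      by (subst TMor_Comp_typed, (rule T)+) (simp only: px)
  qed (rule T)+
  \<comment> \<open>The closed loop of \<open>y\<close>, with \<open>Dual x\<close> as a bystander.\<close>
  also have "?c \<cdot> (?py \<cdot> i) = Scale C t (Ident C ?x')"
  proof (rule iso_mor_cancel_right[OF _ Lunit_iso])
    let ?ky = "Coev C y \<otimes>\<^sub>m Ident C ?x'" and ?p = "Piv C y \<otimes>\<^sub>m Ident C ?y'" and ?l = "Lunit C ?x'"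
    have x': "?x' \<in> Obj C" by (rule T)+
    note l = Lunit_in_Hom[OF x'] Id_in_Hom[OF x'] Id_in_Hom[OF One_in_Obj] TObj_in_Obj[OF One_in_Obj x']
    have "(?c \<cdot> (?py \<cdot> i)) \<cdot> ?l = ?c \<cdot> (?py \<cdot> (i \<cdot> ?l))"
      by (subst Comp_assoc_typed[symmetric], (rule T)+, subst Comp_assoc_typed[symmetric], (rule T)+, rule refl)
    also have "?py \<cdot> (i \<cdot> ?l) = Assoc C ?y'' ?y' ?x' \<cdot> ((?p \<otimes>\<^sub>m Ident C ?x') \<cdot> ?ky)"
    proof -
      have "?py = Piv C y \<otimes>\<^sub>m (Ident C ?y' \<otimes>\<^sub>m Ident C ?x')"
        by (subst TMor_Id, (rule T)+, rule refl)
      then show ?thesis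
        unfolding i_eq by (simp only:) (rule Comp_eq_left2[OF Assoc_natural_typed[symmetric]], (rule T)+)
    qed
    also have "?c \<cdot> \<dots> = ?l \<cdot> ((Ev C ?y' \<otimes>\<^sub>m Ident C ?x') \<cdot> ((?p \<otimes>\<^sub>m Ident C ?x') \<cdot> ?ky))"
    proof -
      have "?c \<cdot> (Assoc C ?y'' ?y' ?x' \<cdot> ((?p \<otimes>\<^sub>m Ident C ?x') \<cdot> ?ky))
        = (?l \<cdot> (Ev C ?y' \<otimes>\<^sub>m Ident C ?x')) \<cdot> ((?p \<otimes>\<^sub>m Ident C ?x') \<cdot> ?ky)"
        by (rule Comp_eq_left[OF contract_Assoc], (rule T)+)
      also have "\<dots> = ?l \<cdot> ((Ev C ?y' \<otimes>\<^sub>m Ident C ?x') \<cdot> ((?p \<otimes>\<^sub>m Ident C ?x') \<cdot> ?ky))"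
        by (rule Comp_assoc_typed[symmetric], (rule T)+)
      finally show ?thesis .
    qed
    also have "(?p \<otimes>\<^sub>m Ident C ?x') \<cdot> ?ky = (?p \<cdot> Coev C y) \<otimes>\<^sub>m Ident C ?x'"
      by (rule TMor_Comp_right_Id[symmetric], (rule T)+)
    also have "(Ev C ?y' \<otimes>\<^sub>m Ident C ?x') \<cdot> \<dots> = (Ev C ?y' \<cdot> (?p \<cdot> Coev C y)) \<otimes>\<^sub>m Ident C ?x'"
      by (rule TMor_Comp_right_Id[symmetric], (rule T)+)
    also have "\<dots> = Scale C t (Ident C (\<one>\<^sub>o \<otimes>\<^sub>o ?x'))"
      by (simp only: trace_mor_Ident[OF o(2), symmetric] t TMor_Id[OF One_in_Obj x']
          TMor_Scale_left[OF One_in_Obj One_in_Obj x' x' l(3,2)])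
    also have "?l \<cdot> \<dots> = Scale C t ?l"
      by (simp only: Comp_Scale_right[OF l(4) l(4) x' l(1) Id_in_Hom[OF l(4)]] Comp_Id[OF l(4) x' l(1)])
    also have "\<dots> = Scale C t (Ident C ?x') \<cdot> ?l"
      by (simp only: Comp_Scale_left[OF l(4) x' x' l(2,1)] Id_Comp[OF l(4) x' l(1)])
    finally show "(?c \<cdot> (?py \<cdot> i)) \<cdot> ?l = Scale C t (Ident C ?x') \<cdot> ?l" .
    interpret V: vector_space "Scale C" by (rule vector_space_Scale)
    show "Scale C t (Ident C ?x') \<in> Hom C ?x' ?x'"
      by (rule V.subspace_scale[OF subspace_Hom[OF x' x'] l(2)])
  qed (rule T)+
  also have "Ev C ?x' \<cdot> ((Piv C x \<otimes>\<^sub>m Scale C t (Ident C ?x')) \<cdot> Coev C x)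
      = Scale C t (trace_mor C x (Ident C x))"
  proof -
    have a: "?x' \<in> Obj C" "?x'' \<in> Obj C" "x \<otimes>\<^sub>o ?x' \<in> Obj C" "?x'' \<otimes>\<^sub>o ?x' \<in> Obj C" by (rule T)+
    have b: "Piv C x \<in> Hom C x ?x''" "Piv C x \<otimes>\<^sub>m Ident C ?x' \<in> Hom C (x \<otimes>\<^sub>o ?x') (?x'' \<otimes>\<^sub>o ?x')"
      "(Piv C x \<otimes>\<^sub>m Ident C ?x') \<cdot> Coev C x \<in> Hom C \<one>\<^sub>o (?x'' \<otimes>\<^sub>o ?x')" by (rule T)+
    show ?thesis
      by (simp only: TMor_Scale_right[OF o(1) a(2,1,1) b(1) Id_in_Hom[OF a(1)]]
          Comp_Scale_left[OF One_in_Obj a(3,4) b(2) DualD(4)[OF o(1)]]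
          Comp_Scale_right[OF One_in_Obj a(4) One_in_Obj DualD(3)[OF a(1)] b(3)] trace_mor_Ident[OF o(1)])
  qed
  finally show ?thesis .
qed

end

lemma (in spherical_braided_fusion_category) ctrace_eqI:
  assumes "trace_mor C x f = Scale C r (Ident C \<one>\<^sub>o)"
  shows "ctrace C x f = r"
proof -
  interpret V: vector_space "Scale C" by (rule vector_space_Scale)
  have "Ident C \<one>\<^sub>o \<noteq> 0"
    using simple_One zero_object_if_Ident_zero[OF One_in_Obj] by (auto simp: simple_object_def)
  then show ?thesis unfolding ctrace_def assms by (simp add: V.scale_cancel_right)
qed

section \<open>Simple objects absorbed by an algebra\<close>

text \<open>
  If the unit were zero, so would be the left unitor of \<open>A\<close>, being multiplication by the unit, and then
  \<open>Hom \<one> A\<close>, which is one-dimensional.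
\<close>

lemma (in algebra_in) connected_unit_generates:
  assumes "connected_algebra C A"
  shows "AUnit A \<noteq> 0" and "w \<in> Hom C \<one>\<^sub>o AA \<Longrightarrow> \<exists>r. w = Scale C r (AUnit A)"
proof -
  interpret V: vector_space "Scale C" by (rule vector_space_Scale)
  let ?H = "Hom C \<one>\<^sub>o AA" and ?u = "AUnit A"
  obtain S where S: "S \<subseteq> ?H" "V.independent S" "?H \<subseteq> V.span S" "card S = V.dim ?H"
    using V.basis_exists[of ?H] by blast
  then obtain v where v: "S = {v}" using assms by (auto simp: connected_algebra_def card_1_singleton_iff)
  have multiple: "\<exists>r. w = Scale C r v" if "w \<in> ?H" for w
    using S(3) that by (auto simp: v V.span_singleton)
  have "v \<in> ?H" "v \<noteq> 0" using S(1,2) by (auto simp: v V.dependent_zero)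
  note o = AObj_in_Obj One_in_Obj TObj_in_Obj[OF One_in_Obj AObj_in_Obj]
  show nz: "?u \<noteq> 0"
  proof
    assume u: "?u = 0"
    have "0 \<otimes>\<^sub>m iA = 0"
      using TMor_add_left[OF o(2,1,1,1) zero_in_Hom[OF o(2,1)] zero_in_Hom[OF o(2,1)] Id_in_Hom[OF o(1)]] by simp
    then have "Lunit C AA = 0"
      using AMult_AUnit_left Comp_zero_right[OF AMult_in_Hom o(3) TObj_in_Obj[OF o(1,1)] o(1)] by (simp add: u)
    then have "v \<cdot> Lunit C \<one>\<^sub>o = 0"
      using Lunit_natural[OF o(2,1) \<open>v \<in> ?H\<close>]
        Comp_zero_left[OF TMor_in_Hom[OF o(2,2,2,1) Id_in_Hom[OF o(2)] \<open>v \<in> ?H\<close>] TObj_in_Obj[OF o(2,2)] o(3,1)]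
      by simp
    then have "v \<cdot> Lunit C \<one>\<^sub>o = 0 \<cdot> Lunit C \<one>\<^sub>o"
      using Comp_zero_left[OF Lunit_in_Hom[OF o(2)] TObj_in_Obj[OF o(2,2)] o(2,1)] by simp
    then have "v = 0"
      by (rule iso_mor_cancel_right[OF _ Lunit_iso[OF o(2)] \<open>v \<in> ?H\<close> zero_in_Hom[OF o(2,1)] TObj_in_Obj[OF o(2,2)] o(2,1)])
    with \<open>v \<noteq> 0\<close> show False by simp
  qed
  assume w: "w \<in> ?H"
  obtain r where r: "w = Scale C r v" using multiple[OF w] by blast
  obtain q where q: "?u = Scale C q v" using multiple[OF AUnit_in_Hom] by blast
  with nz have "q \<noteq> 0" by auto
  then have "w = Scale C (r / q) ?u" by (simp add: r q)
  then show "\<exists>r. w = Scale C r ?u" by blast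
qed

text \<open>
  The free module \<open>b \<otimes> A\<close> is generated by the copy \<open>b \<otimes> \<one>\<close> of \<open>b\<close>: a module map from it is
  multiplication by its restriction \<open>i\<close> to the generators.
\<close>

lemma (in algebra_in) module_map_from_free:
  assumes b: "b \<in> Obj C"
    and \<phi>: "\<phi> \<in> Hom C (b \<otimes>\<^sub>o AA) AA"
      "\<phi> \<cdot> ((Ident C b \<otimes>\<^sub>m AMult A) \<cdot> Assoc C b AA AA) = AMult A \<cdot> (\<phi> \<otimes>\<^sub>m iA)"
    and i: "i \<in> Hom C b AA" "i \<cdot> Runit C b = \<phi> \<cdot> (Ident C b \<otimes>\<^sub>m AUnit A)"
  shows "AMult A \<cdot> (i \<otimes>\<^sub>m iA) = \<phi>"
proof (rule iso_mor_cancel_right[OF _ TMor_iso[OF Runit_iso[OF b] Id_iso[OF AObj_in_Obj]]])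
  note T = mor_typing A_typing b \<phi>(1) i(1)
  let ?\<mu> = "AMult A" and ?u = "Ident C b \<otimes>\<^sub>m AUnit A"
  have "(?\<mu> \<cdot> (i \<otimes>\<^sub>m iA)) \<cdot> (Runit C b \<otimes>\<^sub>m iA) = ?\<mu> \<cdot> ((i \<otimes>\<^sub>m iA) \<cdot> (Runit C b \<otimes>\<^sub>m iA))"
    by (rule Comp_assoc_typed[symmetric], (rule T)+)
  also have "(i \<otimes>\<^sub>m iA) \<cdot> (Runit C b \<otimes>\<^sub>m iA) = (i \<cdot> Runit C b) \<otimes>\<^sub>m iA"
    by (rule TMor_Comp_right_Id[symmetric], (rule T)+)
  also have "\<dots> = (\<phi> \<otimes>\<^sub>m iA) \<cdot> (?u \<otimes>\<^sub>m iA)"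
    unfolding i(2) by (rule TMor_Comp_right_Id, (rule T)+)
  also have "?\<mu> \<cdot> ((\<phi> \<otimes>\<^sub>m iA) \<cdot> (?u \<otimes>\<^sub>m iA))
      = \<phi> \<cdot> (((Ident C b \<otimes>\<^sub>m ?\<mu>) \<cdot> Assoc C b AA AA) \<cdot> (?u \<otimes>\<^sub>m iA))"
    by (rule Comp_eq_left2[OF \<phi>(2)[symmetric]], (rule T)+)
  also have "((Ident C b \<otimes>\<^sub>m ?\<mu>) \<cdot> Assoc C b AA AA) \<cdot> (?u \<otimes>\<^sub>m iA)
      = (Ident C b \<otimes>\<^sub>m ?\<mu>) \<cdot> (Assoc C b AA AA \<cdot> (?u \<otimes>\<^sub>m iA))"
    by (rule Comp_assoc_typed[symmetric], (rule T)+)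
  also have "Assoc C b AA AA \<cdot> (?u \<otimes>\<^sub>m iA) = (Ident C b \<otimes>\<^sub>m (AUnit A \<otimes>\<^sub>m iA)) \<cdot> Assoc C b \<one>\<^sub>o AA"
    by (rule Assoc_natural_typed, (rule T)+)
  also have "(Ident C b \<otimes>\<^sub>m ?\<mu>) \<cdot> \<dots> = (Ident C b \<otimes>\<^sub>m (?\<mu> \<cdot> (AUnit A \<otimes>\<^sub>m iA))) \<cdot> Assoc C b \<one>\<^sub>o AA"
    by (rule Comp_eq_left[OF TMor_Comp_left_Id[symmetric]], (rule T)+)
  also have "\<dots> = Runit C b \<otimes>\<^sub>m iA"
    by (simp only: AMult_AUnit_left triangle[OF b AObj_in_Obj])
  finally show "(?\<mu> \<cdot> (i \<otimes>\<^sub>m iA)) \<cdot> (Runit C b \<otimes>\<^sub>m iA) = \<phi> \<cdot> (Runit C b \<otimes>\<^sub>m iA)" .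
qed (rule mor_typing A_typing b \<phi>(1) i(1))+

lemma (in algebra_in) right_module_self: "right_module C A AA (AMult A)"
  unfolding right_module_def
  using AObj_in_Obj AMult_in_Hom AMult_assoc AMult_AUnit_right by simp

text \<open>
  The morphism \<open>i\<close> is the restriction of the given isomorphism to the generators \<open>b \<otimes> \<one>\<close> of the free
  module. It is nonzero because the zero map is an isomorphism onto \<open>A\<close> only if \<open>A = 0\<close>, when the unit
  of \<open>A\<close> would vanish.
\<close>

lemma (in algebra_in) absorbed_simple:
  assumes conn: "connected_algebra C A" and b: "b \<in> Obj C"
    and iso: "isomorphic (right_modules C A) (Act (right_modules C A) b (AA, AMult A)) (AA, AMult A)"
  shows "\<exists>i\<in>Hom C b AA. i \<noteq> 0 \<and> iso_mor C (b \<otimes>\<^sub>o AA) AA (AMult A \<cdot> (i \<otimes>\<^sub>m iA))"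
proof -
  note o = AObj_in_Obj b One_in_Obj TObj_in_Obj[OF b AObj_in_Obj]
  obtain \<phi> \<phi>' where "inverse_mor (right_modules C A) (Act (right_modules C A) b (AA, AMult A)) (AA, AMult A) \<phi> \<phi>'"
    using iso by (auto simp: isomorphic_def iso_mor_def)
  then have inv: "inverse_mor C (b \<otimes>\<^sub>o AA) AA \<phi> \<phi>'"
    and map: "\<phi> \<cdot> ((Ident C b \<otimes>\<^sub>m AMult A) \<cdot> Assoc C b AA AA) = AMult A \<cdot> (\<phi> \<otimes>\<^sub>m iA)"
    by (auto simp: inverse_mor_def right_modules_sel)
  then have \<phi>: "\<phi> \<in> Hom C (b \<otimes>\<^sub>o AA) AA" "\<phi>' \<in> Hom C AA (b \<otimes>\<^sub>o AA)" "\<phi> \<cdot> \<phi>' = Ident C AA"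
    by (auto simp: inverse_mor_def)
  note T = iso_typing A_typing \<phi>(1) b
  define i where "i = \<phi> \<cdot> ((Ident C b \<otimes>\<^sub>m AUnit A) \<cdot> Runit_inv C b)"
  have i: "i \<in> Hom C b AA" unfolding i_def by (rule T)+
  have "i \<cdot> Runit C b = (\<phi> \<cdot> (Ident C b \<otimes>\<^sub>m AUnit A)) \<cdot> (Runit_inv C b \<cdot> Runit C b)"
    unfolding i_def by (subst Comp_assoc_typed, (rule T)+, rule Comp_assoc_typed[symmetric], (rule T)+)
  also have "Runit_inv C b \<cdot> Runit C b = Ident C (b \<otimes>\<^sub>o \<one>\<^sub>o)"
    by (rule inv_mor_left[OF Runit_iso], (rule T)+)
  also have "(\<phi> \<cdot> (Ident C b \<otimes>\<^sub>m AUnit A)) \<cdot> \<dots> = \<phi> \<cdot> (Ident C b \<otimes>\<^sub>m AUnit A)"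
    by (rule Comp_Id[rotated 2], (rule T)+)
  finally have \<phi>_eq: "AMult A \<cdot> (i \<otimes>\<^sub>m iA) = \<phi>"
    by (rule module_map_from_free[OF b \<phi>(1) map i])
  have "i \<noteq> 0"
  proof
    assume "i = 0"
    moreover have "0 \<otimes>\<^sub>m iA = 0"
      using TMor_add_left[OF o(2,1,1,1) zero_in_Hom[OF o(2,1)] zero_in_Hom[OF o(2,1)] Id_in_Hom[OF o(1)]] by simp
    ultimately have "\<phi> = 0"
      using \<phi>_eq Comp_zero_right[OF AMult_in_Hom o(4) TObj_in_Obj[OF o(1,1)] o(1)] by simp
    then have "Ident C AA = 0" using \<phi>(3) Comp_zero_left[OF \<phi>(2) o(1,4,1)] by simp
    then have "AUnit A = 0"
      using Id_Comp[OF o(3,1) AUnit_in_Hom] Comp_zero_left[OF AUnit_in_Hom o(3,1,1)] by simp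
    then show False using connected_unit_generates(1)[OF conn] by simp
  qed
  moreover have "iso_mor C (b \<otimes>\<^sub>o AA) AA (AMult A \<cdot> (i \<otimes>\<^sub>m iA))"
    using inv by (auto simp: \<phi>_eq iso_mor_def)
  ultimately show ?thesis using i by blast
qed

section \<open>Triviality of the double braiding\<close>

context braided_fusion_category
begin

lemma Braid_in_Hom: "\<lbrakk>a \<in> Obj C; b \<in> Obj C\<rbrakk> \<Longrightarrow> Braid C a b \<in> Hom C (a \<otimes>\<^sub>o b) (b \<otimes>\<^sub>o a)"
  by (rule iso_mor_in_Hom[OF Braid_iso])

text \<open>
  \<open>\<mu> (i \<otimes> j)\<close> is invariant under the double braiding because \<open>A\<close> is commutative, and it is a split
  monomorphism, being the isomorphism \<open>\<mu> (i \<otimes> 1)\<close> after the split monomorphism \<open>1 \<otimes> j\<close>.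
\<close>

lemma double_braiding_trivial:
  fixes A :: "('o, 'm, 'y) algebra_object_scheme"
  assumes alg: "algebra_in C A" and comm: "commutative_algebra C A"
    and o: "b \<in> Obj C" "c \<in> Obj C"
    and i: "i \<in> Hom C b (AObj A)" "iso_mor C (b \<otimes>\<^sub>o AObj A) (AObj A) (AMult A \<cdot> (i \<otimes>\<^sub>m Ident C (AObj A)))"
    and j: "j \<in> Hom C c (AObj A)" "s \<in> Hom C (AObj A) c" "s \<cdot> j = Ident C c"
  shows "Braid C c b \<cdot> Braid C b c = Ident C (b \<otimes>\<^sub>o c)"
proof -
  interpret algebra_in C A by (rule alg)
  note T = iso_typing Braid_in_Hom A_typing o i(1) j(1,2)
  let ?\<mu> = "AMult A"
  have swap: "?\<mu> \<cdot> ((g \<otimes>\<^sub>m f) \<cdot> Braid C x y) = ?\<mu> \<cdot> (f \<otimes>\<^sub>m g)"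
    if xy: "x \<in> Obj C" "y \<in> Obj C" "f \<in> Hom C x AA" "g \<in> Hom C y AA" for f g x y
  proof -
    note T = T xy
    have "?\<mu> \<cdot> ((g \<otimes>\<^sub>m f) \<cdot> Braid C x y) = ?\<mu> \<cdot> (Braid C AA AA \<cdot> (f \<otimes>\<^sub>m g))"
      by (simp only: Braid_natural[OF xy(1) AObj_in_Obj xy(2) AObj_in_Obj xy(3,4)])
    also have "\<dots> = ?\<mu> \<cdot> (f \<otimes>\<^sub>m g)"
      by (rule Comp_eq_left[OF comm[unfolded commutative_algebra_def]], (rule T)+)
    finally show ?thesis .
  qed
  let ?\<phi> = "?\<mu> \<cdot> (i \<otimes>\<^sub>m iA)" and ?w = "Braid C c b \<cdot> Braid C b c" and ?J = "Ident C b \<otimes>\<^sub>m j"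
  have w: "?w \<in> Hom C (b \<otimes>\<^sub>o c) (b \<otimes>\<^sub>o c)" by (rule T)+
  have \<phi>J: "?\<phi> \<cdot> ?J = ?\<mu> \<cdot> (i \<otimes>\<^sub>m j)"
  proof -
    have "?\<phi> \<cdot> ?J = ?\<mu> \<cdot> ((i \<otimes>\<^sub>m iA) \<cdot> ?J)"
      by (rule Comp_assoc_typed[symmetric], (rule T)+)
    also have "(i \<otimes>\<^sub>m iA) \<cdot> ?J = i \<otimes>\<^sub>m j"
      by (subst TMor_Comp_typed, (rule T)+)
        (simp only: Comp_Id[OF o(1) AObj_in_Obj i(1)] Id_Comp[OF o(2) AObj_in_Obj j(1)])
    finally show ?thesis .
  qed
  have "?\<phi> \<cdot> (?J \<cdot> ?w) = (?\<mu> \<cdot> (i \<otimes>\<^sub>m j)) \<cdot> ?w"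
    by (rule Comp_eq_left[OF \<phi>J], (rule T)+)
  also have "\<dots> = (?\<mu> \<cdot> ((i \<otimes>\<^sub>m j) \<cdot> Braid C c b)) \<cdot> Braid C b c"
    by (subst Comp_assoc_typed, (rule T)+, subst Comp_assoc_typed[of "Braid C c b"], (rule T)+, rule refl)
  also have "\<dots> = ?\<mu> \<cdot> ((j \<otimes>\<^sub>m i) \<cdot> Braid C b c)"
    unfolding swap[OF o(2,1) j(1) i(1)] by (rule Comp_assoc_typed[symmetric], (rule T)+)
  also have "\<dots> = ?\<phi> \<cdot> ?J"
    unfolding swap[OF o(1,2) i(1) j(1)] \<phi>J ..
  finally have "?J \<cdot> ?w = ?J"
    by (rule iso_mor_cancel_left[OF _ i(2)]) (rule T)+
  moreover have sJ: "(Ident C b \<otimes>\<^sub>m s) \<cdot> ?J = Ident C (b \<otimes>\<^sub>o c)"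
    by (subst TMor_Comp_left_Id[symmetric], (rule T)+) (simp only: j(3) TMor_Id[OF o])
  moreover have "(Ident C b \<otimes>\<^sub>m s) \<cdot> (?J \<cdot> ?w) = Ident C (b \<otimes>\<^sub>o c) \<cdot> ?w"
    by (rule Comp_eq_left[OF sJ], (rule T)+)
  ultimately show ?thesis
    using Id_Comp[OF TObj_in_Obj[OF o] TObj_in_Obj[OF o] w] by simp
qed

text \<open>
  Composition with the unit \<open>u\<close> of \<open>A\<close> maps \<open>f\<close> to a multiple \<open>r u\<close>, as \<open>Hom \<one> A\<close> is a line. Then
  \<open>f - r\<close> is killed by \<open>u \<noteq> 0\<close>, so it is not invertible and vanishes by Schur's lemma. Connectedness
  thus replaces the usual argument with eigenvalues.
\<close>

lemma End_One_scalar: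
  fixes A :: "('o, 'm, 'y) algebra_object_scheme"
  assumes alg: "algebra_in C A" and conn: "connected_algebra C A" and f: "f \<in> Hom C \<one>\<^sub>o \<one>\<^sub>o"
  shows "\<exists>r. f = Scale C r (Ident C \<one>\<^sub>o)"
proof -
  interpret algebra_in C A by (rule alg)
  interpret abelian_category C using semisimple by (simp add: semisimple_def)
  note o = One_in_Obj AObj_in_Obj
  let ?u = "AUnit A" and ?I = "Ident C \<one>\<^sub>o"
  obtain r where r: "?u \<cdot> f = Scale C r ?u"
    using connected_unit_generates(2)[OF conn Comp_typed[OF f AUnit_in_Hom o(1,1,2)]] by blast
  define g where "g = f - Scale C r ?I"
  have g: "g \<in> Hom C \<one>\<^sub>o \<one>\<^sub>o"
    unfolding g_def by (rule diff_in_Hom[OF f scale_in_Hom[OF Id_in_Hom] o(1,1)]) (rule o)+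
  have "?u \<cdot> g = 0"
    unfolding g_def
    by (simp add: Comp_diff_right[OF AUnit_in_Hom f scale_in_Hom[OF Id_in_Hom[OF o(1)] o(1,1)] o(1,1,2)] r
        Comp_Scale_right[OF o(1,1,2) AUnit_in_Hom Id_in_Hom[OF o(1)]] Comp_Id[OF o AUnit_in_Hom])
  then have eq: "?u \<cdot> g = 0 \<cdot> g" using Comp_zero_left[OF g o(1,1,2)] by simp
  have "g = 0"
  proof (rule ccontr)
    assume "g \<noteq> 0"
    then have "iso_mor C \<one>\<^sub>o \<one>\<^sub>o g" by (rule schur[OF simple_One simple_One g])
    then have "?u = 0"
      by (rule iso_mor_cancel_right[OF eq _ AUnit_in_Hom zero_in_Hom[OF o] o(1,1,2)])
    then show False using connected_unit_generates(1)[OF conn] by simp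
  qed
  then show ?thesis by (auto simp: g_def)
qed

end

section \<open>Degeneracy of the S-matrix\<close>

lemma det_rank_one:
  fixes d :: "nat \<Rightarrow> 'a::field"
  assumes n: "n \<ge> 2"
  shows "det (mat n n (\<lambda>(i, j). d i * d j)) = 0"
proof -
  let ?S = "mat n n (\<lambda>(i, j). d i * d j)"
  have "\<exists>v. v \<in> carrier_vec n \<and> v \<noteq> 0\<^sub>v n \<and> (\<Sum>j<n. d j * v $ j) = 0"
  proof (cases "d 0 = 0")
    case True
    have "(\<Sum>j<n. d j * unit_vec n 0 $ j) = (\<Sum>j<n. 0)"
      by (rule sum.cong) (use True in \<open>auto simp: unit_vec_def\<close>)
    then show ?thesis using n unit_vec_nonzero[of 0 n] by (intro exI[of _ "unit_vec n 0"]) auto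
  next
    case False
    \<comment> \<open>A vector orthogonal to \<open>d\<close>, nonzero at index 1.\<close>
    let ?v = "vec n (\<lambda>j. if j = 0 then d 1 else if j = 1 then - d 0 else 0)"
    have "(\<Sum>j<n. d j * ?v $ j) = (\<Sum>j\<in>{0,1}. d j * ?v $ j)"
      by (rule sum.mono_neutral_right) (use n in auto)
    also have "\<dots> = 0" using n by simp
    finally have "(\<Sum>j<n. d j * ?v $ j) = 0" .
    moreover have "?v $ 1 \<noteq> 0\<^sub>v n $ 1" using n False by simp
    then have "?v \<noteq> 0\<^sub>v n" by metis
    ultimately show ?thesis by (intro exI[of _ ?v]) simp
  qed
  then obtain v where v: "v \<in> carrier_vec n" "v \<noteq> 0\<^sub>v n" "(\<Sum>j<n. d j * v $ j) = 0" by blast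
  have "?S *\<^sub>v v = 0\<^sub>v n"
  proof (rule eq_vecI)
    fix i assume "i < dim_vec (0\<^sub>v n)"
    then have i: "i < n" by simp
    have "(?S *\<^sub>v v) $ i = (\<Sum>j<n. d i * d j * v $ j)"
      using i v(1) by (simp add: scalar_prod_def atLeast0LessThan)
    also have "\<dots> = d i * (\<Sum>j<n. d j * v $ j)" by (simp add: sum_distrib_left mult.assoc)
    finally show "(?S *\<^sub>v v) $ i = 0\<^sub>v n $ i" using i v(3) by simp
  qed simp
  then show ?thesis using v by (auto simp: det_0_iff_vec_prod_zero[of ?S n])
qed

text \<open>
  Preservation is applied only to the regular module \<open>A\<close>: if every simple object absorbs into it, all
  double braidings of simple objects are trivial and the \<open>S\<close>-matrix is \<open>d\<^sub>i d\<^sub>j\<close>.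
\<close>

theorem (in modular_fusion_category) connected_commutative_spontaneously_broken:
  fixes A :: "('a, 'b, 'y) algebra_object_scheme"
  assumes alg: "algebra_in C A" and comm: "commutative_algebra C A" and conn: "connected_algebra C A"
    and xy: "simple_object C x" "simple_object C y" "\<not> isomorphic C x y"
  shows "spontaneously_broken C (right_modules C A)"
proof (rule ccontr)
  interpret algebra_in C A by (rule alg)
  let ?M = "right_modules C A"
  have self: "(AA, AMult A) \<in> Obj ?M" using right_module_self by (simp add: right_modules_sel)
  assume "\<not> ?thesis"
  then have pres: "isomorphic ?M (Act ?M b (AA, AMult A)) (AA, AMult A)" if "simple_object C b" for b
    using that self unfolding spontaneously_broken_def symmetry_spontaneously_broken_def by blast
  have so: "b \<in> Obj C" if "simple_object C b" for b using that by (simp add: simple_object_def)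
  have braid: "Braid C c b \<cdot> Braid C b c = Ident C (b \<otimes>\<^sub>o c)" if bc: "simple_object C b" "simple_object C c" for b c
  proof -
    obtain i where i: "i \<in> Hom C b AA" "iso_mor C (b \<otimes>\<^sub>o AA) AA (AMult A \<cdot> (i \<otimes>\<^sub>m iA))"
      using absorbed_simple[OF conn so[OF bc(1)] pres[OF bc(1)]] by blast
    obtain j where j: "j \<in> Hom C c AA" "j \<noteq> 0"
      using absorbed_simple[OF conn so[OF bc(2)] pres[OF bc(2)]] by blast
    obtain s where "s \<in> Hom C AA c" "s \<cdot> j = Ident C c"
      using simple_source_retraction[OF semisimple bc(2) AObj_in_Obj j] by blast
    then show ?thesis
      by (rule double_braiding_trivial[OF alg comm so[OF bc(1)] so[OF bc(2)] i j(1)])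
  qed
  have dim: "trace_mor C b (Ident C b) = Scale C (ctrace C b (Ident C b)) (Ident C \<one>\<^sub>o)" if b: "b \<in> Obj C" for b
    using End_One_scalar[OF alg conn trace_mor_in_Hom[OF b]] ctrace_eqI by metis
  interpret V: vector_space "Scale C" by (rule vector_space_Scale)
  have mult: "ctrace C (b \<otimes>\<^sub>o c) (Ident C (b \<otimes>\<^sub>o c)) = ctrace C b (Ident C b) * ctrace C c (Ident C c)"
    if "b \<in> Obj C" "c \<in> Obj C" for b c
    by (rule ctrace_eqI) (simp add: trace_mor_TObj[OF that dim[OF that(2)]] dim[OF that(1)] mult.commute)
  obtain xs where xs: "simple_transversal C xs" and det: "det (S_matrix C xs) \<noteq> 0"
    using S_matrix_nondegenerate by blast
  then have simple: "simple_object C (xs ! i)" if "i < length xs" for i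
    using that by (auto simp: simple_transversal_def)
  obtain a b where ab: "a \<in> set xs" "b \<in> set xs" "isomorphic C a x" "isomorphic C b y"
    using xs xy(1,2) unfolding simple_transversal_def by blast
  have "a \<noteq> b"
  proof
    assume "a = b"
    then have "isomorphic C x y"
      using isomorphic_trans[OF isomorphic_sym[OF ab(3)], of y] ab xy(1,2) xs so
      by (auto simp: simple_transversal_def)
    with xy(3) show False by simp
  qed
  then have "card {a, b} \<le> card (set xs)" by (intro card_mono) (use ab in auto)
  with \<open>a \<noteq> b\<close> have n: "length xs \<ge> 2" using card_length[of xs] by simp
  define d where "d i = ctrace C (xs ! i) (Ident C (xs ! i))" for i
  have "S_matrix C xs = mat (length xs) (length xs) (\<lambda>(i, j). d i * d j)"
    unfolding S_matrix_def by (rule eq_matI) (simp_all add: braid simple so mult d_def)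
  with det det_rank_one[OF n, of d] show False by simp
qed

lemma has_fusion_ring_two_simples:
  assumes "has_fusion_ring C R" and "a \<in> rbasis R" "b \<in> rbasis R" "a \<noteq> b"
  shows "\<exists>x y. simple_object C x \<and> simple_object C y \<and> \<not> isomorphic C x y"
  using assms unfolding has_fusion_ring_def by metis

theorem mainTheorem3:
  fixes B :: "('o, 'm::ab_group_add) pivotal_braided_category"
    and A :: "('o, 'm) algebra_object"
  assumes "modular_fusion_category B"
    and "has_fusion_ring B (cyclic_group_ring 6) \<or>
         has_fusion_ring B (tensor_ring (cyclic_group_ring 2) ising_ring) \<or>
         has_fusion_ring B (tensor_ring fib_ring (cyclic_group_ring 3)) \<or>
         has_fusion_ring B (tensor_ring fib_ring ising_ring) \<or>
         has_fusion_ring B (tensor_ring (cyclic_group_ring 2) psu2_5_ring) \<or>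
         has_fusion_ring B so5_2_ring \<or>
         has_fusion_ring B (tensor_ring fib_ring psu2_5_ring) \<or>
         has_fusion_ring B psu2_11_ring"
    and "etale_algebra B A"
    and "connected_algebra B A"
  shows "spontaneously_broken B (right_modules B A)"
proof -
  have "\<exists>x y. simple_object B x \<and> simple_object B y \<and> \<not> isomorphic B x y"
    using assms(2)
  proof (elim disjE)
    assume "has_fusion_ring B (cyclic_group_ring 6)"
    then show ?thesis
      by (rule has_fusion_ring_two_simples[of _ _ 0 1]) (simp_all add: cyclic_group_ring_def)
  next
    assume "has_fusion_ring B (tensor_ring (cyclic_group_ring 2) ising_ring)"
    then show ?thesis
      by (rule has_fusion_ring_two_simples[of _ _ "(0, Ising1)" "(1, Ising1)"])
        (simp_all add: tensor_ring_def cyclic_group_ring_def ising_ring_def)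
  next
    assume "has_fusion_ring B (tensor_ring fib_ring (cyclic_group_ring 3))"
    then show ?thesis
      by (rule has_fusion_ring_two_simples[of _ _ "(Fib1, 0)" "(Fib_tau, 0)"])
        (simp_all add: tensor_ring_def cyclic_group_ring_def fib_ring_def)
  next
    assume "has_fusion_ring B (tensor_ring fib_ring ising_ring)"
    then show ?thesis
      by (rule has_fusion_ring_two_simples[of _ _ "(Fib1, Ising1)" "(Fib_tau, Ising1)"])
        (simp_all add: tensor_ring_def fib_ring_def ising_ring_def)
  next
    assume "has_fusion_ring B (tensor_ring (cyclic_group_ring 2) psu2_5_ring)"
    then show ?thesis
      by (rule has_fusion_ring_two_simples[of _ _ "(0, P1)" "(1, P1)"])
        (simp_all add: tensor_ring_def cyclic_group_ring_def psu2_5_ring_def)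
  next
    assume "has_fusion_ring B so5_2_ring"
    then show ?thesis
      by (rule has_fusion_ring_two_simples[of _ _ I6 X6]) (simp_all add: so5_2_ring_def)
  next
    assume "has_fusion_ring B (tensor_ring fib_ring psu2_5_ring)"
    then show ?thesis
      by (rule has_fusion_ring_two_simples[of _ _ "(Fib1, P1)" "(Fib_tau, P1)"])
        (simp_all add: tensor_ring_def fib_ring_def psu2_5_ring_def)
  next
    assume "has_fusion_ring B psu2_11_ring"
    then show ?thesis
      by (rule has_fusion_ring_two_simples[of _ _ I6 X6]) (simp_all add: psu2_11_ring_def)
  qed
  then show ?thesis
    using modular_fusion_category.connected_commutative_spontaneously_broken[OF assms(1)] assms(3,4)
    by (auto simp: etale_algebra_def)
qed

end
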